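(* Let $q$ be a complex number with $|q|<1$ (equivalently, read each identity as an identity of formal power series in $q$). For every non-negative integer $p$ the following four identities hold. (1) $$\sum_{\substack{i,j,k\ge 0\\ m_p\ge\dots\ge m_1\ge 0}} \frac{q^{2m_p^2+2m_{p-1}^2+\dots+2m_1^2+i^2+j^2+k^2}}{(q^2;q^2)_{m_p-m_{p-1}}\cdots(q^2;q^2)_{m_2-m_1}(q^2;q^2)_{2m_1}}{m_1\brack i}_{q^2}{i-k\brack j}_{q^2}{j\brack k}_{q^2}$$ $$=\frac{(q^{40+64p};q^{40+64p})_\infty}{(q^2;q^2)_\infty}\left((q^{19+32p},q^{21+32p};q^{40+64p})_\infty+q^{1+2p}(q^{11+16p},q^{29+48p};q^{40+64p})_\infty\right).$$ (2) $$\sum_{\substack{i,j,k\ge 0\\ m_p\ge\dots\ge m_1\ge 0}} \frac{q^{2m_p^2+2m_{p-1}^2+\dots+2m_1^2+i^2+j^2+k^2+2j}}{(q^2;q^2)_{m_p-m_{p-1}}\cdots(q^2;q^2)_{m_2-m_1}(q^2;q^2)_{2m_1}}{m_1\brack i}_{q^2}{i-k-1\brack j}_{q^2}{j\brack k}_{q^2}$$ $$=q^{1+2p}\frac{(q^{40+64p};q^{40+64p})_\infty}{(q^2;q^2)_\infty}\left((q^{9+16p},q^{31+48p};q^{40+64p})_\infty+q^{3(1+2p)}(q,q^{39+64p};q^{40+64p})_\infty\right).$$ (3) $$\sum_{\substack{i,j,k\ge 0\\ m_p\ge\dots\ge m_1\ge 0}} \frac{q^{2m_p^2+2m_{p-1}^2+\dots+2m_2^2+4m_1^2-2im_1+i^2-2ij+j^2+k^2}}{(q^2;q^2)_{m_p-m_{p-1}}\cdots(q^2;q^2)_{m_2-m_1}(q^2;q^2)_{2m_1}}{m_1\brack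 i}_{q^2}{i-k\brack j}_{q^2}{j\brack k}_{q^2}$$ $$=\frac{(q^{24+64p};q^{24+64p})_\infty}{(q^2;q^2)_\infty}\left((q^{11+32p},q^{13+32p};q^{24+64p})_\infty+q^{1+2p}(q^{5+16p},q^{19+48p};q^{24+64p})_\infty\right).$$ (4) $$\sum_{\substack{i,j,k\ge 0\\ m_p\ge\dots\ge m_1\ge 0}} \frac{q^{2m_p^2+2m_{p-1}^2+\dots+2m_2^2+4m_1^2-2im_1+i^2-2ij+j^2+k^2}}{(q^2;q^2)_{m_p-m_{p-1}}\cdots(q^2;q^2)_{m_2-m_1}(q^2;q^2)_{2m_1}}{m_1\brack i}_{q^2}{i-k-1\brack j}_{q^2}{j\brack k}_{q^2}$$ $$=q^{1+2p}\frac{(q^{24+64p};q^{24+64p})_\infty}{(q^2;q^2)_\infty}\left((q^{7+16p},q^{17+48p};q^{24+64p})_\infty-q^{3(1+2p)-1}(q,q^{23+64p};q^{24+64p})_\infty\right).$$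
   Context: Notation: $(a;q)_0=1$, $(a;q)_n=\prod_{i=0}^{n-1}(1-aq^i)$ for $n\ge1$, $(a;q)_\infty=\prod_{i\ge0}(1-aq^i)$, and $(a_1,\dots,a_r;q)_\infty=\prod_{i}(a_i;q)_\infty$. The $q$-binomial coefficient is ${n\brack m}_q=\frac{(q;q)_n}{(q;q)_m(q;q)_{n-m}}$ if $n\ge m\ge0$ and $0$ otherwise (in particular it is $0$ whenever $n<0$); ${n\brack m}_{q^2}$ is the same with $q$ replaced by $q^2$. Reading of the left-hand sides. For $p\ge1$ the sums run over integers $i,j,k\ge0$ and $m_p\ge\dots\ge m_1\ge0$; for $p=1$ the denominator is just $(q^2;q^2)_{2m_1}$, the exponent $2m_p^2+\dots+2m_1^2$ is $2m_1^2$ and the exponent $2m_p^2+\dots+2m_2^2+4m_1^2$ is $4m_1^2$. For $p=0$ there are no summation variables $m_1,\dots,m_p$ and the left-hand sides are understood as the $L\to\infty$ limits (as formal power series) of the finite sums from which the hierarchy starts, namely: in (1), $\sum_{i,j,k\ge0}\frac{q^{i^2+j^2+k^2}}{(q^2;q^2)_i}{i-k\brack j}_{q^2}{j\brack k}_{q^2}$; in (2), $\sum_{i,j,k\ge0}\frac{q^{i^2+j^2+k^2+2j}}{(q^2;q^2)_i}{i-k-1\brack j}_{q^2}{j\brack k}_{q^2}$; in (3), $\lim_{L\to\infty}q^{2L^2}\sum_{i,j,k\ge0}q^{i^2-2ij+j^2+k^2-2iL}{L\brack i}_{q^2}{i-k\brack j}_{q^2}{j\brack k}_{q^2}$; in (4),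 $\lim_{L\to\infty}q^{2L^2}\sum_{i,j,k\ge0}q^{i^2-2ij+j^2+k^2-2iL}{L\brack i}_{q^2}{i-k-1\brack j}_{q^2}{j\brack k}_{q^2}$. *)

theory Defs
  imports "HOL-Analysis.Analysis"
begin

definition qpoch :: "complex \<Rightarrow> complex \<Rightarrow> nat \<Rightarrow> complex" where
  "qpoch a q n = (\<Prod>i<n. 1 - a * q ^ i)"

definition qpoch_inf :: "complex \<Rightarrow> complex \<Rightarrow> complex" where
  "qpoch_inf a q = (\<Prod>i. 1 - a * q ^ i)"

definition qpochs_inf :: "complex list \<Rightarrow> complex \<Rightarrow> complex" where
  "qpochs_inf as q = prod_list (map (\<lambda>a. qpoch_inf a q) as)"

(* The arguments are integers because the upper one may be negative
   (as in i - k - 1), in which case the coefficient is 0. *)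
definition qbinom :: "complex \<Rightarrow> int \<Rightarrow> int \<Rightarrow> complex" where
  "qbinom q n m =
     (if n \<ge> m \<and> m \<ge> 0
      then qpoch q q (nat n) / (qpoch q q (nat m) * qpoch q q (nat (n - m)))
      else 0)"

(* Chains m_p >= ... >= m_1 >= 0, indexed by {1..p}; extensionality makes each chain
   correspond to exactly one function. *)
definition chains :: "nat \<Rightarrow> (nat \<Rightarrow> nat) set" where
  "chains p = {m \<in> {1..p} \<rightarrow>\<^sub>E UNIV. \<forall>r\<in>{1..<p}. m r \<le> m (Suc r)}"

definition chain_denom :: "complex \<Rightarrow> nat \<Rightarrow> (nat \<Rightarrow> nat) \<Rightarrow> complex" where
  "chain_denom q p m =
     (\<Prod>r=1..<p. qpoch (q\<^sup>2) (q\<^sup>2) (m (Suc r) - m r)) * qpoch (q\<^sup>2) (q\<^sup>2) (2 * m 1)"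

(* "lhsN_is q p S": the left-hand side of the N-th identity converges, with value S.
   For p = 0 there is no chain, and the left-hand side is the limit, for L tending to
   infinity, of the finite sum from which the hierarchy starts. *)

definition lhs1_is :: "complex \<Rightarrow> nat \<Rightarrow> complex \<Rightarrow> bool" where
  "lhs1_is q p S \<longleftrightarrow>
     (if p = 0 then
        ((\<lambda>(i::nat, j::nat, k::nat).
            q ^ (i^2 + j^2 + k^2) / qpoch (q\<^sup>2) (q\<^sup>2) i
            * qbinom (q\<^sup>2) (int i - int k) (int j) * qbinom (q\<^sup>2) (int j) (int k))
         has_sum S) UNIV
      else
        ((\<lambda>((i::nat, j::nat, k::nat), m).
            q ^ (2 * (\<Sum>r=1..p. (m r)^2) + i^2 + j^2 + k^2) / chain_denom q p m
            * qbinom (q\<^sup>2) (int (m 1)) (int i)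
            * qbinom (q\<^sup>2) (int i - int k) (int j) * qbinom (q\<^sup>2) (int j) (int k))
         has_sum S) (UNIV \<times> chains p))"

definition lhs2_is :: "complex \<Rightarrow> nat \<Rightarrow> complex \<Rightarrow> bool" where
  "lhs2_is q p S \<longleftrightarrow>
     (if p = 0 then
        ((\<lambda>(i::nat, j::nat, k::nat).
            q ^ (i^2 + j^2 + k^2 + 2 * j) / qpoch (q\<^sup>2) (q\<^sup>2) i
            * qbinom (q\<^sup>2) (int i - int k - 1) (int j) * qbinom (q\<^sup>2) (int j) (int k))
         has_sum S) UNIV
      else
        ((\<lambda>((i::nat, j::nat, k::nat), m).
            q ^ (2 * (\<Sum>r=1..p. (m r)^2) + i^2 + j^2 + k^2 + 2 * j) / chain_denom q p m
            * qbinom (q\<^sup>2) (int (m 1)) (int i)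
            * qbinom (q\<^sup>2) (int i - int k - 1) (int j) * qbinom (q\<^sup>2) (int j) (int k))
         has_sum S) (UNIV \<times> chains p))"

(* In the remaining two identities the whole exponent, including the prefactor q^(2L^2)
   when p = 0, is collected into a single integer power. It is nonnegative wherever the
   q-binomials do not vanish (there j <= i, and i <= L or i <= m_1), so every summand is
   the intended polynomial or power series in q also at q = 0. For p = 0 the inner
   infinite sum has only finitely many nonzero terms. *)

definition lhs3_is :: "complex \<Rightarrow> nat \<Rightarrow> complex \<Rightarrow> bool" where
  "lhs3_is q p S \<longleftrightarrow>
     (if p = 0 then
        (\<lambda>L::nat. \<Sum>\<^sub>\<infinity>(i::nat, j::nat, k::nat)\<in>UNIV.
            q powi (2 * (int L)^2 + (int i)^2 - 2 * int i * int j + (int j)^2 + (int k)^2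
                    - 2 * int i * int L)
            * qbinom (q\<^sup>2) (int L) (int i)
            * qbinom (q\<^sup>2) (int i - int k) (int j) * qbinom (q\<^sup>2) (int j) (int k))
        \<longlonglongrightarrow> S
      else
        ((\<lambda>((i::nat, j::nat, k::nat), m).
            q powi (2 * (\<Sum>r=2..p. (int (m r))^2) + 4 * (int (m 1))^2 - 2 * int i * int (m 1)
                    + (int i)^2 - 2 * int i * int j + (int j)^2 + (int k)^2)
            / chain_denom q p m
            * qbinom (q\<^sup>2) (int (m 1)) (int i)
            * qbinom (q\<^sup>2) (int i - int k) (int j) * qbinom (q\<^sup>2) (int j) (int k))
         has_sum S) (UNIV \<times> chains p))"

definition lhs4_is :: "complex \<Rightarrow> nat \<Rightarrow> complex \<Rightarrow> bool" where
  "lhs4_is q p S \<longleftrightarrow>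
     (if p = 0 then
        (\<lambda>L::nat. \<Sum>\<^sub>\<infinity>(i::nat, j::nat, k::nat)\<in>UNIV.
            q powi (2 * (int L)^2 + (int i)^2 - 2 * int i * int j + (int j)^2 + (int k)^2
                    - 2 * int i * int L)
            * qbinom (q\<^sup>2) (int L) (int i)
            * qbinom (q\<^sup>2) (int i - int k - 1) (int j) * qbinom (q\<^sup>2) (int j) (int k))
        \<longlonglongrightarrow> S
      else
        ((\<lambda>((i::nat, j::nat, k::nat), m).
            q powi (2 * (\<Sum>r=2..p. (int (m r))^2) + 4 * (int (m 1))^2 - 2 * int i * int (m 1)
                    + (int i)^2 - 2 * int i * int j + (int j)^2 + (int k)^2)
            / chain_denom q p m
            * qbinom (q\<^sup>2) (int (m 1)) (int i)
            * qbinom (q\<^sup>2) (int i - int k - 1) (int j) * qbinom (q\<^sup>2) (int j) (int k))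
         has_sum S) (UNIV \<times> chains p))"

end

theory Submission
  imports Defs
begin

text \<open>
  Everything rests on one finite identity. With all q-binomial coefficients to the base
  \<open>q^2\<close>, and with \<open>e = 0\<close> or \<open>e = 1\<close>, put
  \<open>F_e(L) = sum_{i,j,k} q^(i^2+j^2+k^2+2ej) [L;i] [i-k-e;j] [j;k]\<close>. Then

  \<open>F_e(L) = sum_n (-1)^n q^(4n^2+(1+2e)n) (q^(A^2) [2L;L-A] + q^((A+1)^2) [2L;L-A-1])\<close>

  where \<open>A = 4n + e\<close> and \<open>n\<close> runs over all integers. Two facts give this identity.

  For fixed \<open>i\<close>, the sum over \<open>j\<close> and \<open>k\<close> is a q-analogue of the Pell numbers: it satisfies
  \<open>P(i) = (1 + q^(2i-1)) P(i-1) + q^(2i-2) P(i-2)\<close>, by two applications of the Pascal rule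
  (\<open>qpell_rec\<close>). An alternating sum of q-trinomial coefficients at the positions
  \<open>4n + e\<close> and \<open>4n + e + 1\<close> satisfies the same recurrence, because the error terms of the
  recurrence for a pair of neighbouring q-trinomial coefficients cancel between consecutive
  values of \<open>n\<close> (\<open>pair_sum_rec\<close>). So the two agree (\<open>qpell_eq_pair_sum\<close>).

  The sum over \<open>i\<close> then turns q-trinomial coefficients into central q-binomial coefficients:
  \<open>q^(a^2) [2L;L-a] = sum_i q^(i^2) [L;i] T(i,a)\<close> (\<open>qbinom_double_eq_sum_qtri\<close>). At \<open>q = 1\<close>
  this compares the coefficients of \<open>x^a\<close> in \<open>(1 + (x + 1 + 1/x))^L\<close> and in
  \<open>(x^(1/2) + x^(-1/2))^(2L)\<close>; in general it consists of two q-Vandermonde summations.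

  Replacing \<open>q\<close> by \<open>1/q\<close> and multiplying by \<open>q^(2L^2)\<close> gives a dual finite identity, in which
  \<open>4n^2+(1+2e)n\<close> changes its sign. The values \<open>e = 0, 1\<close> of the direct identity lead to the
  first two claims, those of the dual identity to the last two.

  A finite identity of this kind is the bottom of a Bailey chain. Since
  \<open>1 / ((q^2;q^2)_(N-a) (q^2;q^2)_(N+a))\<close> reproduces itself with an extra factor \<open>q^(2a^2)\<close>
  under the Bailey lemma (\<open>bailey_step\<close>), each of the \<open>p\<close> variables of a chain multiplies the
  coefficient at position \<open>a\<close> by \<open>q^(2a^2)\<close>, while letting the last variable run to infinity
  replaces the q-binomial coefficients by the constant \<open>1 / (q^2;q^2)_infinity\<close>
  (\<open>chain_has_sum\<close>). What remains are two theta series in \<open>n\<close>, with leading exponent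
  \<open>(20 + 32p) n^2\<close> or \<open>(12 + 32p) n^2\<close>, and the Jacobi triple product
  (\<open>jacobi_triple_product\<close>) turns them into the products of the claim.
\<close>

section \<open>Infinite sums with finite support\<close>

lemma infsum_diff_summable:
  fixes f g :: "'a \<Rightarrow> complex"
  assumes "f summable_on A" "g summable_on A"
  shows "(\<Sum>\<^sub>\<infinity>x\<in>A. f x - g x) = (\<Sum>\<^sub>\<infinity>x\<in>A. f x) - (\<Sum>\<^sub>\<infinity>x\<in>A. g x)"
  using infsum_add[OF assms(1), of "\<lambda>x. - g x"] assms(2) by (simp add: infsum_uminus summable_on_uminus)

lemma summable_finite_support:
  fixes f :: "'a \<Rightarrow> complex"
  assumes "finite F" "\<And>x. x \<notin> F \<Longrightarrow> f x = 0"
  shows "f summable_on UNIV"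
  by (rule finite_nonzero_values_imp_summable_on, rule finite_subset[OF _ assms(1)]) (use assms(2) in auto)

lemma infsum_finite_support:
  fixes f :: "'a \<Rightarrow> complex"
  assumes "finite F" "\<And>x. x \<notin> F \<Longrightarrow> f x = 0"
  shows "(\<Sum>\<^sub>\<infinity>x. f x) = (\<Sum>x\<in>F. f x)"
proof -
  have "infsum f UNIV = infsum f F" by (rule infsum_cong_neutral) (use assms(2) in auto)
  then show ?thesis using assms(1) by simp
qed

lemma infsum_finite_sum:
  fixes f :: "'i \<Rightarrow> 'a \<Rightarrow> complex"
  assumes "finite I" "\<And>i. i \<in> I \<Longrightarrow> f i summable_on A"
  shows "(\<Sum>\<^sub>\<infinity>x\<in>A. \<Sum>i\<in>I. f i x) = (\<Sum>i\<in>I. \<Sum>\<^sub>\<infinity>x\<in>A. f i x)"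
proof -
  have "((\<lambda>x. \<Sum>i\<in>I. f i x) has_sum (\<Sum>i\<in>I. \<Sum>\<^sub>\<infinity>x\<in>A. f i x)) A"
    using assms by (induction I rule: finite_induct) (auto intro!: has_sum_add)
  then show ?thesis by (rule infsumI)
qed

section \<open>Reciprocals of shifted factorials\<close>

text \<open>
  The reciprocal of \<open>(Q;Q)_n\<close>, continued by 0 to negative \<open>n\<close>. With this convention
  \<open>recip_qfact_step_nat\<close> holds for every integer \<open>n\<close>, so that sums over all integers can be
  shifted without looking at their boundaries.
\<close>
definition recip_qfact :: "complex \<Rightarrow> int \<Rightarrow> complex" where
  "recip_qfact Q n = (if n < 0 then 0 else inverse (qpoch Q Q (nat n)))"

text \<open>
  The value \<open>Q = 0\<close> is admitted: this locale carries what is common to the generic algebraic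
  identities and to the analysis on the open unit disc.
\<close>
locale nonroot =
  fixes Q :: complex
  assumes not_root: "n > 0 \<Longrightarrow> Q ^ n \<noteq> 1"
begin

lemma qpoch_nonzero: "qpoch Q Q n \<noteq> 0"
  using not_root[of "Suc _"] by (auto simp: qpoch_def)

lemma recip_qfact_neg [simp]: "n < 0 \<Longrightarrow> recip_qfact Q n = 0"
  by (simp add: recip_qfact_def)

lemma recip_qfact_0 [simp]: "recip_qfact Q 0 = 1"
  by (simp add: recip_qfact_def qpoch_def)

lemma recip_qfact_nonneg: "n \<ge> 0 \<Longrightarrow> recip_qfact Q n = 1 / qpoch Q Q (nat n)"
  by (simp add: recip_qfact_def field_simps)

lemma qpoch_Suc: "qpoch Q Q (Suc n) = (1 - Q ^ Suc n) * qpoch Q Q n"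
  by (simp add: qpoch_def mult.commute)

lemma recip_qfact_step_nat: "(1 - Q ^ nat n) * recip_qfact Q n = recip_qfact Q (n - 1)"
proof (cases "n \<le> 0")
  case True then show ?thesis by (auto simp: recip_qfact_def)
next
  case False
  then obtain k where k: "n = int (Suc k)" by (metis not_le zero_less_imp_eq_int gr0_implies_Suc)
  have "1 - Q ^ Suc k \<noteq> 0" using not_root[of "Suc k"] by auto
  then show ?thesis using k qpoch_nonzero[of k]
    by (simp add: recip_qfact_def qpoch_Suc nat_add_distrib del: power_Suc)
qed

lemma qbinom_eq: "qbinom Q n m = (if n \<ge> 0 then qpoch Q Q (nat n) * recip_qfact Q m * recip_qfact Q (n - m) else 0)"
  by (auto simp: qbinom_def recip_qfact_def field_simps)

end

text \<open>
  The setting of the algebraic identities. It is stable under replacing \<open>q\<close> by its inverse, and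
  \<open>q\<close> being nonzero makes exponents in all of \<open>int\<close> meaningful.
\<close>
locale generic_base =
  fixes q :: complex
  assumes q_nz: "q \<noteq> 0" and q_not_root: "n > 0 \<Longrightarrow> q ^ n \<noteq> 1"
begin

sublocale nonroot "q\<^sup>2"
  by unfold_locales (use q_not_root[of "2 * _"] in \<open>simp add: power_mult\<close>)

lemma powi_split: "a = b + c \<Longrightarrow> q powi a = q powi b * q powi c"
  using q_nz by (simp add: power_int_add)

lemma recip_qfact_step: "(1 - q powi (2 * n)) * recip_qfact (q\<^sup>2) n = recip_qfact (q\<^sup>2) (n - 1)"
proof (cases "n < 0")
  case True then show ?thesis by simp
next
  case False
  then have "q powi (2 * n) = (q\<^sup>2) ^ nat n"
    by (simp add: power_int_nonneg_exp nat_mult_distrib power_mult)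
  then show ?thesis using recip_qfact_step_nat[of n] by simp
qed

lemma not_one_powi: "m \<ge> 1 \<Longrightarrow> 1 - q powi (2 * m) \<noteq> 0"
  using q_not_root[of "nat (2 * m)"] by (simp add: power_int_nonneg_exp)

section \<open>Contiguous relations of q-trinomial coefficients\<close>

text \<open>
  Up to the factor \<open>(q^2;q^2)_L\<close> this is a q-trinomial coefficient: it enumerates the words of
  length \<open>L\<close> in the letters -1, 0, 1 with sum \<open>A\<close>, where \<open>j\<close> letters are -1, \<open>j + A\<close> letters are 1
  and the remaining \<open>n = L - 2j - A\<close> are 0; the weight is \<open>q^(n(n+s))\<close>. For \<open>s = 0\<close> and \<open>s = -1\<close>
  these are the coefficients \<open>T_0\<close> and \<open>T_1\<close> of Andrews and Baxter to the base \<open>q^2\<close>.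
\<close>
definition tri :: "int \<Rightarrow> int \<Rightarrow> int \<Rightarrow> complex" where
  "tri s L A = (\<Sum>\<^sub>\<infinity>j. q powi ((L - 2 * j - A) * (L - 2 * j - A + s)) *
     (recip_qfact (q\<^sup>2) j * recip_qfact (q\<^sup>2) (j + A) * recip_qfact (q\<^sup>2) (L - 2 * j - A)))"

lemma tri_support:
  assumes "recip_qfact (q\<^sup>2) j * recip_qfact (q\<^sup>2) (j + A) * recip_qfact (q\<^sup>2) (L - 2 * j - A) \<noteq> 0"
  shows "0 \<le> j" "0 \<le> j + A" "2 * j + A \<le> L" "j \<le> L"
proof -
  show *: "0 \<le> j" "0 \<le> j + A" "2 * j + A \<le> L"
    using assms by (auto simp: recip_qfact_def split: if_splits)
  from * show "j \<le> L" by linarith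
qed

lemma tri_summable [simp]:
  "(\<lambda>j. c j * (recip_qfact (q\<^sup>2) j * recip_qfact (q\<^sup>2) (j + A) * recip_qfact (q\<^sup>2) (L - 2 * j - A)))
     summable_on UNIV"
proof (rule summable_finite_support[of "{0..L}"])
  show "c j * (recip_qfact (q\<^sup>2) j * recip_qfact (q\<^sup>2) (j + A) * recip_qfact (q\<^sup>2) (L - 2 * j - A)) = 0"
    if "j \<notin> {0..L}" for j
    using that tri_support(1,4)[of j A L] by auto
qed simp

lemma tri_eq_0: "\<bar>A\<bar> > L \<Longrightarrow> tri s L A = 0"
proof -
  assume A: "\<bar>A\<bar> > L"
  have z: "recip_qfact (q\<^sup>2) j * recip_qfact (q\<^sup>2) (j + A) * recip_qfact (q\<^sup>2) (L - 2 * j - A) = 0" for j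
    using tri_support[of j A L] A by linarith
  show "tri s L A = 0"
    unfolding tri_def by (rule infsum_0) (simp only: z mult_zero_right)
qed

text \<open>
  The three contiguous relations come from removing one letter of each kind: the difference on
  the left inserts \<open>1 - q^(2n)\<close>, \<open>1 - q^(2j)\<close> or \<open>1 - q^(2(j+A))\<close> into the sum, and this factor
  lowers the index of one reciprocal factorial.
\<close>
lemma tri_diff_zeros:
  "tri s L A - tri (s + 2) L A = q powi (1 + s) * tri (s + 2) (L - 1) A"
proof -
  have "tri s L A - tri (s + 2) L A = (\<Sum>\<^sub>\<infinity>j. q powi (1 + s) *
      (q powi ((L - 1 - 2 * j - A) * (L - 1 - 2 * j - A + (s + 2))) *
     (recip_qfact (q\<^sup>2) j * recip_qfact (q\<^sup>2) (j + A) * recip_qfact (q\<^sup>2) (L - 1 - 2 * j - A))))"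
    unfolding tri_def
  proof (subst infsum_diff_summable[symmetric, OF tri_summable tri_summable], rule infsum_cong)
    fix j :: int
    define n where "n = L - 2 * j - A"
    have 1: "q powi (n * (n + (s + 2))) = q powi (n * (n + s)) * q powi (2 * n)"
      by (rule powi_split) (simp add: algebra_simps)
    have 2: "q powi (n * (n + s)) = q powi (1 + s) * q powi ((n - 1) * (n - 1 + (s + 2)))"
      by (rule powi_split) (simp add: algebra_simps)
    have 3: "L - 1 - 2 * j - A = n - 1" by (simp add: n_def)
    show "q powi ((L - 2 * j - A) * (L - 2 * j - A + s)) *
         (recip_qfact (q\<^sup>2) j * recip_qfact (q\<^sup>2) (j + A) * recip_qfact (q\<^sup>2) (L - 2 * j - A)) -
         q powi ((L - 2 * j - A) * (L - 2 * j - A + (s + 2))) *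
         (recip_qfact (q\<^sup>2) j * recip_qfact (q\<^sup>2) (j + A) * recip_qfact (q\<^sup>2) (L - 2 * j - A)) =
         q powi (1 + s) * (q powi ((L - 1 - 2 * j - A) * (L - 1 - 2 * j - A + (s + 2))) *
         (recip_qfact (q\<^sup>2) j * recip_qfact (q\<^sup>2) (j + A) * recip_qfact (q\<^sup>2) (L - 1 - 2 * j - A)))"
      unfolding 3 n_def[symmetric] recip_qfact_step[of n, symmetric] 1
      by (subst (1 2) 2) algebra
  qed
  also have "\<dots> = q powi (1 + s) * tri (s + 2) (L - 1) A"
    unfolding tri_def by (rule infsum_cmult_right')
  finally show ?thesis .
qed

lemma tri_diff_minus:
  "tri s L A - q powi (L - A) * tri (s - 1) L A = tri s (L - 1) (A + 1)"
proof -
  have "tri s L A - q powi (L - A) * tri (s - 1) L A = (\<Sum>\<^sub>\<infinity>j.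
      (q powi ((L - 1 - 2 * (j - 1) - (A + 1)) * (L - 1 - 2 * (j - 1) - (A + 1) + s)) *
     (recip_qfact (q\<^sup>2) (j - 1) * recip_qfact (q\<^sup>2) (j - 1 + (A + 1)) * recip_qfact (q\<^sup>2) (L - 1 - 2 * (j - 1) - (A + 1)))))"
    unfolding tri_def infsum_cmult_right'[symmetric] mult.assoc[of "q powi (L - A)", symmetric]
  proof (subst infsum_diff_summable[symmetric, OF tri_summable tri_summable], rule infsum_cong)
    fix j :: int
    define n where "n = L - 2 * j - A"
    have 1: "q powi (L - A) * q powi (n * (n + (s - 1))) = q powi (n * (n + s)) * q powi (2 * j)"
      unfolding powi_split[OF refl, symmetric] by (simp add: algebra_simps n_def)
    have 3: "L - 1 - 2 * (j - 1) - (A + 1) = n" "j - 1 + (A + 1) = j + A" by (simp_all add: n_def)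
    show "q powi ((L - 2 * j - A) * (L - 2 * j - A + s)) *
         (recip_qfact (q\<^sup>2) j * recip_qfact (q\<^sup>2) (j + A) * recip_qfact (q\<^sup>2) (L - 2 * j - A)) -
         q powi (L - A) * q powi ((L - 2 * j - A) * (L - 2 * j - A + (s - 1))) *
         (recip_qfact (q\<^sup>2) j * recip_qfact (q\<^sup>2) (j + A) * recip_qfact (q\<^sup>2) (L - 2 * j - A)) =
         q powi ((L - 1 - 2 * (j - 1) - (A + 1)) * (L - 1 - 2 * (j - 1) - (A + 1) + s)) *
     (recip_qfact (q\<^sup>2) (j - 1) * recip_qfact (q\<^sup>2) (j - 1 + (A + 1)) * recip_qfact (q\<^sup>2) (L - 1 - 2 * (j - 1) - (A + 1)))"
      unfolding 3 n_def[symmetric] recip_qfact_step[of j, symmetric] 1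
      by algebra
  qed
  also have "\<dots> = tri s (L - 1) (A + 1)"
    unfolding tri_def by (rule infsum_reindex_bij_witness[of _ "\<lambda>j. j + 1" "\<lambda>j. j - 1"]) auto
  finally show ?thesis .
qed

lemma tri_diff_plus:
  "tri s L A - q powi (L + A) * tri (s - 1) L A = tri s (L - 1) (A - 1)"
  unfolding tri_def infsum_cmult_right'[symmetric] mult.assoc[of "q powi (L + A)", symmetric]
proof (subst infsum_diff_summable[symmetric, OF tri_summable tri_summable], rule infsum_cong)
    fix j :: int
    define n where "n = L - 2 * j - A"
    have 1: "q powi (L + A) * q powi (n * (n + (s - 1))) = q powi (n * (n + s)) * q powi (2 * (j + A))"
      unfolding powi_split[OF refl, symmetric] by (simp add: algebra_simps n_def)
    have 3: "L - 1 - 2 * j - (A - 1) = n" "j + (A - 1) = (j + A) - 1" by (simp_all add: n_def)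
    show "q powi ((L - 2 * j - A) * (L - 2 * j - A + s)) *
         (recip_qfact (q\<^sup>2) j * recip_qfact (q\<^sup>2) (j + A) * recip_qfact (q\<^sup>2) (L - 2 * j - A)) -
         q powi (L + A) * q powi ((L - 2 * j - A) * (L - 2 * j - A + (s - 1))) *
         (recip_qfact (q\<^sup>2) j * recip_qfact (q\<^sup>2) (j + A) * recip_qfact (q\<^sup>2) (L - 2 * j - A)) =
         q powi ((L - 1 - 2 * j - (A - 1)) * (L - 1 - 2 * j - (A - 1) + s)) *
     (recip_qfact (q\<^sup>2) j * recip_qfact (q\<^sup>2) (j + (A - 1)) * recip_qfact (q\<^sup>2) (L - 1 - 2 * j - (A - 1)))"
      unfolding 3 n_def[symmetric] recip_qfact_step[of "j + A", symmetric] 1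
      by algebra
qed

definition qtri :: "int \<Rightarrow> int \<Rightarrow> int \<Rightarrow> complex" where
  "qtri s m A = qpoch (q\<^sup>2) (q\<^sup>2) (nat m) * tri s m A"

lemma qtri_eq_0: "\<bar>A\<bar> > m \<Longrightarrow> qtri s m A = 0"
  by (simp add: qtri_def tri_eq_0)

text \<open>
  At \<open>m = 0\<close> both sides vanish, so the relations below need no special treatment of that case.
\<close>
lemma qpoch_times_tri:
  assumes "m \<ge> 0"
  shows "qpoch (q\<^sup>2) (q\<^sup>2) (nat m) * tri s (m - 1) A = (1 - q powi (2 * m)) * qtri s (m - 1) A"
proof (cases "m = 0")
  case True then show ?thesis by (simp add: tri_eq_0 qtri_eq_0)
next
  case False
  then obtain k where k: "m = int (Suc k)" using assms
    by (metis nonneg_int_cases of_nat_0 old.nat.exhaust)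
  have "nat (2 * m) = 2 * Suc k" using k by simp
  then have "q powi (2 * m) = (q\<^sup>2) ^ Suc k"
    using k by (simp only: power_int_nonneg_exp power_mult[symmetric])
  then show ?thesis unfolding k
    by (simp only: qtri_def nat_int qpoch_Suc) simp
qed

lemma qtri_diff_zeros:
  "m \<ge> 0 \<Longrightarrow> qtri s m A - qtri (s + 2) m A = (1 - q powi (2 * m)) * (q powi (1 + s) * qtri (s + 2) (m - 1) A)"
  by (drule qpoch_times_tri[of m "s + 2" "A"]) (use tri_diff_zeros[of s m A] in \<open>unfold qtri_def, algebra\<close>)

lemma qtri_diff_minus:
  "m \<ge> 0 \<Longrightarrow> qtri s m A - q powi (m - A) * qtri (s - 1) m A = (1 - q powi (2 * m)) * qtri s (m - 1) (A + 1)"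
  by (drule qpoch_times_tri[of m "s" "A + 1"]) (use tri_diff_minus[of s m A] in \<open>unfold qtri_def, algebra\<close>)

lemma qtri_diff_plus:
  "m \<ge> 0 \<Longrightarrow> qtri s m A - q powi (m + A) * qtri (s - 1) m A = (1 - q powi (2 * m)) * qtri s (m - 1) (A - 1)"
  by (drule qpoch_times_tri[of m "s" "A - 1"]) (use tri_diff_plus[of s m A] in \<open>unfold qtri_def, algebra\<close>)

text \<open>
  The relations from here to \<open>qtri_pair_rec\<close> are linear consequences of the three contiguous
  relations. Here both sides equal \<open>1 - q^(2m)\<close> times the sum of the coefficients with \<open>s = 1\<close>
  at level \<open>m - 1\<close> and positions \<open>A\<close> and \<open>A + 1\<close>.
\<close>
lemma qtri_exchange:
  assumes "m \<ge> 0"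
  shows "qtri (-1) m A - q powi (m - A) * qtri 0 m A =
         qtri (-1) m (A + 1) - q powi (m + A + 1) * qtri 0 m (A + 1)"
  using qtri_diff_zeros[OF assms, of "-1" A] qtri_diff_zeros[OF assms, of "-1" "A + 1"]
        qtri_diff_minus[OF assms, of 1 A] qtri_diff_plus[OF assms, of 1 "A + 1"]
  by (simp add: add.assoc) algebra

text \<open>
  The factor \<open>1 - q^(2m)\<close>, split according to the letter that is removed, expresses the left-hand
  side through coefficients with \<open>s = 1\<close> and \<open>s = 0\<close> at level \<open>m - 1\<close>; those with \<open>s = 1\<close> are then
  traded for \<open>s = -1\<close> and \<open>s = 0\<close> with the help of level \<open>m - 2\<close>.
\<close>
lemma qtri_m1_rec:
  assumes "m \<ge> 1"
  shows "qtri (-1) m A = qtri (-1) (m - 1) A + q powi (m + A) * qtri 0 (m - 1) (A + 1)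
           + q powi (m - A) * qtri 0 (m - 1) (A - 1)"
proof -
  define X where "X = 1 - q powi (2 * m)"
  have X: "X \<noteq> 0" using not_one_powi[OF assms] by (simp add: X_def)
  have pp: "q powi (m - A) * q powi (m + A) = 1 - X"
    unfolding X_def powi_split[OF refl, symmetric] by simp
  have "qtri (-1) m A - qtri 1 m A = X * qtri 1 (m - 1) A"
    using qtri_diff_zeros[of m "-1" A] assms by (simp add: X_def)
  moreover have "qtri 1 m A - q powi (m - A) * qtri 0 m A = X * qtri 1 (m - 1) (A + 1)"
    using qtri_diff_minus[of m 1 A] assms by (simp add: X_def)
  moreover have "qtri 0 m A - q powi (m + A) * qtri (-1) m A = X * qtri 0 (m - 1) (A - 1)"
    using qtri_diff_plus[of m 0 A] assms by (simp add: X_def)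
  ultimately have "X * qtri (-1) m A = X * (qtri 1 (m - 1) A + qtri 1 (m - 1) (A + 1) +
      q powi (m - A) * qtri 0 (m - 1) (A - 1))" using pp by algebra
  then have 1: "qtri (-1) m A = qtri 1 (m - 1) A + qtri 1 (m - 1) (A + 1) +
      q powi (m - A) * qtri 0 (m - 1) (A - 1)" using X by simp
  have "qtri (-1) (m - 1) A - qtri 1 (m - 1) A = (1 - q powi (2 * (m - 1))) * qtri 1 (m - 2) A"
    using qtri_diff_zeros[of "m - 1" "-1" A] assms by simp
  moreover have "qtri 1 (m - 1) (A + 1) - q powi (m + A) * qtri 0 (m - 1) (A + 1) =
     (1 - q powi (2 * (m - 1))) * qtri 1 (m - 2) A"
    using qtri_diff_plus[of "m - 1" 1 "A + 1"] assms by simp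
  ultimately show ?thesis using 1 by algebra
qed

text \<open>
  The same splitting of \<open>1 - q^(2m)\<close>, with the letters removed in a different order: the two
  versions start with -1 and with 1, and 0 comes last in both.
\<close>
lemma qtri_0_rec:
  assumes "m \<ge> 1"
  shows "qtri 0 m A = qtri 0 (m - 1) (A + 1) + q powi (m - A) * qtri (-1) (m - 1) (A - 1)
           + q powi (2 * m - 1) * qtri 0 (m - 1) A"
    and "qtri 0 m A = qtri 0 (m - 1) (A - 1) + q powi (m + A) * qtri (-1) (m - 1) (A + 1)
           + q powi (2 * m - 1) * qtri 0 (m - 1) A"
proof -
  define X where "X = 1 - q powi (2 * m)"
  have X: "X \<noteq> 0" using not_one_powi[OF assms] by (simp add: X_def)
  have pp: "q powi (m - A) * q powi (m + A) = 1 - X"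
    unfolding X_def powi_split[OF refl, symmetric] by simp
  have pq: "q powi (2 * m - 1) = (1 - X) * q powi (-1)"
    unfolding X_def by (simp add: powi_split[of "2 * m - 1" "2 * m" "-1"])
  have 1: "qtri (-2) m A - qtri 0 m A = X * (q powi (-1) * qtri 0 (m - 1) A)"
    using qtri_diff_zeros[of m "-2" A] assms by (simp add: X_def)
  have 2: "qtri 0 m A - q powi (m - A) * qtri (-1) m A = X * qtri 0 (m - 1) (A + 1)"
    using qtri_diff_minus[of m 0 A] assms by (simp add: X_def)
  have 3: "qtri 0 m A - q powi (m + A) * qtri (-1) m A = X * qtri 0 (m - 1) (A - 1)"
    using qtri_diff_plus[of m 0 A] assms by (simp add: X_def)
  have 4: "qtri (-1) m A - q powi (m - A) * qtri (-2) m A = X * qtri (-1) (m - 1) (A + 1)"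
    using qtri_diff_minus[of m "-1" A] assms by (simp add: X_def)
  have 5: "qtri (-1) m A - q powi (m + A) * qtri (-2) m A = X * qtri (-1) (m - 1) (A - 1)"
    using qtri_diff_plus[of m "-1" A] assms by (simp add: X_def)
  have "X * qtri 0 m A = X * (qtri 0 (m - 1) (A + 1) + q powi (m - A) * qtri (-1) (m - 1) (A - 1)
           + q powi (2 * m - 1) * qtri 0 (m - 1) A)"
    using 1 2 5 pp pq by algebra
  then show "qtri 0 m A = qtri 0 (m - 1) (A + 1) + q powi (m - A) * qtri (-1) (m - 1) (A - 1)
           + q powi (2 * m - 1) * qtri 0 (m - 1) A" using X by simp
  have "X * qtri 0 m A = X * (qtri 0 (m - 1) (A - 1) + q powi (m + A) * qtri (-1) (m - 1) (A + 1)
           + q powi (2 * m - 1) * qtri 0 (m - 1) A)"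
    using 1 3 4 pp pq by algebra
  then show "qtri 0 m A = qtri 0 (m - 1) (A - 1) + q powi (m + A) * qtri (-1) (m - 1) (A + 1)
           + q powi (2 * m - 1) * qtri 0 (m - 1) A" using X by simp
qed

definition qtri_pair :: "int \<Rightarrow> int \<Rightarrow> complex" where
  "qtri_pair m A = qtri 0 m A + qtri 0 m (A + 1)"

text \<open>
  By \<open>qtri_exchange\<close>, this one function describes both error terms in the recurrence of
  \<open>qtri_pair\<close>, at positions that differ by 4. This is why the alternating sum has to run over
  positions in steps of 4.
\<close>
definition qtri_rest :: "int \<Rightarrow> int \<Rightarrow> complex" where
  "qtri_rest m B = qtri (-1) m (B - 1) + q powi (m + B) * qtri 0 m B"

lemma qtri_pair_rec:
  assumes "m \<ge> 2"
  shows "qtri_pair m A = (1 + q powi (2 * m - 1)) * qtri_pair (m - 1) A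
           + q powi (2 * m - 2) * qtri_pair (m - 2) A
           + q powi (m - A) * qtri_rest (m - 2) (A - 1) + q powi (m + A + 1) * qtri_rest (m - 2) (A + 3)"
proof -
  have ex: "qtri (-1) (m - 2) (A - 2) - q powi (m - A) * qtri 0 (m - 2) (A - 2) =
         qtri (-1) (m - 2) (A - 1) - q powi (m + A - 3) * qtri 0 (m - 2) (A - 1)"
    using qtri_exchange[of "m - 2" "A - 2"] assms by (simp add: algebra_simps)
  have r1: "qtri 0 m A = qtri 0 (m - 1) (A + 1) + q powi (m - A) * qtri (-1) (m - 1) (A - 1)
           + q powi (2 * m - 1) * qtri 0 (m - 1) A"
    using qtri_0_rec(1)[of m A] assms by simp
  have r2: "qtri 0 m (A + 1) = qtri 0 (m - 1) A + q powi (m + A + 1) * qtri (-1) (m - 1) (A + 2)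
           + q powi (2 * m - 1) * qtri 0 (m - 1) (A + 1)"
    using qtri_0_rec(2)[of m "A + 1"] assms by (simp add: add.assoc)
  have s1: "qtri (-1) (m - 1) (A - 1) = qtri (-1) (m - 2) (A - 1)
       + q powi (m + A - 2) * qtri 0 (m - 2) A + q powi (m - A) * qtri 0 (m - 2) (A - 2)"
    using qtri_m1_rec[of "m - 1" "A - 1"] assms by (simp add: algebra_simps)
  have s2: "qtri (-1) (m - 1) (A + 2) = qtri (-1) (m - 2) (A + 2)
       + q powi (m + A + 1) * qtri 0 (m - 2) (A + 3) + q powi (m - A - 3) * qtri 0 (m - 2) (A + 1)"
    using qtri_m1_rec[of "m - 1" "A + 2"] assms by (simp add: algebra_simps)
  have p1: "q powi (m - A) * q powi (m + A - 2) = q powi (2 * m - 2)"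
    unfolding powi_split[OF refl, symmetric] by simp
  have p2: "q powi (m + A + 1) * q powi (m - A - 3) = q powi (2 * m - 2)"
    unfolding powi_split[OF refl, symmetric] by simp
  have y1: "qtri_rest (m - 2) (A - 1) = qtri (-1) (m - 2) (A - 2) + q powi (m + A - 3) * qtri 0 (m - 2) (A - 1)"
    unfolding qtri_rest_def by (simp add: algebra_simps)
  have y2: "qtri_rest (m - 2) (A + 3) = qtri (-1) (m - 2) (A + 2) + q powi (m + A + 1) * qtri 0 (m - 2) (A + 3)"
    unfolding qtri_rest_def by (simp add: algebra_simps)
  show ?thesis
    unfolding qtri_pair_def y1 y2 r1 r2 s1 s2 using ex p1 p2 by algebra
qed

end

section \<open>The q-Vandermonde sum and central q-binomial coefficients\<close>

context generic_base
begin

text \<open>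
  The recurrence \<open>vandermonde_rec\<close> in \<open>s\<close> holds for every weight \<open>h\<close>. The constant weight gives the
  limiting sum behind the Bailey lemma, and \<open>h x = recip_qfact (q^2) (r - x)\<close> gives the
  q-Vandermonde sum.
\<close>
definition vandermonde :: "(int \<Rightarrow> complex) \<Rightarrow> int \<Rightarrow> int \<Rightarrow> complex" where
  "vandermonde h s c = (\<Sum>\<^sub>\<infinity>j. q powi (2 * (j * (j + c))) *
     (recip_qfact (q\<^sup>2) j * recip_qfact (q\<^sup>2) (j + c) * recip_qfact (q\<^sup>2) (s - j)) * h (c + j))"

text \<open>
  Write \<open>1 - q^(2s) = (1 - q^(2(s-j))) + q^(2(s-j)) (1 - q^(2j))\<close> in the term with index \<open>j\<close>: the
  first part lowers \<open>s - j\<close>, the second one lowers \<open>j\<close>.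
\<close>
lemma vandermonde_rec:
  "(1 - q powi (2 * s)) * vandermonde h s c =
     vandermonde h (s - 1) c + q powi (2 * (s + c)) * vandermonde h (s - 1) (c + 1)"
proof -
  define f where "f c s j = q powi (2 * (j * (j + c))) *
     (recip_qfact (q\<^sup>2) j * recip_qfact (q\<^sup>2) (j + c) * recip_qfact (q\<^sup>2) (s - j)) * h (c + j)" for c s j
  have V: "vandermonde h s c = infsum (f c s) UNIV" for s c
    unfolding vandermonde_def f_def by simp
  have zero: "f c s j = 0" if "j \<notin> {0..s}" for c s j
    using that by (auto simp: f_def)
  have summ: "f c s summable_on UNIV" for c s
    by (rule summable_finite_support[of "{0..s}"]) (use zero in auto)
  have summ': "(\<lambda>j. q powi (2 * (s + c)) * f (c + 1) (s - 1) (j - 1)) summable_on UNIV"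
    by (rule summable_finite_support[of "{1..s}"]) (use zero in auto)
  have step: "(1 - q powi (2 * s)) * f c s j = f c (s - 1) j + q powi (2 * (s + c)) * f (c + 1) (s - 1) (j - 1)" for j
  proof -
    have 1: "q powi (2 * s) = q powi (2 * (s - j)) * q powi (2 * j)"
      by (rule powi_split) simp
    have 2: "q powi (2 * (s + c)) * q powi (2 * ((j - 1) * (j + c))) = q powi (2 * (j * (j + c))) * q powi (2 * (s - j))"
      unfolding powi_split[OF refl, symmetric] by (simp add: algebra_simps)
    have 3: "j - 1 + (c + 1) = j + c" "s - 1 - (j - 1) = s - j" "c + 1 + (j - 1) = c + j" "s - 1 - j = (s - j) - 1"
      by auto
    show ?thesis
      unfolding f_def 3 1 recip_qfact_step[symmetric] using 2 by algebra
  qed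
  have "(1 - q powi (2 * s)) * vandermonde h s c = (\<Sum>\<^sub>\<infinity>j. (1 - q powi (2 * s)) * f c s j)"
    unfolding V by (rule infsum_cmult_right'[symmetric])
  also have "\<dots> = (\<Sum>\<^sub>\<infinity>j. f c (s - 1) j) + (\<Sum>\<^sub>\<infinity>j. q powi (2 * (s + c)) * f (c + 1) (s - 1) (j - 1))"
    unfolding step by (rule infsum_add[OF summ summ'])
  also have "(\<Sum>\<^sub>\<infinity>j. q powi (2 * (s + c)) * f (c + 1) (s - 1) (j - 1)) =
      q powi (2 * (s + c)) * (\<Sum>\<^sub>\<infinity>j. f (c + 1) (s - 1) j)"
    unfolding infsum_cmult_right'
    by (rule arg_cong[of _ _ "(*) _"], rule infsum_reindex_bij_witness[of _ "\<lambda>j. j + 1" "\<lambda>j. j - 1"]) auto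
  finally show ?thesis unfolding V .
qed

lemma vandermonde_base: "vandermonde h 0 c = recip_qfact (q\<^sup>2) c * h c"
  unfolding vandermonde_def
proof (subst infsum_finite_support[of "{0}"])
  show "q powi (2 * (x * (x + c))) * (recip_qfact (q\<^sup>2) x * recip_qfact (q\<^sup>2) (x + c) *
      recip_qfact (q\<^sup>2) (0 - x)) * h (c + x) = 0" if "x \<notin> {0}" for x
    using that by (cases "x < 0") auto
qed simp_all

lemma vandermonde_neg: "s < 0 \<Longrightarrow> vandermonde h s c = 0"
  unfolding vandermonde_def by (rule infsum_0) (auto simp: recip_qfact_def)

lemma q_vandermonde_limit:
  "vandermonde (\<lambda>_. 1) s c = recip_qfact (q\<^sup>2) s * recip_qfact (q\<^sup>2) (s + c)"
proof (cases "s < 0")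
  case True then show ?thesis by (simp add: vandermonde_neg)
next
  case False
  then have "s \<ge> 0" by simp
  then show ?thesis
  proof (induction s arbitrary: c rule: int_ge_induct)
    case base then show ?case by (simp add: vandermonde_base)
  next
    case (step s)
    have nz: "1 - q powi (2 * (s + 1)) \<noteq> 0" using not_one_powi[of "s + 1"] step.hyps by simp
    have "(1 - q powi (2 * (s + 1))) * vandermonde (\<lambda>_. 1) (s + 1) c =
      (1 - q powi (2 * (s + 1))) * (recip_qfact (q\<^sup>2) (s + 1) * recip_qfact (q\<^sup>2) (s + 1 + c))"
      using vandermonde_rec[of "s + 1" "\<lambda>_. 1" c] step.IH[of c] step.IH[of "c + 1"]
        recip_qfact_step[of "s + 1"] recip_qfact_step[of "s + 1 + c"]
      by (simp add: add_ac) algebra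
    then show ?case using nz by simp
  qed
qed

lemma q_vandermonde:
  "vandermonde (\<lambda>x. recip_qfact (q\<^sup>2) (r - x)) s c =
     qpoch (q\<^sup>2) (q\<^sup>2) (nat (r + s)) * recip_qfact (q\<^sup>2) s * recip_qfact (q\<^sup>2) r *
       recip_qfact (q\<^sup>2) (s + c) * recip_qfact (q\<^sup>2) (r - c)" (is "?V s c = ?R s c")
proof -
  consider "s < 0" | "r < 0" | "s \<ge> 0" "r \<ge> 0" by linarith
  then show ?thesis
  proof cases
    case 1 then show ?thesis by (simp add: vandermonde_neg)
  next
    case 2
    then have z: "recip_qfact (q\<^sup>2) (j + c) * recip_qfact (q\<^sup>2) (r - (c + j)) = 0" for j
      by (auto simp: recip_qfact_def)
    have "?V s c = 0" unfolding vandermonde_def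
      by (rule infsum_0) (use z in auto)
    then show ?thesis using 2 by simp
  next
    case 3
    from 3(1) show ?thesis
    proof (induction s arbitrary: c rule: int_ge_induct)
      case base
      have "qpoch (q\<^sup>2) (q\<^sup>2) (nat r) * recip_qfact (q\<^sup>2) r = 1"
        using 3(2) qpoch_nonzero by (simp add: recip_qfact_nonneg)
      then show ?case by (simp add: vandermonde_base mult_ac)
    next
      case (step s)
      define X where "X = 1 - q powi (2 * (s + 1))"
      have nz: "X \<noteq> 0" using not_one_powi[of "s + 1"] step.hyps by (simp add: X_def)
      have 1: "X * ?V (s + 1) c = ?V s c + q powi (2 * (s + 1 + c)) * ?V s (c + 1)"
        using vandermonde_rec[of "s + 1" "\<lambda>x. recip_qfact (q\<^sup>2) (r - x)" c] by (simp add: X_def add_ac)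
      have 2: "X * recip_qfact (q\<^sup>2) (s + 1) = recip_qfact (q\<^sup>2) s"
        using recip_qfact_step[of "s + 1"] by (simp add: X_def)
      have 3: "(1 - q powi (2 * (s + 1 + c))) * recip_qfact (q\<^sup>2) (s + 1 + c) = recip_qfact (q\<^sup>2) (s + c)"
        using recip_qfact_step[of "s + 1 + c"] by (simp add: add_ac)
      have 4: "(1 - q powi (2 * (r - c))) * recip_qfact (q\<^sup>2) (r - c) = recip_qfact (q\<^sup>2) (r - c - 1)"
        using recip_qfact_step[of "r - c"] by simp
      have 5: "q powi (2 * (s + 1 + c)) * q powi (2 * (r - c)) = q powi (2 * (r + s + 1))"
        unfolding powi_split[OF refl, symmetric] by (simp add: algebra_simps)
      have "nat (r + s + 1) = Suc (nat (r + s))" using \<open>r \<ge> 0\<close> step.hyps by simp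
      moreover have "q powi (2 * (r + s + 1)) = (q\<^sup>2) ^ Suc (nat (r + s))"
      proof -
        have "nat (2 * (r + s + 1)) = 2 * Suc (nat (r + s))" using \<open>r \<ge> 0\<close> step.hyps by simp
        moreover have "2 * (r + s + 1) \<ge> 0" using \<open>r \<ge> 0\<close> step.hyps by simp
        ultimately show ?thesis
          by (simp only: power_int_nonneg_exp power_mult[symmetric])
      qed
      ultimately have 6: "qpoch (q\<^sup>2) (q\<^sup>2) (nat (r + s + 1)) = (1 - q powi (2 * (r + s + 1))) * qpoch (q\<^sup>2) (q\<^sup>2) (nat (r + s))"
        by (simp only: qpoch_Suc)
      have e: "s + (c + 1) = s + 1 + c" "r - (c + 1) = r - c - 1" "r + (s + 1) = r + s + 1" by simp_all
      have "X * ?V (s + 1) c = X * ?R (s + 1) c"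
        unfolding 1 step.IH e 2[symmetric] 3[symmetric] 4[symmetric] 6 5[symmetric]
        by (simp add: algebra_simps)
      then show ?case using nz by simp
    qed
  qed
qed

lemma qbinom_nat: "qbinom (q\<^sup>2) (int n) m = qpoch (q\<^sup>2) (q\<^sup>2) n * recip_qfact (q\<^sup>2) m * recip_qfact (q\<^sup>2) (int n - m)"
  by (simp add: qbinom_eq)

text \<open>
  In the double sum over \<open>i\<close> and \<open>j\<close> that defines the right-hand side, substitute \<open>i = s + j + a\<close>.
  The exponent becomes \<open>a^2 + 2s(s+a) + 2j(j+a)\<close>, so that the sum over \<open>j\<close> and after it the sum
  over \<open>s\<close> are q-Vandermonde sums.
\<close>
lemma qbinom_double_eq_sum_qtri:
  "q powi (a * a) * qbinom (q\<^sup>2) (int (2 * L)) (int L - a) =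
     (\<Sum>i\<in>{0..int L}. q powi (i * i) * qbinom (q\<^sup>2) (int L) i * qtri 0 i a)"
proof -
  define D where "D = qpoch (q\<^sup>2) (q\<^sup>2) L"
  define \<rho> where "\<rho> = recip_qfact (q\<^sup>2)"
  have rho_neg: "\<rho> n = 0" if "n < 0" for n using that by (simp add: \<rho>_def)
  define g where "g i j = q powi (i * i + (i - 2 * j - a) * (i - 2 * j - a)) *
     (\<rho> (int L - i) * \<rho> j * \<rho> (j + a) * \<rho> (i - 2 * j - a))" for i j
  have g0: "g i j = 0" if "\<not> (0 \<le> i \<and> i \<le> int L \<and> 0 \<le> j \<and> j \<le> int L)" for i j
  proof -
    have "int L - i < 0 \<or> j < 0 \<or> j + a < 0 \<or> i - 2 * j - a < 0" using that by linarith
    then show ?thesis by (auto simp: g_def rho_neg)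
  qed
  have g1: "g (s + j + a) j = 0" if "\<not> (0 \<le> s \<and> s \<le> int L \<and> 0 \<le> j \<and> j \<le> int L)" for s j
  proof -
    have "int L - (s + j + a) < 0 \<or> j < 0 \<or> j + a < 0 \<or> s + j + a - 2 * j - a < 0" using that by linarith
    then show ?thesis by (auto simp: g_def rho_neg)
  qed
  have fin: "finite ({0..int L} \<times> {0..int L})" by simp
  have term_i: "D * (\<Sum>\<^sub>\<infinity>j. g i j) = q powi (i * i) * qbinom (q\<^sup>2) (int L) i * qtri 0 i a"
    if "i \<in> {0..int L}" for i
  proof -
    have "(\<Sum>\<^sub>\<infinity>j. g i j) = q powi (i * i) * \<rho> (int L - i) * tri 0 i a"
      unfolding tri_def infsum_cmult_right'[symmetric] g_def \<rho>_def
      by (rule infsum_cong) (use q_nz in \<open>simp add: power_int_add\<close>)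
    moreover have "recip_qfact (q\<^sup>2) i * qpoch (q\<^sup>2) (q\<^sup>2) (nat i) = 1"
      using that qpoch_nonzero by (simp add: recip_qfact_nonneg)
    ultimately show ?thesis
      unfolding qtri_def qbinom_nat D_def \<rho>_def by algebra
  qed
  have "(\<Sum>i\<in>{0..int L}. q powi (i * i) * qbinom (q\<^sup>2) (int L) i * qtri 0 i a) =
    D * (\<Sum>i\<in>{0..int L}. \<Sum>\<^sub>\<infinity>j. g i j)"
    unfolding sum_distrib_left by (rule sum.cong) (use term_i in auto)
  also have "(\<Sum>i\<in>{0..int L}. \<Sum>\<^sub>\<infinity>j. g i j) = (\<Sum>\<^sub>\<infinity>i. \<Sum>\<^sub>\<infinity>j. g i j)"
    by (rule infsum_finite_support[symmetric]) (auto simp: g0)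
  also have "\<dots> = (\<Sum>\<^sub>\<infinity>j. \<Sum>\<^sub>\<infinity>i. g i j)"
  proof (rule infsum_swap_banach)
    show "(\<lambda>(i, j). g i j) summable_on (UNIV \<times> UNIV)"
      unfolding UNIV_Times_UNIV by (rule summable_finite_support[OF fin])
        (use g0[of "fst _" "snd _"] in \<open>auto simp: split_beta mem_Times_iff\<close>)
  qed
  also have "\<dots> = (\<Sum>\<^sub>\<infinity>j. \<Sum>\<^sub>\<infinity>s. g (s + j + a) j)"
  proof (rule infsum_cong)
    fix j :: int
    show "(\<Sum>\<^sub>\<infinity>i. g i j) = (\<Sum>\<^sub>\<infinity>s. g (s + j + a) j)"
      by (rule infsum_reindex_bij_witness[of _ "\<lambda>s. s + j + a" "\<lambda>i. i - j - a"]) auto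
  qed
  also have "\<dots> = (\<Sum>\<^sub>\<infinity>s. \<Sum>\<^sub>\<infinity>j. g (s + j + a) j)"
  proof (rule infsum_swap_banach[symmetric])
    show "(\<lambda>(s, j). g (s + j + a) j) summable_on (UNIV \<times> UNIV)"
      unfolding UNIV_Times_UNIV by (rule summable_finite_support[OF fin])
        (use g1[of "fst _" "snd _"] in \<open>auto simp: split_beta mem_Times_iff\<close>)
  qed
  also have "\<dots> = (\<Sum>\<^sub>\<infinity>s. (q powi (a * a) * D) * (q powi (2 * (s * (s + a))) *
      (recip_qfact (q\<^sup>2) s * recip_qfact (q\<^sup>2) (s + a) * recip_qfact (q\<^sup>2) (int L - s)) * recip_qfact (q\<^sup>2) (int L - (a + s))))"
  proof (rule infsum_cong)
    fix s :: int
    have "(\<Sum>\<^sub>\<infinity>j. g (s + j + a) j) = q powi (a * a) * q powi (2 * (s * (s + a))) *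
       vandermonde (\<lambda>x. recip_qfact (q\<^sup>2) (int L - s - x)) s a"
      unfolding vandermonde_def infsum_cmult_right'[symmetric]
    proof (rule infsum_cong)
      fix j :: int
      have e: "(s + j + a) * (s + j + a) + (s - j) * (s - j) =
         a * a + 2 * (s * (s + a)) + 2 * (j * (j + a))" by (simp add: algebra_simps)
      have e2: "s + j + a - 2 * j - a = s - j" "int L - (s + j + a) = int L - s - (a + j)" by simp_all
      show "g (s + j + a) j = q powi (a * a) * q powi (2 * (s * (s + a))) *
        (q powi (2 * (j * (j + a))) * (recip_qfact (q\<^sup>2) j * recip_qfact (q\<^sup>2) (j + a) *
          recip_qfact (q\<^sup>2) (s - j)) * recip_qfact (q\<^sup>2) (int L - s - (a + j)))"
        unfolding g_def e2 e powi_split[OF refl] \<rho>_def by (simp add: mult_ac)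
    qed
    then show "(\<Sum>\<^sub>\<infinity>j. g (s + j + a) j) = (q powi (a * a) * D) * (q powi (2 * (s * (s + a))) *
      (recip_qfact (q\<^sup>2) s * recip_qfact (q\<^sup>2) (s + a) * recip_qfact (q\<^sup>2) (int L - s)) * recip_qfact (q\<^sup>2) (int L - (a + s)))"
      unfolding q_vandermonde by (simp add: D_def mult_ac diff_diff_eq add_ac)
  qed
  also have "\<dots> = (q powi (a * a) * D) * vandermonde (\<lambda>x. recip_qfact (q\<^sup>2) (int L - x)) (int L) a"
    unfolding infsum_cmult_right' vandermonde_def ..
  also have "\<dots> = (q powi (a * a) * D) * (qpoch (q\<^sup>2) (q\<^sup>2) (2 * L) * \<rho> (int L) * \<rho> (int L) * \<rho> (int L + a) * \<rho> (int L - a))"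
  proof -
    have "nat (int L + int L) = 2 * L" by linarith
    then show ?thesis unfolding q_vandermonde \<rho>_def by (simp only:)
  qed
  also have "D * ((q powi (a * a) * D) * (qpoch (q\<^sup>2) (q\<^sup>2) (2 * L) * \<rho> (int L) * \<rho> (int L) * \<rho> (int L + a) * \<rho> (int L - a)))
      = q powi (a * a) * qbinom (q\<^sup>2) (int (2 * L)) (int L - a)"
  proof -
    have d: "D * \<rho> (int L) = 1" using qpoch_nonzero by (simp add: D_def \<rho>_def recip_qfact_nonneg)
    have e: "int (2 * L) - (int L - a) = int L + a" by simp
    show ?thesis using d unfolding qbinom_nat e \<rho>_def by algebra
  qed
  finally show ?thesis by simp
qed

section \<open>The q-Pell numbers\<close>

text \<open>
  With 0 for the coefficients outside the range \<open>0 \<le> m \<le> n\<close>, the Pascal rules fail only at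
  \<open>n = m = 0\<close>.
\<close>
lemma qbinom_pascal:
  assumes "n \<noteq> 0 \<or> m \<noteq> 0"
  shows "qbinom (q\<^sup>2) n m = qbinom (q\<^sup>2) (n - 1) m + q powi (2 * (n - m)) * qbinom (q\<^sup>2) (n - 1) (m - 1)"
    and "qbinom (q\<^sup>2) n m = qbinom (q\<^sup>2) (n - 1) (m - 1) + q powi (2 * m) * qbinom (q\<^sup>2) (n - 1) m"
proof -
  consider "n < 0" | "n = 0" | k where "n = int (Suc k)"
    by (metis linorder_neqE_linordered_idom zero_less_imp_eq_int gr0_implies_Suc)
  then have "qbinom (q\<^sup>2) n m = qbinom (q\<^sup>2) (n - 1) m + q powi (2 * (n - m)) * qbinom (q\<^sup>2) (n - 1) (m - 1) \<and>
     qbinom (q\<^sup>2) n m = qbinom (q\<^sup>2) (n - 1) (m - 1) + q powi (2 * m) * qbinom (q\<^sup>2) (n - 1) m"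
  proof cases
    case 1 then show ?thesis by (auto simp: qbinom_def)
  next
    case 2 then show ?thesis using assms by (auto simp: qbinom_def)
  next
    case 3
    define \<rho> where "\<rho> = recip_qfact (q\<^sup>2)"
    have n1: "n - 1 = int k" using 3 by simp
    have "nat (2 * n) = 2 * Suc k" using 3 by simp
    then have "q powi (2 * n) = (q\<^sup>2) ^ Suc k"
      using 3 by (simp only: power_int_nonneg_exp power_mult[symmetric])
    then have P: "qpoch (q\<^sup>2) (q\<^sup>2) (Suc k) = (1 - q powi (2 * n)) * qpoch (q\<^sup>2) (q\<^sup>2) k"
      by (simp only: qpoch_Suc)
    have r1: "(1 - q powi (2 * m)) * \<rho> m = \<rho> (m - 1)"
      unfolding \<rho>_def by (rule recip_qfact_step)
    have r2: "(1 - q powi (2 * (n - m))) * \<rho> (n - m) = \<rho> (n - m - 1)"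
      unfolding \<rho>_def by (rule recip_qfact_step)
    have pp: "q powi (2 * n) = q powi (2 * (n - m)) * q powi (2 * m)"
      by (rule powi_split) simp
    have e: "n - 1 - m = n - m - 1" "n - 1 - (m - 1) = n - m" by simp_all
    have b1: "qbinom (q\<^sup>2) n m = (1 - q powi (2 * n)) * qpoch (q\<^sup>2) (q\<^sup>2) k * \<rho> m * \<rho> (n - m)"
      unfolding 3 qbinom_nat \<rho>_def P[unfolded 3] ..
    have b2: "qbinom (q\<^sup>2) (n - 1) m = qpoch (q\<^sup>2) (q\<^sup>2) k * \<rho> m * \<rho> (n - m - 1)" for m
      unfolding n1 qbinom_nat \<rho>_def using n1 by (simp add: algebra_simps)
    have b3: "n - (m - 1) - 1 = n - m" by simp
    show ?thesis unfolding b1 b2 b3 r1[symmetric] r2[symmetric] pp by (simp add: algebra_simps)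
  qed
  then show "qbinom (q\<^sup>2) n m = qbinom (q\<^sup>2) (n - 1) m + q powi (2 * (n - m)) * qbinom (q\<^sup>2) (n - 1) (m - 1)"
    and "qbinom (q\<^sup>2) n m = qbinom (q\<^sup>2) (n - 1) (m - 1) + q powi (2 * m) * qbinom (q\<^sup>2) (n - 1) m" by auto
qed

text \<open>
  The parameter \<open>e\<close>, equal to 0 or 1 in the applications, treats the two families of sums at once.
\<close>
definition qpell_term :: "nat \<Rightarrow> int \<Rightarrow> int \<times> int \<Rightarrow> complex" where
  "qpell_term e i = (\<lambda>(j, k). q powi (j * j + k * k + 2 * int e * j) *
     (qbinom (q\<^sup>2) (i - k - int e) j * qbinom (q\<^sup>2) j k))"

definition qpell :: "nat \<Rightarrow> int \<Rightarrow> complex" where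
  "qpell e i = (\<Sum>\<^sub>\<infinity>jk. qpell_term e i jk)"

lemma qpell_term_support:
  assumes "jk \<notin> {0..i} \<times> {0..i}"
  shows "qpell_term e i jk = 0"
  using assms by (cases jk) (auto simp: qpell_term_def qbinom_def)

lemma qpell_summable: "qpell_term e i summable_on UNIV"
  by (rule summable_finite_support[of "{0..i} \<times> {0..i}"]) (use qpell_term_support in auto)

text \<open>
  The recurrence already holds term by term, up to shifts of \<open>j\<close> and \<open>k\<close>. The exceptional case
  \<open>n = m = 0\<close> of the Pascal rule is harmless in both places: the other q-binomial coefficient
  vanishes there, the first time because \<open>i \<noteq> e\<close>.
\<close>
lemma qpell_term_rec:
  assumes "i \<noteq> int e"
  shows "qpell_term e i (j, k) = qpell_term e (i - 1) (j, k) + q powi (2 * i - 1) * qpell_term e (i - 1) (j - 1, k)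
     + q powi (2 * i - 2) * qpell_term e (i - 2) (j - 1, k - 1)"
proof -
  define n where "n = i - k - int e"
  have e1: "i - 1 - k - int e = n - 1" "i - 2 - (k - 1) - int e = n - 1" by (simp_all add: n_def)
  have 1: "qbinom (q\<^sup>2) n j * qbinom (q\<^sup>2) j k =
     (qbinom (q\<^sup>2) (n - 1) j + q powi (2 * (n - j)) * qbinom (q\<^sup>2) (n - 1) (j - 1)) * qbinom (q\<^sup>2) j k"
  proof (cases "n = 0 \<and> j = 0")
    case True
    then have "k \<noteq> 0" using assms by (auto simp: n_def)
    then have "qbinom (q\<^sup>2) j k = 0" using True by (auto simp: qbinom_def)
    then show ?thesis by simp
  next
    case False then show ?thesis using qbinom_pascal(1)[of n j] by simp
  qed
  have 2: "qbinom (q\<^sup>2) (n - 1) (j - 1) * qbinom (q\<^sup>2) j k =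
     qbinom (q\<^sup>2) (n - 1) (j - 1) * (qbinom (q\<^sup>2) (j - 1) (k - 1) + q powi (2 * k) * qbinom (q\<^sup>2) (j - 1) k)"
  proof (cases "j = 0")
    case True then show ?thesis by (simp add: qbinom_def)
  next
    case False then show ?thesis using qbinom_pascal(2)[of j k] by simp
  qed
  have 3: "q powi (j * j + k * k + 2 * int e * j) * q powi (2 * (n - j)) * q powi (2 * k) =
    q powi (2 * i - 1) * q powi ((j - 1) * (j - 1) + k * k + 2 * int e * (j - 1))"
    unfolding powi_split[OF refl, symmetric] by (simp add: algebra_simps n_def)
  have 4: "q powi (j * j + k * k + 2 * int e * j) * q powi (2 * (n - j)) =
    q powi (2 * i - 2) * q powi ((j - 1) * (j - 1) + (k - 1) * (k - 1) + 2 * int e * (j - 1))"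
    unfolding powi_split[OF refl, symmetric] by (simp add: algebra_simps n_def)
  show ?thesis
    unfolding qpell_term_def prod.case e1 n_def[symmetric] using 1 2 3 4 by algebra
qed

lemma qpell_rec:
  assumes "i \<noteq> int e"
  shows "qpell e i = (1 + q powi (2 * i - 1)) * qpell e (i - 1) + q powi (2 * i - 2) * qpell e (i - 2)"
proof -
  have s1: "(\<lambda>(j, k). q powi (2 * i - 1) * qpell_term e (i - 1) (j - 1, k)) summable_on UNIV"
    by (rule summable_finite_support[of "{0..i} \<times> {0..i}"]) (auto intro!: qpell_term_support)
  have s2: "(\<lambda>(j, k). q powi (2 * i - 2) * qpell_term e (i - 2) (j - 1, k - 1)) summable_on UNIV"
    by (rule summable_finite_support[of "{0..i} \<times> {0..i}"]) (auto intro!: qpell_term_support)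
  have "qpell e i = (\<Sum>\<^sub>\<infinity>x. qpell_term e (i - 1) x + (\<lambda>(j, k). q powi (2 * i - 1) * qpell_term e (i - 1) (j - 1, k)) x
     + (\<lambda>(j, k). q powi (2 * i - 2) * qpell_term e (i - 2) (j - 1, k - 1)) x)"
    unfolding qpell_def by (rule infsum_cong) (use qpell_term_rec[OF assms] in \<open>auto\<close>)
  also have "\<dots> = qpell e (i - 1) + (\<Sum>\<^sub>\<infinity>x. (\<lambda>(j, k). q powi (2 * i - 1) * qpell_term e (i - 1) (j - 1, k)) x)
    + (\<Sum>\<^sub>\<infinity>x. (\<lambda>(j, k). q powi (2 * i - 2) * qpell_term e (i - 2) (j - 1, k - 1)) x)"
    unfolding qpell_def using s1 s2 qpell_summable
    by (simp add: infsum_add summable_on_add)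
  also have "(\<Sum>\<^sub>\<infinity>x. (\<lambda>(j, k). q powi (2 * i - 1) * qpell_term e (i - 1) (j - 1, k)) x) = q powi (2 * i - 1) * qpell e (i - 1)"
    unfolding qpell_def infsum_cmult_right'[symmetric]
    by (rule infsum_reindex_bij_witness[of _ "\<lambda>(j, k). (j + 1, k)" "\<lambda>(j, k). (j - 1, k)"]) auto
  also have "(\<Sum>\<^sub>\<infinity>x. (\<lambda>(j, k). q powi (2 * i - 2) * qpell_term e (i - 2) (j - 1, k - 1)) x) = q powi (2 * i - 2) * qpell e (i - 2)"
    unfolding qpell_def infsum_cmult_right'[symmetric]
    by (rule infsum_reindex_bij_witness[of _ "\<lambda>(j, k). (j + 1, k + 1)" "\<lambda>(j, k). (j - 1, k - 1)"]) auto
  finally show ?thesis by (simp add: algebra_simps)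
qed

lemma qpell_initial:
  "qpell 0 0 = 1" "qpell 0 1 = 1 + q" "qpell 1 0 = 0" "qpell 1 1 = 1"
proof -
  have *: "qpell e i = (\<Sum>jk\<in>{0..i} \<times> {0..i}. qpell_term e i jk)" for e i
    unfolding qpell_def by (rule infsum_finite_support) (auto intro!: qpell_term_support)
  have s: "{0..1::int} = {0, 1}" by auto
  have nz: "qpoch (q\<^sup>2) (q\<^sup>2) n \<noteq> 0" for n by (rule qpoch_nonzero)
  have t: "{0, 1} \<times> {0, 1::int} = {(0, 0), (0, 1), (1, 0), (1, 1)}" by auto
  have p0: "qpoch (q\<^sup>2) (q\<^sup>2) 0 = 1" by (simp add: qpoch_def)
  show "qpell 0 0 = 1" "qpell 1 0 = 0" by (simp_all add: * qpell_term_def qbinom_def p0)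
  show "qpell 0 1 = 1 + q" "qpell 1 1 = 1"
    unfolding * s t using nz by (simp_all add: qpell_term_def qbinom_def p0)
qed

section \<open>The q-Pell numbers as alternating sums of q-trinomial coefficients\<close>

text \<open>
  The quadratic exponent is dictated by \<open>theta_wt_step\<close>: it makes the two error terms of
  \<open>qtri_pair_rec\<close> cancel between neighbouring values of \<open>n\<close>.
\<close>
definition theta_wt :: "nat \<Rightarrow> int \<Rightarrow> complex" where
  "theta_wt e n = (-1) powi n * q powi (4 * (n * n) + (1 + 2 * int e) * n)"

definition pair_sum :: "nat \<Rightarrow> int \<Rightarrow> complex" where
  "pair_sum e m = (\<Sum>\<^sub>\<infinity>n. theta_wt e n * qtri_pair m (4 * n + int e))"

lemma qtri_pair_support:
  assumes "m \<ge> 0" "n \<notin> {- (m + int e + 1) .. m + int e + 1}"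
  shows "qtri_pair m (4 * n + int e) = 0"
proof -
  have "\<bar>4 * n + int e\<bar> > m" "\<bar>4 * n + int e + 1\<bar> > m" using assms by auto
  then show ?thesis by (simp add: qtri_pair_def qtri_eq_0)
qed

lemma qtri_rest_support:
  assumes "m \<ge> 0" "n \<notin> {- (m + int e + 1) .. m + int e + 1}"
  shows "qtri_rest m (4 * n + int e - 1) = 0"
proof -
  have "\<bar>4 * n + int e - 1\<bar> > m" "\<bar>4 * n + int e - 1 - 1\<bar> > m" using assms by auto
  then show ?thesis by (simp add: qtri_rest_def qtri_eq_0)
qed

lemma theta_wt_step:
  "theta_wt e n * q powi (m - (4 * n + int e)) = - theta_wt e (n - 1) * q powi (m + 4 * (n - 1) + int e + 1)"
proof -
  have "(-1 :: complex) powi n = - ((-1) powi (n - 1))"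
    by (simp add: power_int_diff)
  moreover have "q powi (4 * (n * n) + (1 + 2 * int e) * n) * q powi (m - (4 * n + int e)) =
     q powi (4 * ((n - 1) * (n - 1)) + (1 + 2 * int e) * (n - 1)) * q powi (m + 4 * (n - 1) + int e + 1)"
    unfolding powi_split[OF refl, symmetric] by (simp add: algebra_simps)
  ultimately show ?thesis unfolding theta_wt_def by algebra
qed

text \<open>
  Summed against \<open>theta_wt\<close>, the recurrence for \<open>qtri_pair\<close> has error terms of the form
  \<open>z n - z (n + 1)\<close>, and these telescope to 0.
\<close>
lemma pair_sum_rec:
  assumes "m \<ge> 2"
  shows "pair_sum e m = (1 + q powi (2 * m - 1)) * pair_sum e (m - 1) + q powi (2 * m - 2) * pair_sum e (m - 2)"
proof -
  define z where "z n = theta_wt e n * q powi (m - (4 * n + int e)) * qtri_rest (m - 2) (4 * n + int e - 1)" for n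
  have summand: "theta_wt e n * qtri_pair m (4 * n + int e) =
      (1 + q powi (2 * m - 1)) * (theta_wt e n * qtri_pair (m - 1) (4 * n + int e)) +
      q powi (2 * m - 2) * (theta_wt e n * qtri_pair (m - 2) (4 * n + int e)) + (z n - z (n + 1))" for n
  proof -
    have z1: "z (n + 1) = - (theta_wt e n * q powi (m + 4 * n + int e + 1) * qtri_rest (m - 2) (4 * n + int e + 3))"
      using theta_wt_step[of e "n + 1" m] by (simp add: z_def algebra_simps)
    have 2: "qtri_pair m (4 * n + int e) = (1 + q powi (2 * m - 1)) * qtri_pair (m - 1) (4 * n + int e)
           + q powi (2 * m - 2) * qtri_pair (m - 2) (4 * n + int e)
           + q powi (m - (4 * n + int e)) * qtri_rest (m - 2) (4 * n + int e - 1)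
           + q powi (m + 4 * n + int e + 1) * qtri_rest (m - 2) (4 * n + int e + 3)"
      using qtri_pair_rec[OF assms, of "4 * n + int e"] by (simp add: add.assoc)
    show ?thesis unfolding z1 2 by (simp add: z_def algebra_simps)
  qed
  have summ: "(\<lambda>n. c * (theta_wt e n * qtri_pair l (4 * n + int e))) summable_on UNIV" if "l \<ge> 0" for l c
    by (rule summable_finite_support[of "{- (l + int e + 1) .. l + int e + 1}"])
       (use qtri_pair_support[OF that] in auto)
  have z0: "z n = 0" if "n \<notin> {- (m + int e) .. m + int e}" for n
    using qtri_rest_support[of "m - 2" n e] assms that by (auto simp: z_def)
  have sz: "z summable_on UNIV"
    by (rule summable_finite_support[of "{- (m + int e) .. m + int e}"]) (use z0 in auto)
  have sz': "(\<lambda>n. z (n + 1)) summable_on UNIV"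
    by (rule summable_finite_support[of "{- (m + int e + 1) .. m + int e}"]) (use z0 in auto)
  have "(\<Sum>\<^sub>\<infinity>n. z (n + 1)) = (\<Sum>\<^sub>\<infinity>n. z n)"
    by (rule infsum_reindex_bij_witness[of _ "\<lambda>n. n - 1" "\<lambda>n. n + 1"]) auto
  then have tele: "(\<Sum>\<^sub>\<infinity>n. z n - z (n + 1)) = 0"
    by (simp add: infsum_diff_summable[OF sz sz'])
  have dz: "(\<lambda>n. z n - z (n + 1)) summable_on UNIV"
    by (rule summable_finite_support[of "{- (m + int e + 1) .. m + int e}"]) (use z0 in auto)
  have "pair_sum e m = (\<Sum>\<^sub>\<infinity>n. (1 + q powi (2 * m - 1)) * (theta_wt e n * qtri_pair (m - 1) (4 * n + int e)) +
      q powi (2 * m - 2) * (theta_wt e n * qtri_pair (m - 2) (4 * n + int e)) + (z n - z (n + 1)))"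
    unfolding pair_sum_def summand ..
  also have "\<dots> = (1 + q powi (2 * m - 1)) * pair_sum e (m - 1) + q powi (2 * m - 2) * pair_sum e (m - 2)"
    using assms summ[of "m - 1"] summ[of "m - 2"] dz tele
    by (simp add: infsum_add summable_on_add infsum_cmult_right' pair_sum_def)
  finally show ?thesis .
qed

lemma tri_0: "tri s 0 A = (if A = 0 then 1 else 0)"
proof (cases "A = 0")
  case True
  have "tri s 0 0 = (\<Sum>j\<in>{0}. q powi ((0 - 2 * j - 0) * (0 - 2 * j - 0 + s)) *
     (recip_qfact (q\<^sup>2) j * recip_qfact (q\<^sup>2) (j + 0) * recip_qfact (q\<^sup>2) (0 - 2 * j - 0)))"
    unfolding tri_def
  proof (rule infsum_finite_support)
    fix j :: int assume "j \<notin> {0}"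
    then show "q powi ((0 - 2 * j - 0) * (0 - 2 * j - 0 + s)) *
     (recip_qfact (q\<^sup>2) j * recip_qfact (q\<^sup>2) (j + 0) * recip_qfact (q\<^sup>2) (0 - 2 * j - 0)) = 0"
      by (cases "j < 0") auto
  qed simp
  then show ?thesis using True by simp
qed (simp add: tri_eq_0)

lemma qtri_initial: "qtri s 0 A = (if A = 0 then 1 else 0)"
  "qtri 0 1 0 = q" "qtri 0 1 1 = 1"
proof -
  show *: "qtri s 0 A = (if A = 0 then 1 else 0)" for s A
    by (simp add: qtri_def tri_0 qpoch_def)
  show "qtri 0 1 0 = q" "qtri 0 1 1 = 1"
    using qtri_0_rec(1)[of 1 0] qtri_0_rec(1)[of 1 1] by (simp_all add: *)
qed

lemma pair_sum_initial:
  "pair_sum 0 0 = 1" "pair_sum 0 1 = 1 + q" "pair_sum 1 0 = 0" "pair_sum 1 1 = 1"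
proof -
  have *: "pair_sum e i = theta_wt e 0 * qtri_pair i (int e)" if "i \<le> 1" "e \<le> 1" "i \<ge> 0" for e i
  proof -
    have "pair_sum e i = (\<Sum>n\<in>{0}. theta_wt e n * qtri_pair i (4 * n + int e))"
      unfolding pair_sum_def
    proof (rule infsum_finite_support)
      fix n :: int assume "n \<notin> {0}"
      then have "\<bar>4 * n + int e\<bar> > i" "\<bar>4 * n + int e + 1\<bar> > i" using that by auto
      then show "theta_wt e n * qtri_pair i (4 * n + int e) = 0" by (simp add: qtri_pair_def qtri_eq_0)
    qed simp
    then show ?thesis by simp
  qed
  show "pair_sum 0 0 = 1" "pair_sum 0 1 = 1 + q" "pair_sum 1 0 = 0" "pair_sum 1 1 = 1"
    by (simp_all add: * theta_wt_def qtri_pair_def qtri_initial qtri_eq_0)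
qed

lemma qpell_eq_pair_sum:
  assumes "e \<le> 1"
  shows "qpell e (int i) = pair_sum e (int i)"
proof (induction i rule: less_induct)
  case (less i)
  have e: "e = 0 \<or> e = 1" using assms by auto
  consider "i = 0" | "i = 1" | "i \<ge> 2" by linarith
  then show ?case
  proof cases
    case 1 then show ?thesis using e qpell_initial pair_sum_initial by auto
  next
    case 2 then show ?thesis using e qpell_initial pair_sum_initial by auto
  next
    case 3
    have 1: "int i - 1 = int (i - 1)" "int i - 2 = int (i - 2)" using 3 by auto
    have "int i \<noteq> int e" using 3 assms by auto
    then show ?thesis using qpell_rec[of "int i" e] pair_sum_rec[of "int i" e] 3
      less.IH[of "i - 1"] less.IH[of "i - 2"] unfolding 1 by simp
  qed
qed

text \<open>
  Insert \<open>qpell_eq_pair_sum\<close> and interchange the sums over \<open>i\<close> and \<open>n\<close>; the sum over \<open>i\<close> is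
  then evaluated by \<open>qbinom_double_eq_sum_qtri\<close>.
\<close>
lemma finite_identity:
  assumes "e \<le> 1"
  shows "(\<Sum>i\<in>{0..int L}. q powi (i * i) * qbinom (q\<^sup>2) (int L) i * qpell e i) =
    (\<Sum>\<^sub>\<infinity>n. theta_wt e n * (q powi ((4 * n + int e) * (4 * n + int e)) * qbinom (q\<^sup>2) (int (2 * L)) (int L - (4 * n + int e))
       + q powi ((4 * n + int e + 1) * (4 * n + int e + 1)) * qbinom (q\<^sup>2) (int (2 * L)) (int L - (4 * n + int e + 1))))"
proof -
  have "(\<Sum>i\<in>{0..int L}. q powi (i * i) * qbinom (q\<^sup>2) (int L) i * qpell e i) =
     (\<Sum>i\<in>{0..int L}. \<Sum>\<^sub>\<infinity>n. q powi (i * i) * qbinom (q\<^sup>2) (int L) i * (theta_wt e n * qtri_pair i (4 * n + int e)))"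
  proof (rule sum.cong[OF refl])
    fix i assume "i \<in> {0..int L}"
    then have "qpell e i = pair_sum e i" using qpell_eq_pair_sum[OF assms, of "nat i"] by simp
    then show "q powi (i * i) * qbinom (q\<^sup>2) (int L) i * qpell e i =
      (\<Sum>\<^sub>\<infinity>n. q powi (i * i) * qbinom (q\<^sup>2) (int L) i * (theta_wt e n * qtri_pair i (4 * n + int e)))"
      unfolding infsum_cmult_right' pair_sum_def by simp
  qed
  also have "\<dots> = (\<Sum>\<^sub>\<infinity>n. \<Sum>i\<in>{0..int L}. q powi (i * i) * qbinom (q\<^sup>2) (int L) i * (theta_wt e n * qtri_pair i (4 * n + int e)))"
  proof (rule infsum_finite_sum[symmetric])
    fix i assume i: "i \<in> {0..int L}"
    show "(\<lambda>n. q powi (i * i) * qbinom (q\<^sup>2) (int L) i * (theta_wt e n * qtri_pair i (4 * n + int e))) summable_on UNIV"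
      by (rule summable_finite_support[of "{- (i + int e + 1) .. i + int e + 1}"])
         (use qtri_pair_support[of i _ e] i in auto)
  qed simp
  finally show ?thesis
    unfolding qbinom_double_eq_sum_qtri qtri_pair_def
    by (simp add: sum_distrib_left sum.distrib algebra_simps)
qed

end

section \<open>Inversion of the base\<close>

context generic_base
begin

text \<open>
  Each factor obeys \<open>1 - 1/y = -(1 - y)/y\<close>. The signs and powers of \<open>q\<close> that are produced here
  combine in \<open>qbinom_inverse\<close> to one power of \<open>q\<close>.
\<close>
lemma qpoch_inverse:
  "qpoch ((inverse q)\<^sup>2) ((inverse q)\<^sup>2) n = (-1) ^ n * q powi (- (int n * (int n + 1))) * qpoch (q\<^sup>2) (q\<^sup>2) n"
proof (induction n)
  case 0 then show ?case by (simp add: qpoch_def)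
next
  case (Suc n)
  define y where "y = (q\<^sup>2) ^ Suc n"
  have y0: "y \<noteq> 0" using q_nz by (simp add: y_def)
  have y: "q powi (2 * (int n + 1)) = y"
  proof -
    have "2 * (int n + 1) = int (2 * Suc n)" by simp
    then show ?thesis unfolding y_def power_mult[symmetric] by (simp only: power_int_of_nat)
  qed
  have "((inverse q)\<^sup>2) ^ Suc n = inverse y" unfolding y_def by (simp only: power_inverse)
  then have 1: "qpoch ((inverse q)\<^sup>2) ((inverse q)\<^sup>2) (Suc n) = (1 - inverse y) * qpoch ((inverse q)\<^sup>2) ((inverse q)\<^sup>2) n"
    by (simp add: qpoch_def mult.commute)
  have e: "- (int (Suc n) * (int (Suc n) + 1)) + 2 * (int n + 1) = - (int n * (int n + 1))"
    by (simp add: algebra_simps)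
  have 2: "q powi (- (int n * (int n + 1))) = q powi (- (int (Suc n) * (int (Suc n) + 1))) * y"
    unfolding y[symmetric] powi_split[OF refl, symmetric] e ..
  have 3: "qpoch (q\<^sup>2) (q\<^sup>2) (Suc n) = (1 - y) * qpoch (q\<^sup>2) (q\<^sup>2) n" by (simp only: qpoch_Suc y_def)
  show ?case unfolding 1 Suc.IH 2 3 using y0 by (simp add: field_simps)
qed

lemma qbinom_inverse: "qbinom ((inverse q)\<^sup>2) n m = q powi (- (2 * m * (n - m))) * qbinom (q\<^sup>2) n m"
proof (cases "n \<ge> m \<and> m \<ge> 0")
  case False then show ?thesis by (auto simp: qbinom_def)
next
  case True
  define k where "k = nat m"
  define l where "l = nat (n - m)"
  have m: "m = int k" and n: "n = int (k + l)" using True by (auto simp: k_def l_def)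
  have p: "q powi (- (int (k + l) * (int (k + l) + 1))) =
    q powi (- (2 * m * (n - m))) * (q powi (- (int k * (int k + 1))) * q powi (- (int l * (int l + 1))))"
    unfolding powi_split[OF refl, symmetric] by (simp add: m n algebra_simps)
  have nz: "q powi x \<noteq> 0" for x using q_nz by simp
  have "qbinom ((inverse q)\<^sup>2) n m = qpoch ((inverse q)\<^sup>2) ((inverse q)\<^sup>2) (k + l) /
      (qpoch ((inverse q)\<^sup>2) ((inverse q)\<^sup>2) k * qpoch ((inverse q)\<^sup>2) ((inverse q)\<^sup>2) l)"
    by (simp add: qbinom_def m n nat_add_distrib)
  also have "\<dots> = q powi (- (2 * m * (n - m))) * (qpoch (q\<^sup>2) (q\<^sup>2) (k + l) / (qpoch (q\<^sup>2) (q\<^sup>2) k * qpoch (q\<^sup>2) (q\<^sup>2) l))"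
    unfolding qpoch_inverse p using nz qpoch_nonzero q_nz by (simp add: divide_simps power_add)
  also have "qpoch (q\<^sup>2) (q\<^sup>2) (k + l) / (qpoch (q\<^sup>2) (q\<^sup>2) k * qpoch (q\<^sup>2) (q\<^sup>2) l) = qbinom (q\<^sup>2) n m"
    by (simp add: qbinom_def m n nat_add_distrib)
  finally show ?thesis .
qed

end

section \<open>The finite identities on the unit disc\<close>

definition qbinom3 :: "complex \<Rightarrow> nat \<Rightarrow> nat \<Rightarrow> nat \<times> nat \<times> nat \<Rightarrow> complex" where
  "qbinom3 q e L = (\<lambda>(i, j, k). qbinom (q\<^sup>2) (int L) (int i) *
     (qbinom (q\<^sup>2) (int i - int k - int e) (int j) * qbinom (q\<^sup>2) (int j) (int k)))"

text \<open>
  The dual exponent is \<open>2 L^2\<close> minus the direct one, minus \<open>2 m (n - m)\<close> for each of the three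
  coefficients \<open>[n;m]\<close> in \<open>qbinom3\<close>, as \<open>qbinom_inverse\<close> requires; the parameter \<open>e\<close> cancels.
\<close>
definition summand_exp :: "bool \<Rightarrow> nat \<Rightarrow> nat \<Rightarrow> nat \<times> nat \<times> nat \<Rightarrow> int" where
  "summand_exp dual e L = (\<lambda>(i, j, k).
     if dual then 2 * (int L)\<^sup>2 - 2 * int i * int L + (int i)\<^sup>2 - 2 * int i * int j + (int j)\<^sup>2 + (int k)\<^sup>2
     else (int i)\<^sup>2 + (int j)\<^sup>2 + (int k)\<^sup>2 + 2 * int e * int j)"

text \<open>
  The theta side is indexed by pairs \<open>(n, b)\<close>, where \<open>b\<close> tells the positions \<open>4n + e\<close> and
  \<open>4n + e + 1\<close> apart.
\<close>
definition theta_exp :: "bool \<Rightarrow> nat \<Rightarrow> int \<times> bool \<Rightarrow> int" where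
  "theta_exp dual e = (\<lambda>(n, b). (4 * n + int e + of_bool b)\<^sup>2
     + (if dual then - 1 else 1) * (4 * n\<^sup>2 + (1 + 2 * int e) * n))"

definition theta_pos :: "nat \<Rightarrow> int \<times> bool \<Rightarrow> int" where
  "theta_pos e = (\<lambda>(n, b). 4 * n + int e + of_bool b)"

definition theta_sign :: "int \<times> bool \<Rightarrow> complex" where
  "theta_sign x = (-1) powi (fst x)"

definition triples :: "nat \<Rightarrow> (nat \<times> nat \<times> nat) set" where
  "triples L = {..L} \<times> {..L} \<times> {..L}"

text \<open>
  A finite set that contains all indices whose position lies between \<open>-L\<close> and \<open>L\<close>.
\<close>
definition window :: "nat \<Rightarrow> (int \<times> bool) set" where
  "window L = {- (int L + 2) .. int L + 2} \<times> UNIV"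

lemma finite_triples [simp]: "finite (triples L)" by (simp add: triples_def)
lemma finite_window [simp]: "finite (window L)" by (simp add: window_def)

lemma qbinom3_support: "qbinom3 q e L (i, j, k) \<noteq> 0 \<Longrightarrow> i \<le> L \<and> j \<le> i \<and> k \<le> j"
  by (auto simp: qbinom3_def qbinom_def split: if_splits)

lemma qbinom3_outside: "x \<notin> triples L \<Longrightarrow> qbinom3 q e L x = 0"
  using qbinom3_support[of q e L "fst x" "fst (snd x)" "snd (snd x)"]
  by (cases "qbinom3 q e L x = 0") (auto simp: triples_def mem_Times_iff)

lemma summand_exp_nonneg:
  assumes "i \<le> L" shows "summand_exp dual e L (i, j, k) \<ge> 0"
proof -
  have "2 * (int L)\<^sup>2 - 2 * int i * int L + (int i)\<^sup>2 - 2 * int i * int j + (int j)\<^sup>2 + (int k)\<^sup>2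
     = 2 * int L * (int L - int i) + (int i - int j)\<^sup>2 + (int k)\<^sup>2"
    by (simp add: power2_eq_square algebra_simps)
  moreover have "2 * int L * (int L - int i) \<ge> 0" using assms by simp
  ultimately show ?thesis by (auto simp: summand_exp_def)
qed

lemma int_abs_le_square:
  fixes n :: int shows "\<bar>n\<bar> \<le> n\<^sup>2"
proof (cases "n = 0")
  case False
  then have "\<bar>n\<bar> * 1 \<le> \<bar>n\<bar> * \<bar>n\<bar>" by (intro mult_left_mono) auto
  then show ?thesis by (simp add: power2_eq_square)
qed simp

text \<open>
  This makes the theta coefficients absolutely summable on the unit disc, and allows natural
  exponents in place of integer ones.
\<close>
lemma theta_exp_ge:
  assumes "e \<le> 1" shows "theta_exp dual e (n, b) \<ge> \<bar>n\<bar>"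
proof -
  have sq: "n\<^sup>2 \<ge> \<bar>n\<bar>" by (rule int_abs_le_square)
  have sq2: "n\<^sup>2 \<ge> 2 * \<bar>n\<bar>" if "\<bar>n\<bar> \<ge> 2"
  proof -
    have "2 * \<bar>n\<bar> \<le> \<bar>n\<bar> * \<bar>n\<bar>" using that by (intro mult_right_mono) auto
    then show ?thesis by (simp add: power2_eq_square)
  qed
  have e: "e = 0 \<or> e = 1" using assms by auto
  have "theta_exp True e (n, b) \<ge> \<bar>n\<bar>"
  proof -
    have "theta_exp True e (n, b) = (if e = 0 then if b then 12 * n\<^sup>2 + 7 * n + 1 else 12 * n\<^sup>2 - n
       else if b then 12 * n\<^sup>2 + 13 * n + 4 else 12 * n\<^sup>2 + 5 * n + 1)"
      using e by (cases b) (auto simp: theta_exp_def power2_eq_square algebra_simps)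
    moreover have "12 * n\<^sup>2 + 13 * n + 4 \<ge> \<bar>n\<bar>" using sq sq2 by linarith
    moreover have "12 * n\<^sup>2 + 7 * n + 1 \<ge> \<bar>n\<bar>" "12 * n\<^sup>2 - n \<ge> \<bar>n\<bar>" "12 * n\<^sup>2 + 5 * n + 1 \<ge> \<bar>n\<bar>"
      using sq by linarith+
    ultimately show ?thesis by (cases b; cases "e = 0") (simp_all only: if_True if_False simp_thms)
  qed
  moreover have "theta_exp False e (n, b) \<ge> theta_exp True e (n, b)"
  proof -
    have "4 * n\<^sup>2 + n \<ge> 0" "4 * n\<^sup>2 + 3 * n \<ge> 0" using sq by linarith+
    then show ?thesis using e by (auto simp: theta_exp_def)
  qed
  ultimately show ?thesis by (cases dual) auto
qed

lemma theta_exp_nonneg: "e \<le> 1 \<Longrightarrow> theta_exp dual e (n, b) \<ge> 0"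
  using theta_exp_ge[of e n dual b] by linarith

lemma qbinom_outside_window:
  assumes "e \<le> 1" "x \<notin> window L"
  shows "qbinom Q (int (2 * L)) (int L - theta_pos e x) = 0"
proof -
  obtain n b where x: "x = (n, b)" by (cases x)
  have "\<bar>theta_pos e x\<bar> > int L" using assms by (auto simp: x window_def theta_pos_def)
  then show ?thesis by (auto simp: qbinom_def)
qed

lemma (in generic_base) finite_identity_forward:
  assumes "e \<le> 1"
  shows "(\<Sum>x\<in>triples L. q powi summand_exp False e L x * qbinom3 q e L x) =
     (\<Sum>x\<in>window L. theta_sign x * q powi theta_exp False e x * qbinom (q\<^sup>2) (int (2 * L)) (int L - theta_pos e x))"
proof -
  have pell: "qpell e (int i) = (\<Sum>(j,k)\<in>{..L} \<times> {..L}. qpell_term e (int i) (int j, int k))" if "i \<le> L" for i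
  proof -
    have "qpell e (int i) = (\<Sum>jk\<in>{0..int L} \<times> {0..int L}. qpell_term e (int i) jk)"
      unfolding qpell_def by (rule infsum_finite_support) (use that in \<open>auto intro!: qpell_term_support\<close>)
    also have "\<dots> = (\<Sum>(j,k)\<in>{..L} \<times> {..L}. qpell_term e (int i) (int j, int k))"
      by (rule sum.reindex_bij_witness[of _ "\<lambda>(j,k). (int j, int k)" "\<lambda>(j,k). (nat j, nat k)"]) auto
    finally show ?thesis .
  qed
  have "(\<Sum>x\<in>triples L. q powi summand_exp False e L x * qbinom3 q e L x) =
    (\<Sum>i\<le>L. \<Sum>x\<in>{..L} \<times> {..L}. q powi summand_exp False e L (i, x) * qbinom3 q e L (i, x))"
    unfolding triples_def by (subst sum.cartesian_product) (simp add: case_prod_unfold)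
  also have "\<dots> = (\<Sum>i\<le>L. q powi (int i * int i) * qbinom (q\<^sup>2) (int L) (int i) * qpell e (int i))"
  proof (rule sum.cong[OF refl])
    fix i assume "i \<in> {..L}"
    then have "i \<le> L" by simp
    show "(\<Sum>x\<in>{..L} \<times> {..L}. q powi summand_exp False e L (i, x) * qbinom3 q e L (i, x)) =
       q powi (int i * int i) * qbinom (q\<^sup>2) (int L) (int i) * qpell e (int i)"
      unfolding pell[OF \<open>i \<le> L\<close>] sum_distrib_left
    proof (rule sum.cong[OF refl], clarify)
      fix j k
      have "q powi summand_exp False e L (i, j, k) = q powi (int i * int i) *
        q powi (int j * int j + int k * int k + 2 * int e * int j)"
        unfolding powi_split[OF refl, symmetric] by (simp add: summand_exp_def power2_eq_square add_ac)
      then show "q powi summand_exp False e L (i, j, k) * qbinom3 q e L (i, j, k) =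
        q powi (int i * int i) * qbinom (q\<^sup>2) (int L) (int i) * qpell_term e (int i) (int j, int k)"
        by (simp add: qbinom3_def qpell_term_def)
    qed
  qed
  also have "\<dots> = (\<Sum>i\<in>{0..int L}. q powi (i * i) * qbinom (q\<^sup>2) (int L) i * qpell e i)"
    by (rule sum.reindex_bij_witness[of _ nat int]) auto
  also have "\<dots> = (\<Sum>\<^sub>\<infinity>n. theta_wt e n * (q powi ((4 * n + int e) * (4 * n + int e)) * qbinom (q\<^sup>2) (int (2 * L)) (int L - (4 * n + int e))
     + q powi ((4 * n + int e + 1) * (4 * n + int e + 1)) * qbinom (q\<^sup>2) (int (2 * L)) (int L - (4 * n + int e + 1))))"
    by (rule finite_identity[OF assms])
  also have "\<dots> = (\<Sum>\<^sub>\<infinity>n. \<Sum>b\<in>UNIV. theta_sign (n, b) * q powi theta_exp False e (n, b) * qbinom (q\<^sup>2) (int (2 * L)) (int L - theta_pos e (n, b)))"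
  proof (rule infsum_cong)
    fix n :: int
    have "theta_sign (n, b) * q powi theta_exp False e (n, b) = theta_wt e n * q powi ((4 * n + int e + of_bool b) * (4 * n + int e + of_bool b))" for b
      unfolding theta_sign_def theta_wt_def fst_conv mult.assoc powi_split[OF refl, symmetric]
      by (simp add: theta_exp_def power2_eq_square add_ac)
    then show "theta_wt e n * (q powi ((4 * n + int e) * (4 * n + int e)) * qbinom (q\<^sup>2) (int (2 * L)) (int L - (4 * n + int e))
     + q powi ((4 * n + int e + 1) * (4 * n + int e + 1)) * qbinom (q\<^sup>2) (int (2 * L)) (int L - (4 * n + int e + 1)))
     = (\<Sum>b\<in>UNIV. theta_sign (n, b) * q powi theta_exp False e (n, b) * qbinom (q\<^sup>2) (int (2 * L)) (int L - theta_pos e (n, b)))"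
      by (simp add: UNIV_bool theta_pos_def algebra_simps)
  qed
  also have "\<dots> = (\<Sum>n\<in>{- (int L + 2) .. int L + 2}. \<Sum>b\<in>UNIV. theta_sign (n, b) * q powi theta_exp False e (n, b) * qbinom (q\<^sup>2) (int (2 * L)) (int L - theta_pos e (n, b)))"
    by (rule infsum_finite_support) (use qbinom_outside_window[OF assms, of _ L] in \<open>auto simp: window_def\<close>)
  also have "\<dots> = (\<Sum>x\<in>window L. theta_sign x * q powi theta_exp False e x * qbinom (q\<^sup>2) (int (2 * L)) (int L - theta_pos e x))"
    unfolding window_def by (subst sum.cartesian_product) (simp add: case_prod_unfold)
  finally show ?thesis .
qed

text \<open>
  The dual case is the direct one for the base \<open>1/q\<close>, multiplied by \<open>q^(2 L^2)\<close>.
\<close>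
lemma (in generic_base) finite_identity_powi:
  assumes "e \<le> 1"
  shows "(\<Sum>x\<in>triples L. q powi summand_exp dual e L x * qbinom3 q e L x) =
     (\<Sum>x\<in>window L. theta_sign x * q powi theta_exp dual e x * qbinom (q\<^sup>2) (int (2 * L)) (int L - theta_pos e x))"
proof (cases dual)
  case False then show ?thesis using finite_identity_forward[OF assms, of L] by simp
next
  case True
  have gen': "generic_base (inverse q)"
    by unfold_locales (use q_nz q_not_root in \<open>auto simp: power_inverse\<close>)
  have inv: "inverse q powi x = q powi (- x)" for x
    by (simp add: power_int_inverse power_int_minus)
  have "(\<Sum>x\<in>triples L. q powi summand_exp dual e L x * qbinom3 q e L x) =
    (\<Sum>x\<in>triples L. q powi (2 * (int L)\<^sup>2) * (inverse q powi summand_exp False e L x * qbinom3 (inverse q) e L x))"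
  proof (rule sum.cong[OF refl], clarify)
    fix i j k
    have "q powi summand_exp dual e L (i, j, k) = q powi (2 * (int L)\<^sup>2) * q powi (- summand_exp False e L (i, j, k))
      * q powi (- (2 * int i * (int L - int i))) * q powi (- (2 * int j * (int i - int k - int e - int j))) *
      q powi (- (2 * int k * (int j - int k)))"
      unfolding powi_split[OF refl, symmetric] using True
      by (simp add: summand_exp_def power2_eq_square algebra_simps)
    then show "q powi summand_exp dual e L (i, j, k) * qbinom3 q e L (i, j, k) =
      q powi (2 * (int L)\<^sup>2) * (inverse q powi summand_exp False e L (i, j, k) * qbinom3 (inverse q) e L (i, j, k))"
      by (simp add: qbinom3_def qbinom_inverse inv)
  qed
  also have "\<dots> = q powi (2 * (int L)\<^sup>2) * (\<Sum>x\<in>window L. theta_sign x * inverse q powi theta_exp False e x *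
      qbinom ((inverse q)\<^sup>2) (int (2 * L)) (int L - theta_pos e x))"
    unfolding sum_distrib_left[symmetric] generic_base.finite_identity_forward[OF gen' assms] ..
  also have "\<dots> = (\<Sum>x\<in>window L. theta_sign x * q powi theta_exp dual e x * qbinom (q\<^sup>2) (int (2 * L)) (int L - theta_pos e x))"
    unfolding sum_distrib_left
  proof (rule sum.cong[OF refl], clarify)
    fix n b
    define a where "a = theta_pos e (n, b)"
    have e: "theta_exp dual e (n, b) = 2 * (int L)\<^sup>2 + - theta_exp False e (n, b) + - (2 * (int L - a) * (int (2 * L) - (int L - a)))"
      using True by (simp add: theta_exp_def a_def theta_pos_def power2_eq_square algebra_simps)
    show "q powi (2 * (int L)\<^sup>2) * (theta_sign (n, b) * inverse q powi theta_exp False e (n, b) *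
         qbinom ((inverse q)\<^sup>2) (int (2 * L)) (int L - theta_pos e (n, b))) =
       theta_sign (n, b) * q powi theta_exp dual e (n, b) * qbinom (q\<^sup>2) (int (2 * L)) (int L - theta_pos e (n, b))"
      unfolding a_def[symmetric] qbinom_inverse inv e powi_split[OF refl] by (simp only: mult_ac)
  qed
  finally show ?thesis .
qed

lemma generic_base_norm_less_1:
  assumes "norm q < 1" "q \<noteq> 0" shows "generic_base q"
proof
  fix n :: nat assume "n > 0"
  then have "norm (q ^ n) < 1" using assms(1) by (simp add: norm_power power_less_one_iff)
  then show "q ^ n \<noteq> 1" by auto
qed (rule assms(2))

lemma isCont_qbinom_0: "isCont (\<lambda>q. qbinom (q\<^sup>2) n m) 0"
proof (cases "n \<ge> m \<and> m \<ge> 0")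
  case True
  have "qpoch 0 0 n \<noteq> 0" for n by (simp add: qpoch_def)
  moreover have "isCont (\<lambda>q :: complex. qpoch (q\<^sup>2) (q\<^sup>2) n) 0" for n
    unfolding qpoch_def by (intro continuous_intros)
  ultimately show ?thesis using True
    by (simp add: qbinom_def)
next
  case False
  then have "(\<lambda>q. qbinom (q\<^sup>2) n m) = (\<lambda>_. 0)" by (auto simp: qbinom_def)
  then show ?thesis by simp
qed

text \<open>
  With natural exponents, both sides are continuous at \<open>q = 0\<close>. So the identity passes from the
  punctured disc to the origin, which the inversion of the base cannot reach.
\<close>
theorem finite_identity_unit_disc:
  assumes "e \<le> 1" "norm q < 1"
  shows "(\<Sum>x\<in>triples L. q ^ nat (summand_exp dual e L x) * qbinom3 q e L x) =
     (\<Sum>x\<in>window L. theta_sign x * q ^ nat (theta_exp dual e x) * qbinom (q\<^sup>2) (int (2 * L)) (int L - theta_pos e x))"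
    (is "?l q = ?r q")
proof -
  have nz: "?l q = ?r q" if q: "norm q < 1" "q \<noteq> 0" for q
  proof -
    interpret generic_base q by (rule generic_base_norm_less_1[OF q])
    have "?l q = (\<Sum>x\<in>triples L. q powi summand_exp dual e L x * qbinom3 q e L x)"
    proof (rule sum.cong[OF refl], clarify)
      fix i j k
      show "q ^ nat (summand_exp dual e L (i, j, k)) * qbinom3 q e L (i, j, k) =
        q powi summand_exp dual e L (i, j, k) * qbinom3 q e L (i, j, k)"
        using qbinom3_support[of q e L i j k] summand_exp_nonneg[of i L dual e j k]
        by (cases "qbinom3 q e L (i, j, k) = 0") (auto simp: power_int_nonneg_exp)
    qed
    also have "\<dots> = ?r q"
      unfolding finite_identity_powi[OF assms(1)]
    proof (rule sum.cong[OF refl])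
      fix x :: "int \<times> bool"
      show "theta_sign x * q powi theta_exp dual e x * qbinom (q\<^sup>2) (int (2 * L)) (int L - theta_pos e x) =
        theta_sign x * q ^ nat (theta_exp dual e x) * qbinom (q\<^sup>2) (int (2 * L)) (int L - theta_pos e x)"
        using theta_exp_nonneg[OF assms(1), of dual "fst x" "snd x"] by (simp add: power_int_nonneg_exp)
    qed
    finally show ?thesis .
  qed
  show ?thesis
  proof (cases "q = 0")
    case False then show ?thesis using nz assms(2) by simp
  next
    case True
    have "isCont ?l 0" unfolding qbinom3_def case_prod_unfold
      by (intro continuous_intros isCont_qbinom_0)
    then have l: "(?l \<longlongrightarrow> ?l 0) (at 0)" by (simp only: isCont_def)
    have "isCont ?r 0"
      by (intro continuous_intros isCont_qbinom_0)
    then have r: "(?r \<longlongrightarrow> ?r 0) (at 0)" by (simp only: isCont_def)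
    have "eventually (\<lambda>q :: complex. ?l q = ?r q) (at 0)"
      unfolding eventually_at by (rule exI[of _ 1]) (use nz in auto)
    then have "(?r \<longlongrightarrow> ?l 0) (at 0)" using l by (rule Lim_transform_eventually[rotated])
    then have "?l 0 = ?r 0" using r by (rule tendsto_unique[rotated]) simp
    then show ?thesis unfolding True .
  qed
qed

section \<open>Interchange of limits and sums\<close>

text \<open>
  Dominated convergence for series (the theorem of Tannery): the bound makes the finite partial sums
  converge uniformly in \<open>N\<close>.
\<close>
lemma tannery_infsum:
  fixes f :: "nat \<Rightarrow> 'a \<Rightarrow> complex" and h :: "'a \<Rightarrow> real"
  assumes lim: "\<And>x. (\<lambda>N. f N x) \<longlonglongrightarrow> g x"
    and bound: "\<And>N x. norm (f N x) \<le> h x"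
    and h: "h summable_on UNIV"
  shows "(\<lambda>N. \<Sum>\<^sub>\<infinity>x. f N x) \<longlonglongrightarrow> (\<Sum>\<^sub>\<infinity>x. g x)"
proof (rule swap_uniform_limit'[where S = UNIV and F = "finite_subsets_at_top UNIV"
      and f = "\<lambda>X N. \<Sum>x\<in>X. f N x" and g = "\<lambda>X. \<Sum>x\<in>X. g x"])
  have "norm (g x) \<le> h x" for x
    using tendsto_norm[OF lim] by (rule LIMSEQ_le_const2) (use bound in auto)
  then have "(\<lambda>x. norm (g x)) summable_on UNIV"
    using Infinite_Sum.abs_summable_on_comparison_test'[OF h] by blast
  then have "g summable_on UNIV" by (rule abs_summable_summable)
  then have "(g has_sum infsum g UNIV) UNIV" by (rule has_sum_infsum)
  then show "(sum g \<longlongrightarrow> infsum g UNIV) (finite_subsets_at_top UNIV)" by (simp add: has_sum_def)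
  show "uniform_limit UNIV (\<lambda>X N. \<Sum>x\<in>X. f N x) (\<lambda>N. \<Sum>\<^sub>\<infinity>x. f N x) (finite_subsets_at_top UNIV)"
    by (rule Weierstrass_m_test_general[OF _ h]) (rule bound)
  show "\<forall>\<^sub>F X in finite_subsets_at_top UNIV. (\<lambda>N. \<Sum>x\<in>X. f N x) \<longlonglongrightarrow> (\<Sum>x\<in>X. g x)"
    by (intro always_eventually allI tendsto_sum lim)
qed auto

lemma summable_geometric_int:
  assumes "0 \<le> y" "y < (1 :: real)"
  shows "(\<lambda>n :: int. y ^ nat \<bar>n\<bar>) summable_on UNIV"
proof -
  have g: "(\<lambda>n :: nat. y ^ n) summable_on UNIV"
    using assms by (simp add: summable_on_UNIV_nonneg_real_iff summable_geometric)
  have "(\<lambda>n :: int. y ^ nat \<bar>n\<bar>) summable_on range int"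
    by (subst summable_on_reindex) (use g in \<open>auto simp: o_def\<close>)
  moreover have "(\<lambda>n :: int. y ^ nat \<bar>n\<bar>) summable_on range (\<lambda>n. - int n)"
    by (subst summable_on_reindex) (use g in \<open>auto simp: o_def inj_on_def\<close>)
  ultimately have "(\<lambda>n :: int. y ^ nat \<bar>n\<bar>) summable_on (range int \<union> range (\<lambda>n. - int n))"
    by (rule summable_on_union)
  moreover have "range int \<union> range (\<lambda>n. - int n) = UNIV"
  proof (intro equalityI subsetI)
    fix n :: int
    have "n = int (nat n) \<or> n = - int (nat (- n))" by linarith
    then show "n \<in> range int \<union> range (\<lambda>n. - int n)" by blast
  qed simp
  ultimately show ?thesis by simp
qed

lemma summable_on_times_bool:
  fixes f :: "'a \<times> bool \<Rightarrow> 'b :: banach"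
  assumes "\<And>b. (\<lambda>x. f (x, b)) summable_on UNIV"
  shows "f summable_on UNIV" "infsum f UNIV = (\<Sum>\<^sub>\<infinity>x. f (x, False)) + (\<Sum>\<^sub>\<infinity>x. f (x, True))"
proof -
  have un: "UNIV = range (\<lambda>x :: 'a. (x, False)) \<union> range (\<lambda>x :: 'a. (x, True))"
  proof (intro equalityI subsetI)
    fix y :: "'a \<times> bool"
    show "y \<in> range (\<lambda>x. (x, False)) \<union> range (\<lambda>x. (x, True))" by (cases y; cases "snd y") auto
  qed simp
  have inj: "inj (\<lambda>x :: 'a. (x, b))" for b :: bool by (auto simp: inj_on_def)
  have s: "f summable_on range (\<lambda>x. (x, b))" for b
    by (subst summable_on_reindex[OF inj]) (use assms in \<open>simp add: o_def\<close>)
  have e: "infsum f (range (\<lambda>x. (x, b))) = (\<Sum>\<^sub>\<infinity>x. f (x, b))" for b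
    by (subst infsum_reindex[OF inj]) (simp add: o_def)
  have disj: "range (\<lambda>x :: 'a. (x, False)) \<inter> range (\<lambda>x. (x, True)) = {}" by auto
  show "f summable_on UNIV" unfolding un by (rule summable_on_Un_disjoint[OF s s disj])
  show "infsum f UNIV = (\<Sum>\<^sub>\<infinity>x. f (x, False)) + (\<Sum>\<^sub>\<infinity>x. f (x, True))"
    unfolding e[symmetric] by (subst un) (rule infsum_Un_disjoint[OF s s disj])
qed

text \<open>
  The factor \<open>(n + 1)^3\<close> bounds the number of triples \<open>(i, j, k)\<close> that belong to a chain with
  largest element \<open>n\<close>.
\<close>
lemma summable_cubic_geometric:
  assumes "0 \<le> y" "y < (1 :: real)"
  shows "(\<lambda>n :: nat. real ((n + 1) ^ 3) * y ^ (n\<^sup>2)) summable_on UNIV"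
proof -
  \<comment> \<open>Three of the four factors \<open>z ^ n\<close> of \<open>y ^ n\<close> absorb the cube, the last one is summed.\<close>
  define z where "z = root 4 y"
  have z: "0 \<le> z" "z < 1" "z ^ 4 = y" using assms by (auto simp: z_def real_root_lt_1_iff)
  have "(\<lambda>n. real n * z ^ n + z ^ n) \<longlonglongrightarrow> 0 + 0"
    by (intro tendsto_add powser_times_n_limit_0 LIMSEQ_power_zero) (use z in auto)
  then have "Bseq (\<lambda>n. real n * z ^ n + z ^ n)" by (intro convergent_imp_Bseq) (auto simp: convergent_def)
  then obtain K where K: "\<And>n. norm (real n * z ^ n + z ^ n) \<le> K" by (auto simp: Bseq_def)
  have K': "real (n + 1) * z ^ n \<le> K" for n
  proof -
    have "real (n + 1) * z ^ n = real n * z ^ n + z ^ n" by (simp add: algebra_simps)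
    also have "\<dots> \<le> norm (real n * z ^ n + z ^ n)" by simp
    finally show ?thesis using K[of n] by linarith
  qed
  have bound: "norm (real ((n + 1) ^ 3) * y ^ (n\<^sup>2)) \<le> K ^ 3 * z ^ n" for n
  proof -
    have "y ^ (n\<^sup>2) \<le> y ^ n" using assms by (intro power_decreasing) (auto simp: power2_eq_square)
    then have "norm (real ((n + 1) ^ 3) * y ^ (n\<^sup>2)) \<le> real ((n + 1) ^ 3) * y ^ n"
      using assms by (simp add: mult_left_mono)
    also have "\<dots> = (real (n + 1) * z ^ n) ^ 3 * z ^ n"
      by (simp add: z(3)[symmetric] power_mult_distrib flip: power_mult power_add)
    also have "\<dots> \<le> K ^ 3 * z ^ n"
      using K'[of n] z by (intro mult_right_mono power_mono) auto
    finally show ?thesis .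
  qed
  have "(\<lambda>n. K ^ 3 * z ^ n) summable_on UNIV"
    by (rule summable_on_cmult_right) (use z in \<open>simp add: summable_on_UNIV_nonneg_real_iff summable_geometric\<close>)
  then show ?thesis
    by (rule abs_summable_summable[OF Infinite_Sum.abs_summable_on_comparison_test']) (rule bound)
qed

text \<open>
  This splits an unordered sum into finite blocks. It is used with the blocks of all indices whose
  chain has the same largest element and, when there is no chain, of all indices with the same \<open>i\<close>.
\<close>
lemma has_sum_finite_blocks:
  fixes g :: "'a \<Rightarrow> complex" and E :: "nat \<Rightarrow> 'a set"
  assumes fin: "\<And>M. finite (E M)"
    and disj: "\<And>M N x. x \<in> E M \<Longrightarrow> x \<in> E N \<Longrightarrow> M = N"
    and sub: "\<And>M. E M \<subseteq> S" and zero: "\<And>x. x \<in> S \<Longrightarrow> (\<And>M. x \<notin> E M) \<Longrightarrow> g x = 0"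
    and bound: "\<And>M. (\<Sum>x\<in>E M. norm (g x)) \<le> h M" and h: "h summable_on UNIV"
    and sums: "((\<lambda>M. \<Sum>x\<in>E M. g x) has_sum V) UNIV"
  shows "(g has_sum V) S"
proof -
  have 1: "(\<lambda>x. norm ((g \<circ> snd) x)) summable_on Sigma UNIV E"
    unfolding Infinite_Sum.abs_summable_on_Sigma_iff
  proof (intro conjI ballI)
    show "(\<lambda>y. norm ((g \<circ> snd) (M, y))) summable_on E M" for M using fin by simp
    have "(\<lambda>M. norm (\<Sum>x\<in>E M. norm (g x))) summable_on UNIV"
      by (rule Infinite_Sum.abs_summable_on_comparison_test'[OF h]) (use bound in \<open>auto simp: sum_nonneg\<close>)
    then show "(\<lambda>M. norm (\<Sum>\<^sub>\<infinity>y\<in>E M. norm ((g \<circ> snd) (M, y)))) summable_on UNIV"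
      using fin by simp
  qed
  then have "(g \<circ> snd) summable_on Sigma UNIV E" by (rule abs_summable_summable)
  then have "((g \<circ> snd) has_sum V) (Sigma UNIV E)"
    by (rule has_sum_SigmaI[OF _ sums, rotated]) (use fin in auto)
  moreover have "inj_on snd (Sigma UNIV E)" using disj by (auto simp: inj_on_def)
  ultimately have "(g has_sum V) (snd ` Sigma UNIV E)" by (simp add: has_sum_reindex)
  then show ?thesis
    by (rule has_sum_cong_neutral[THEN iffD1, rotated -1]) (use sub zero in \<open>force+\<close>)
qed

section \<open>Shifted factorials on the unit disc\<close>

locale unit_disc =
  fixes Q :: complex
  assumes norm_Q: "norm Q < 1"
begin

sublocale nonroot Q
proof
  fix n :: nat assume "n > 0"
  then have "norm (Q ^ n) < 1" using norm_Q by (simp add: norm_power power_less_one_iff)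
  then show "Q ^ n \<noteq> 1" by auto
qed

lemma convergent_qpoch: "convergent_prod (\<lambda>i. 1 - a * Q ^ i)"
proof (rule abs_convergent_prod_imp_convergent_prod, rule summable_imp_abs_convergent_prod)
  have "summable (\<lambda>i. norm a * norm Q ^ i)" using norm_Q by (intro summable_mult summable_geometric) simp
  then show "summable (\<lambda>i. norm (1 - a * Q ^ i - 1))" by (simp add: norm_mult norm_power)
qed

lemma qpoch_LIMSEQ: "(\<lambda>n. qpoch a Q n) \<longlonglongrightarrow> qpoch_inf a Q"
  using convergent_prod_LIMSEQ[OF convergent_qpoch[of a]]
  unfolding qpoch_def qpoch_inf_def by (simp add: LIMSEQ_lessThan_iff_atMost)

lemma qpoch_inf_nonzero: "qpoch_inf Q Q \<noteq> 0"
  unfolding qpoch_inf_def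
proof (rule prodinf_nonzero[OF convergent_qpoch])
  show "1 - Q * Q ^ i \<noteq> 0" for i using not_root[of "Suc i"] by simp
qed

lemma recip_qfact_LIMSEQ: "(\<lambda>N. recip_qfact Q (int N + c)) \<longlonglongrightarrow> inverse (qpoch_inf Q Q)"
proof -
  have "filterlim (\<lambda>N. nat (int N + c)) at_top sequentially"
    unfolding filterlim_at_top
  proof
    fix Z :: nat
    show "\<forall>\<^sub>F N in sequentially. Z \<le> nat (int N + c)"
      using eventually_ge_at_top[of "nat (int Z + \<bar>c\<bar>)"] by eventually_elim linarith
  qed
  then have "(\<lambda>N. inverse (qpoch Q Q (nat (int N + c)))) \<longlonglongrightarrow> inverse (qpoch_inf Q Q)"
    by (intro tendsto_inverse qpoch_inf_nonzero filterlim_compose[OF qpoch_LIMSEQ])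
  moreover have "\<forall>\<^sub>F N in sequentially. inverse (qpoch Q Q (nat (int N + c))) = recip_qfact Q (int N + c)"
    using eventually_ge_at_top[of "nat \<bar>c\<bar>"] by eventually_elim (auto simp: recip_qfact_def)
  ultimately show ?thesis by (rule Lim_transform_eventually)
qed

lemma bounded_qpoch: obtains C where "C > 0" "\<And>n. norm (qpoch Q Q n) \<le> C"
  using convergent_imp_Bseq[of "\<lambda>n. qpoch Q Q n"] qpoch_LIMSEQ by (auto simp: convergent_def Bseq_def)

lemma bounded_recip_qfact: obtains C where "C > 0" "\<And>n. norm (recip_qfact Q n) \<le> C"
proof -
  have "(\<lambda>n. inverse (qpoch Q Q n)) \<longlonglongrightarrow> inverse (qpoch_inf Q Q)"
    by (intro tendsto_inverse qpoch_inf_nonzero qpoch_LIMSEQ)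
  then obtain C where C: "C > 0" "\<And>n. norm (inverse (qpoch Q Q n)) \<le> C"
    using convergent_imp_Bseq[of "\<lambda>n. inverse (qpoch Q Q n)"] by (auto simp: convergent_def Bseq_def)
  show ?thesis by (rule that[of C]) (use C in \<open>auto simp: recip_qfact_def\<close>)
qed

lemma bounded_qbinom: obtains C where "C > 0" "\<And>n m. norm (qbinom Q n m) \<le> C"
proof -
  obtain C where C: "C > 0" "\<And>n. norm (qpoch Q Q n) \<le> C" by (rule bounded_qpoch) auto
  obtain D where D: "D > 0" "\<And>n. norm (recip_qfact Q n) \<le> D" by (rule bounded_recip_qfact) auto
  have "norm (qbinom Q n m) \<le> C * D * D" for n m
  proof -
    have "norm (qpoch Q Q (nat n) * recip_qfact Q m * recip_qfact Q (n - m)) \<le> C * D * D"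
      unfolding norm_mult by (intro mult_mono C(2) D(2)) (use C(1) D(1) in auto)
    then show ?thesis using C(1) D(1) by (simp add: qbinom_eq)
  qed
  then show ?thesis using that[of "C * D * D"] C(1) D(1) by simp
qed

end

text \<open>
  With \<open>M = j + a\<close> this is \<open>q_vandermonde_limit\<close>, as \<open>j(j + 2a) = M^2 - a^2\<close>.
\<close>
lemma bailey_step:
  assumes "norm q < 1"
  shows "(\<Sum>M\<le>N. (q\<^sup>2) ^ (M\<^sup>2) * recip_qfact (q\<^sup>2) (int N - int M) *
      (recip_qfact (q\<^sup>2) (int M - a) * recip_qfact (q\<^sup>2) (int M + a))) =
    (q\<^sup>2) ^ nat (a\<^sup>2) * (recip_qfact (q\<^sup>2) (int N - a) * recip_qfact (q\<^sup>2) (int N + a))"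
proof (cases "q = 0")
  case True
  have "(\<Sum>M\<le>N. (q\<^sup>2) ^ (M\<^sup>2) * recip_qfact (q\<^sup>2) (int N - int M) *
      (recip_qfact (q\<^sup>2) (int M - a) * recip_qfact (q\<^sup>2) (int M + a))) =
     (\<Sum>M\<in>{0}. (q\<^sup>2) ^ (M\<^sup>2) * recip_qfact (q\<^sup>2) (int N - int M) *
      (recip_qfact (q\<^sup>2) (int M - a) * recip_qfact (q\<^sup>2) (int M + a)))"
    by (rule sum.mono_neutral_right) (use True in auto)
  also have "\<dots> = (q\<^sup>2) ^ nat (a\<^sup>2) * (recip_qfact (q\<^sup>2) (int N - a) * recip_qfact (q\<^sup>2) (int N + a))"
    using True by (cases "a = 0") (auto simp: recip_qfact_def qpoch_def)
  finally show ?thesis .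
next
  case False
  interpret generic_base q by (rule generic_base_norm_less_1[OF assms False])
  have pw: "(q\<^sup>2) ^ nat (x\<^sup>2) = q powi (2 * x\<^sup>2)" for x :: int
    by (simp add: power_int_nonneg_exp nat_mult_distrib power_mult)
  define g where "g M = q powi (2 * M\<^sup>2) * recip_qfact (q\<^sup>2) (int N - M) *
      (recip_qfact (q\<^sup>2) (M - a) * recip_qfact (q\<^sup>2) (M + a))" for M
  have pwn: "(q\<^sup>2) ^ (M\<^sup>2) = q powi (2 * (int M)\<^sup>2)" for M
    using pw[of "int M"] by (simp add: nat_power_eq)
  have g0: "g M = 0" if "M \<notin> {0..int N}" for M
  proof -
    have "int N - M < 0 \<or> M - a < 0 \<or> M + a < 0" using that by auto
    then show ?thesis by (auto simp: g_def)
  qed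
  have "(\<Sum>M\<le>N. (q\<^sup>2) ^ (M\<^sup>2) * recip_qfact (q\<^sup>2) (int N - int M) *
      (recip_qfact (q\<^sup>2) (int M - a) * recip_qfact (q\<^sup>2) (int M + a))) = (\<Sum>M\<in>{0..int N}. g M)"
    unfolding pwn g_def by (rule sum.reindex_bij_witness[of _ nat int]) auto
  also have "\<dots> = (\<Sum>\<^sub>\<infinity>M. g M)"
    by (rule infsum_finite_support[symmetric]) (use g0 in auto)
  also have "\<dots> = (\<Sum>\<^sub>\<infinity>j. g (j + a))"
    by (rule infsum_reindex_bij_witness[of _ "\<lambda>j. j + a" "\<lambda>M. M - a"]) auto
  also have "\<dots> = q powi (2 * a\<^sup>2) * vandermonde (\<lambda>_. 1) (int N - a) (2 * a)"
    unfolding vandermonde_def infsum_cmult_right'[symmetric]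
  proof (rule infsum_cong)
    fix j
    have e: "2 * (j + a)\<^sup>2 = 2 * a\<^sup>2 + 2 * (j * (j + 2 * a))" by (simp add: power2_eq_square algebra_simps)
    have e2: "int N - (j + a) = int N - a - j" "j + a - a = j" "j + a + a = j + 2 * a" by simp_all
    show "g (j + a) = q powi (2 * a\<^sup>2) * (q powi (2 * (j * (j + 2 * a))) * (recip_qfact (q\<^sup>2) j *
       recip_qfact (q\<^sup>2) (j + 2 * a) * recip_qfact (q\<^sup>2) (int N - a - j)) * 1)"
      unfolding g_def e e2 powi_split[OF refl] by simp
  qed
  also have "\<dots> = (q\<^sup>2) ^ nat (a\<^sup>2) * (recip_qfact (q\<^sup>2) (int N - a) * recip_qfact (q\<^sup>2) (int N + a))"
    unfolding q_vandermonde_limit pw by (simp add: add.commute[of a])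
  finally show ?thesis .
qed

section \<open>Chains and the Bailey lemma\<close>

text \<open>
  Chains are grouped by their largest element: each group is finite, and removing the largest
  element of a chain gives a recursion between the groups.
\<close>
definition top_chains :: "nat \<Rightarrow> nat \<Rightarrow> (nat \<Rightarrow> nat) set" where
  "top_chains p M = {m \<in> chains p. m p = M}"

lemma top_chains_1: "top_chains (Suc 0) M = {(\<lambda>r\<in>{1}. M)}"
  by (auto simp: top_chains_def chains_def fun_eq_iff PiE_iff extensional_def)

lemma bij_betw_top_chains_Suc:
  assumes "p \<ge> 1"
  shows "bij_betw (\<lambda>(k, m). m(Suc p := M)) (SIGMA k:{..M}. top_chains p k) (top_chains (Suc p) M)"
proof (rule bij_betw_byWitness[where f' = "\<lambda>m. (m p, m(Suc p := undefined))"])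
  show "\<forall>a\<in>SIGMA k:{..M}. top_chains p k. (\<lambda>m. (m p, m(Suc p := undefined))) ((\<lambda>(k, m). m(Suc p := M)) a) = a"
    by (auto simp: top_chains_def chains_def fun_eq_iff PiE_iff extensional_def)
  show "\<forall>a'\<in>top_chains (Suc p) M. (\<lambda>(k, m). m(Suc p := M)) ((\<lambda>m. (m p, m(Suc p := undefined))) a') = a'"
    by (auto simp: top_chains_def fun_eq_iff)
  show "(\<lambda>(k, m). m(Suc p := M)) ` (SIGMA k:{..M}. top_chains p k) \<subseteq> top_chains (Suc p) M"
  proof clarify
    fix k m assume k: "k \<le> M" and m: "m \<in> top_chains p k"
    have "(m(Suc p := M)) r \<le> (m(Suc p := M)) (Suc r)" if "r \<in> {1..<Suc p}" for r
      using that k m by (cases "r = p") (auto simp: top_chains_def chains_def)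
    moreover have "m(Suc p := M) \<in> {1..Suc p} \<rightarrow>\<^sub>E UNIV"
      using m by (auto simp: top_chains_def chains_def PiE_iff extensional_def)
    ultimately show "m(Suc p := M) \<in> top_chains (Suc p) M"
      by (simp add: top_chains_def chains_def)
  qed
  show "(\<lambda>m. (m p, m(Suc p := undefined))) ` top_chains (Suc p) M \<subseteq> (SIGMA k:{..M}. top_chains p k)"
  proof clarify
    fix m assume m: "m \<in> top_chains (Suc p) M"
    have "m p \<le> M" using m assms by (auto simp: top_chains_def chains_def)
    moreover have "m(Suc p := undefined) \<in> {1..p} \<rightarrow>\<^sub>E UNIV"
      using m by (auto simp: top_chains_def chains_def PiE_iff extensional_def)
    moreover have "(m(Suc p := undefined)) r \<le> (m(Suc p := undefined)) (Suc r)" if "r \<in> {1..<p}" for r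
      using that m by (auto simp: top_chains_def chains_def)
    ultimately show "m p \<in> {..M} \<and> m(Suc p := undefined) \<in> top_chains p (m p)"
      by (simp add: top_chains_def chains_def)
  qed
qed

lemma finite_top_chains: "p \<ge> 1 \<Longrightarrow> finite (top_chains p M)"
proof (induction p arbitrary: M rule: nat_induct_at_least)
  case base then show ?case using top_chains_1[of M] by simp
next
  case (Suc p)
  show ?case
    using bij_betw_finite[OF bij_betw_top_chains_Suc[OF Suc.hyps, of M]] Suc.IH by simp
qed

lemma sum_top_chains_Suc:
  fixes h :: "(nat \<Rightarrow> nat) \<Rightarrow> 'b :: comm_monoid_add"
  assumes "p \<ge> 1"
  shows "(\<Sum>m\<in>top_chains (Suc p) M. h m) = (\<Sum>k\<le>M. \<Sum>m\<in>top_chains p k. h (m(Suc p := M)))"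
proof -
  have "(\<Sum>m\<in>top_chains (Suc p) M. h m) = (\<Sum>x\<in>(SIGMA k:{..M}. top_chains p k). h ((\<lambda>(k, m). m(Suc p := M)) x))"
    by (rule sum.reindex_bij_betw[symmetric, OF bij_betw_top_chains_Suc[OF assms]])
  also have "\<dots> = (\<Sum>k\<le>M. \<Sum>m\<in>top_chains p k. h (m(Suc p := M)))"
    by (subst sum.Sigma) (auto simp: finite_top_chains[OF assms] case_prod_unfold)
  finally show ?thesis .
qed

lemma chain_le_top:
  assumes "m \<in> top_chains p M" "p \<ge> 1"
  shows "m 1 \<le> M"
proof -
  have "r \<le> p \<Longrightarrow> m 1 \<le> m r" if "r \<ge> 1" for r
    using that
  proof (induction r rule: nat_induct_at_least)
    case (Suc r)
    have "m r \<le> m (Suc r)" using Suc.hyps Suc.prems assms by (auto simp: top_chains_def chains_def)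
    then show ?case using Suc.IH Suc.prems by simp
  qed simp
  from this[of p] show ?thesis using assms by (simp add: top_chains_def)
qed

definition chain_weight :: "complex \<Rightarrow> nat \<Rightarrow> (nat \<Rightarrow> nat) \<Rightarrow> complex" where
  "chain_weight q p m = (q\<^sup>2) ^ (\<Sum>r=1..p. (m r)\<^sup>2) / chain_denom q p m"

lemma chain_weight_1: "m 1 = M \<Longrightarrow> chain_weight q (Suc 0) m = (q\<^sup>2) ^ (M\<^sup>2) / qpoch (q\<^sup>2) (q\<^sup>2) (2 * M)"
  by (simp add: chain_weight_def chain_denom_def)

lemma chain_weight_Suc:
  assumes "p \<ge> 1"
  shows "chain_weight q (Suc p) (m(Suc p := M)) =
    (q\<^sup>2) ^ (M\<^sup>2) / qpoch (q\<^sup>2) (q\<^sup>2) (M - m p) * chain_weight q p m"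
proof -
  have 1: "(\<Sum>r=1..Suc p. ((m(Suc p := M)) r)\<^sup>2) = (\<Sum>r=1..p. (m r)\<^sup>2) + M\<^sup>2" by simp
  have "(\<Prod>r=1..<Suc p. qpoch (q\<^sup>2) (q\<^sup>2) ((m(Suc p := M)) (Suc r) - (m(Suc p := M)) r)) =
     (\<Prod>r=1..<p. qpoch (q\<^sup>2) (q\<^sup>2) (m (Suc r) - m r)) * qpoch (q\<^sup>2) (q\<^sup>2) (M - m p)"
    using assms by (subst prod.atLeastLessThan_Suc) auto
  then have 2: "chain_denom q (Suc p) (m(Suc p := M)) = qpoch (q\<^sup>2) (q\<^sup>2) (M - m p) * chain_denom q p m"
    using assms by (simp add: chain_denom_def)
  show ?thesis unfolding chain_weight_def 1 2 by (simp add: power_add)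
qed

text \<open>
  The coefficients \<open>\<alpha> x\<close> sit at the positions \<open>A x\<close>. \<open>bailey_alpha p\<close> and \<open>bailey_beta p\<close> are the two
  sequences of the Bailey pair reached after \<open>p\<close> steps, where the first one keeps track of the index
  \<open>x\<close> instead of collecting the coefficients at the same position.
\<close>
locale bailey =
  fixes q :: complex and \<alpha> :: "'i \<Rightarrow> complex" and A :: "'i \<Rightarrow> int"
  assumes norm_q: "norm q < 1" and summable_alpha: "(\<lambda>x. norm (\<alpha> x)) summable_on UNIV"
begin

sublocale unit_disc "q\<^sup>2"
  by unfold_locales (use norm_q in \<open>simp add: norm_power power_less_one_iff\<close>)

definition bailey_alpha :: "nat \<Rightarrow> 'i \<Rightarrow> complex" where
  "bailey_alpha p x = \<alpha> x * (q\<^sup>2) ^ (p * nat ((A x)\<^sup>2))"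

definition bailey_beta :: "nat \<Rightarrow> nat \<Rightarrow> complex" where
  "bailey_beta p N = (\<Sum>\<^sub>\<infinity>x. bailey_alpha p x * (recip_qfact (q\<^sup>2) (int N - A x) * recip_qfact (q\<^sup>2) (int N + A x)))"

definition theta :: "nat \<Rightarrow> complex" where
  "theta p = (\<Sum>\<^sub>\<infinity>x. bailey_alpha p x)"

lemma norm_bailey_alpha: "norm (bailey_alpha p x) \<le> norm (\<alpha> x)"
  using norm_Q by (simp add: bailey_alpha_def norm_mult norm_power mult_left_le power_le_one)

lemma norm_power_Q_le_1: "norm ((q\<^sup>2) ^ n) \<le> 1"
  unfolding norm_power[of "q\<^sup>2"] using norm_Q by (intro power_le_one) auto

lemma bailey_summable:
  assumes "\<And>x. norm (g x) \<le> C"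
  shows "(\<lambda>x. bailey_alpha p x * g x) summable_on UNIV"
proof (rule abs_summable_summable, rule Infinite_Sum.abs_summable_on_comparison_test')
  show "(\<lambda>x. norm (\<alpha> x) * C) summable_on UNIV" by (rule summable_on_cmult_left[OF summable_alpha])
  show "norm (bailey_alpha p x * g x) \<le> norm (\<alpha> x) * C" for x
    unfolding norm_mult by (intro mult_mono norm_bailey_alpha assms) auto
qed

lemma bailey_beta_Suc:
  "bailey_beta (Suc p) N = (\<Sum>M\<le>N. (q\<^sup>2) ^ (M\<^sup>2) * recip_qfact (q\<^sup>2) (int N - int M) * bailey_beta p M)"
proof -
  obtain C where C: "C > 0" "\<And>n. norm (recip_qfact (q\<^sup>2) n) \<le> C" by (rule bounded_recip_qfact) auto
  have bd: "norm ((q\<^sup>2) ^ (M\<^sup>2) * recip_qfact (q\<^sup>2) (int N - int M) *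
      (recip_qfact (q\<^sup>2) (int M - A x) * recip_qfact (q\<^sup>2) (int M + A x))) \<le> 1 * C * (C * C)" for M x
    unfolding norm_mult by (intro mult_mono norm_power_Q_le_1 C(2)) (use C(1) in auto)
  have "bailey_beta (Suc p) N = (\<Sum>\<^sub>\<infinity>x. \<Sum>M\<le>N. bailey_alpha p x * ((q\<^sup>2) ^ (M\<^sup>2) * recip_qfact (q\<^sup>2) (int N - int M) *
      (recip_qfact (q\<^sup>2) (int M - A x) * recip_qfact (q\<^sup>2) (int M + A x))))"
    unfolding bailey_beta_def sum_distrib_left[symmetric] bailey_step[OF norm_q]
    by (simp add: bailey_alpha_def power_add mult_ac)
  also have "\<dots> = (\<Sum>M\<le>N. \<Sum>\<^sub>\<infinity>x. bailey_alpha p x * ((q\<^sup>2) ^ (M\<^sup>2) * recip_qfact (q\<^sup>2) (int N - int M) *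
      (recip_qfact (q\<^sup>2) (int M - A x) * recip_qfact (q\<^sup>2) (int M + A x))))"
    by (rule infsum_finite_sum) (use bailey_summable[OF bd] in auto)
  also have "\<dots> = (\<Sum>M\<le>N. (q\<^sup>2) ^ (M\<^sup>2) * recip_qfact (q\<^sup>2) (int N - int M) * bailey_beta p M)"
    unfolding bailey_beta_def infsum_cmult_right'[symmetric] by (simp add: mult_ac)
  finally show ?thesis .
qed

lemma bailey_beta_bounded: obtains C where "C > 0" "\<And>N. norm (bailey_beta p N) \<le> C"
proof -
  obtain C where C: "C > 0" "\<And>n. norm (recip_qfact (q\<^sup>2) n) \<le> C" by (rule bounded_recip_qfact) auto
  define S where "S = (\<Sum>\<^sub>\<infinity>x. norm (\<alpha> x) * (C * C))"
  have "norm (bailey_beta p N) \<le> S" for N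
  proof -
    have le: "norm (bailey_alpha p x * (recip_qfact (q\<^sup>2) (int N - A x) * recip_qfact (q\<^sup>2) (int N + A x))) \<le> norm (\<alpha> x) * (C * C)" for x
      unfolding norm_mult by (intro mult_mono norm_bailey_alpha C(2)) (use C(1) in auto)
    have s: "(\<lambda>x. norm (\<alpha> x) * (C * C)) summable_on UNIV" by (rule summable_on_cmult_left[OF summable_alpha])
    have s': "(\<lambda>x. norm (bailey_alpha p x * (recip_qfact (q\<^sup>2) (int N - A x) * recip_qfact (q\<^sup>2) (int N + A x)))) summable_on UNIV"
      by (rule Infinite_Sum.abs_summable_on_comparison_test'[OF s]) (rule le)
    have "norm (bailey_beta p N) \<le> (\<Sum>\<^sub>\<infinity>x. norm (bailey_alpha p x * (recip_qfact (q\<^sup>2) (int N - A x) * recip_qfact (q\<^sup>2) (int N + A x))))"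
      unfolding bailey_beta_def by (rule norm_infsum_bound[OF s'])
    also have "\<dots> \<le> S" unfolding S_def by (rule infsum_mono[OF s' s]) (rule le)
    finally show ?thesis .
  qed
  then show ?thesis by (intro that[of "max S 1"]) (auto simp: le_max_iff_disj)
qed

lemma bailey_beta_LIMSEQ: "(\<lambda>N. bailey_beta p N) \<longlonglongrightarrow> theta p * (inverse (qpoch_inf (q\<^sup>2) (q\<^sup>2)))\<^sup>2"
proof -
  obtain C where C: "C > 0" "\<And>n. norm (recip_qfact (q\<^sup>2) n) \<le> C" by (rule bounded_recip_qfact) auto
  have "(\<lambda>N. bailey_beta p N) \<longlonglongrightarrow> (\<Sum>\<^sub>\<infinity>x. bailey_alpha p x * (inverse (qpoch_inf (q\<^sup>2) (q\<^sup>2)) * inverse (qpoch_inf (q\<^sup>2) (q\<^sup>2))))"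
    unfolding bailey_beta_def
  proof (rule tannery_infsum[where h = "\<lambda>x. norm (\<alpha> x) * (C * C)"])
    show "(\<lambda>N. bailey_alpha p x * (recip_qfact (q\<^sup>2) (int N - A x) * recip_qfact (q\<^sup>2) (int N + A x)))
       \<longlonglongrightarrow> bailey_alpha p x * (inverse (qpoch_inf (q\<^sup>2) (q\<^sup>2)) * inverse (qpoch_inf (q\<^sup>2) (q\<^sup>2)))" for x
      using recip_qfact_LIMSEQ[of "- A x"] recip_qfact_LIMSEQ[of "A x"] by (intro tendsto_intros) simp_all
    show "norm (bailey_alpha p x * (recip_qfact (q\<^sup>2) (int N - A x) * recip_qfact (q\<^sup>2) (int N + A x))) \<le> norm (\<alpha> x) * (C * C)" for N x
      unfolding norm_mult by (intro mult_mono norm_bailey_alpha C(2)) (use C(1) in auto)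
  qed (rule summable_on_cmult_left[OF summable_alpha])
  then show ?thesis unfolding infsum_cmult_left' theta_def power2_eq_square .
qed

text \<open>
  Compare two evaluations of the limit of \<open>bailey_beta (Suc p)\<close>: the limit inside its definition
  gives \<open>bailey_beta_LIMSEQ\<close>, and the limit inside the recursion \<open>bailey_beta_Suc\<close> gives the series
  in question, divided by \<open>(q^2;q^2)_infinity\<close>.
\<close>
lemma bailey_beta_sums:
  "((\<lambda>M. (q\<^sup>2) ^ (M\<^sup>2) * bailey_beta p M) has_sum (theta (Suc p) / qpoch_inf (q\<^sup>2) (q\<^sup>2))) UNIV"
proof -
  define y where "y = norm (q\<^sup>2)"
  have y: "0 \<le> y" "y < 1" using norm_Q by (auto simp: y_def)
  obtain C where C: "C > 0" "\<And>N. norm (bailey_beta p N) \<le> C" by (rule bailey_beta_bounded) auto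
  obtain D where D: "D > 0" "\<And>n. norm (recip_qfact (q\<^sup>2) n) \<le> D" by (rule bounded_recip_qfact) auto
  have geo: "(\<lambda>M. y ^ M * K) summable_on UNIV" for K
    by (rule summable_on_cmult_left) (use y in \<open>simp add: summable_on_UNIV_nonneg_real_iff summable_geometric\<close>)
  have pw: "norm ((q\<^sup>2) ^ (M\<^sup>2)) \<le> y ^ M" for M
    unfolding norm_power[of "q\<^sup>2"] y_def[symmetric]
    by (rule power_decreasing) (use y in \<open>auto simp: power2_eq_square\<close>)
  have "norm ((q\<^sup>2) ^ (M\<^sup>2) * bailey_beta p M) \<le> y ^ M * C" for M
    unfolding norm_mult by (intro mult_mono pw C(2)) (use y in auto)
  then have "(\<lambda>M. (q\<^sup>2) ^ (M\<^sup>2) * bailey_beta p M) summable_on UNIV"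
    by (intro abs_summable_summable[OF Infinite_Sum.abs_summable_on_comparison_test'[OF geo]])
  then have hs: "((\<lambda>M. (q\<^sup>2) ^ (M\<^sup>2) * bailey_beta p M) has_sum (\<Sum>\<^sub>\<infinity>M. (q\<^sup>2) ^ (M\<^sup>2) * bailey_beta p M)) UNIV"
    by (rule has_sum_infsum)
  have "(\<lambda>N. \<Sum>\<^sub>\<infinity>M. (q\<^sup>2) ^ (M\<^sup>2) * bailey_beta p M * recip_qfact (q\<^sup>2) (int N - int M)) \<longlonglongrightarrow>
        (\<Sum>\<^sub>\<infinity>M. (q\<^sup>2) ^ (M\<^sup>2) * bailey_beta p M * inverse (qpoch_inf (q\<^sup>2) (q\<^sup>2)))"
  proof (rule tannery_infsum[where h = "\<lambda>M. y ^ M * (C * D)"])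
    show "(\<lambda>N. (q\<^sup>2) ^ (M\<^sup>2) * bailey_beta p M * recip_qfact (q\<^sup>2) (int N - int M)) \<longlonglongrightarrow>
        (q\<^sup>2) ^ (M\<^sup>2) * bailey_beta p M * inverse (qpoch_inf (q\<^sup>2) (q\<^sup>2))" for M
      using recip_qfact_LIMSEQ[of "- int M"] by (intro tendsto_intros) simp
    show "norm ((q\<^sup>2) ^ (M\<^sup>2) * bailey_beta p M * recip_qfact (q\<^sup>2) (int N - int M)) \<le> y ^ M * (C * D)" for N M
      unfolding norm_mult mult.assoc by (intro mult_mono pw C(2) D(2)) (use y C D in auto)
  qed (rule geo)
  also have "(\<lambda>N. \<Sum>\<^sub>\<infinity>M. (q\<^sup>2) ^ (M\<^sup>2) * bailey_beta p M * recip_qfact (q\<^sup>2) (int N - int M)) = bailey_beta (Suc p)"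
  proof
    fix N
    have "(\<Sum>\<^sub>\<infinity>M. (q\<^sup>2) ^ (M\<^sup>2) * bailey_beta p M * recip_qfact (q\<^sup>2) (int N - int M)) =
      (\<Sum>M\<le>N. (q\<^sup>2) ^ (M\<^sup>2) * bailey_beta p M * recip_qfact (q\<^sup>2) (int N - int M))"
      by (rule infsum_finite_support) auto
    then show "(\<Sum>\<^sub>\<infinity>M. (q\<^sup>2) ^ (M\<^sup>2) * bailey_beta p M * recip_qfact (q\<^sup>2) (int N - int M)) = bailey_beta (Suc p) N"
      unfolding bailey_beta_Suc by (simp add: mult_ac)
  qed
  finally have "(\<Sum>\<^sub>\<infinity>M. (q\<^sup>2) ^ (M\<^sup>2) * bailey_beta p M * inverse (qpoch_inf (q\<^sup>2) (q\<^sup>2))) =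
      theta (Suc p) * (inverse (qpoch_inf (q\<^sup>2) (q\<^sup>2)))\<^sup>2"
    by (rule LIMSEQ_unique[OF _ bailey_beta_LIMSEQ])
  then have "(\<Sum>\<^sub>\<infinity>M. (q\<^sup>2) ^ (M\<^sup>2) * bailey_beta p M) = theta (Suc p) / qpoch_inf (q\<^sup>2) (q\<^sup>2)"
    unfolding infsum_cmult_left' using qpoch_inf_nonzero by (simp add: field_simps power2_eq_square)
  then show ?thesis using hs by simp
qed

text \<open>
  Enlarging the chains by one element is one Bailey step. A chain of \<open>p + 1\<close> elements gives only
  \<open>bailey_beta p\<close>, because the factor \<open>1 / (q^2;q^2)_(N - M)\<close> that completes the last step is absent.
\<close>
lemma sum_top_chains_weight:
  assumes F: "\<And>L. F L = qpoch (q\<^sup>2) (q\<^sup>2) (2 * L) * bailey_beta 0 L"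
  shows "(\<Sum>m\<in>top_chains (Suc p) M. chain_weight q (Suc p) m * F (m 1)) = (q\<^sup>2) ^ (M\<^sup>2) * bailey_beta p M"
proof (induction p arbitrary: M)
  case 0
  have nz: "qpoch (q\<^sup>2) (q\<^sup>2) (2 * M) \<noteq> 0" by (rule qpoch_nonzero)
  show ?case using nz by (simp add: top_chains_1 chain_weight_1 F)
next
  case (Suc p)
  have "(\<Sum>m\<in>top_chains (Suc (Suc p)) M. chain_weight q (Suc (Suc p)) m * F (m 1)) =
    (\<Sum>k\<le>M. \<Sum>m\<in>top_chains (Suc p) k. chain_weight q (Suc (Suc p)) (m(Suc (Suc p) := M)) * F (m 1))"
    by (subst sum_top_chains_Suc) auto
  also have "\<dots> = (\<Sum>k\<le>M. (q\<^sup>2) ^ (M\<^sup>2) * recip_qfact (q\<^sup>2) (int M - int k) *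
      (\<Sum>m\<in>top_chains (Suc p) k. chain_weight q (Suc p) m * F (m 1)))"
  proof (rule sum.cong[OF refl])
    fix k assume k: "k \<in> {..M}"
    have e: "recip_qfact (q\<^sup>2) (int M - int k) = 1 / qpoch (q\<^sup>2) (q\<^sup>2) (M - k)"
      using k by (simp add: recip_qfact_nonneg nat_diff_distrib flip: of_nat_diff)
    show "(\<Sum>m\<in>top_chains (Suc p) k. chain_weight q (Suc (Suc p)) (m(Suc (Suc p) := M)) * F (m 1)) =
      (q\<^sup>2) ^ (M\<^sup>2) * recip_qfact (q\<^sup>2) (int M - int k) * (\<Sum>m\<in>top_chains (Suc p) k. chain_weight q (Suc p) m * F (m 1))"
      unfolding sum_distrib_left
      by (rule sum.cong[OF refl]) (simp add: chain_weight_Suc e top_chains_def)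
  qed
  also have "\<dots> = (q\<^sup>2) ^ (M\<^sup>2) * bailey_beta (Suc p) M"
    unfolding Suc.IH bailey_beta_Suc sum_distrib_left by (simp add: mult_ac)
  finally show ?case .
qed

text \<open>
  The same recursion, with norms: each further element of the chain costs a constant factor, since the
  geometric series bounds the sum over the previous element.
\<close>
lemma sum_norm_chain_weight_le:
  obtains K where "K > 0" "\<And>M. (\<Sum>m\<in>top_chains (Suc p) M. norm (chain_weight q (Suc p) m)) \<le> K * norm (q\<^sup>2) ^ (M\<^sup>2)"
proof -
  define y where "y = norm (q\<^sup>2)"
  have y: "0 \<le> y" "y < 1" using norm_Q by (auto simp: y_def)
  obtain D where D: "D > 0" "\<And>n. norm (recip_qfact (q\<^sup>2) n) \<le> D" by (rule bounded_recip_qfact) auto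
  have D': "1 / norm (qpoch (q\<^sup>2) (q\<^sup>2) n) \<le> D" for n
    using D(2)[of "int n"] by (simp add: recip_qfact_nonneg norm_divide)
  have "\<exists>K>0. \<forall>M. (\<Sum>m\<in>top_chains (Suc p) M. norm (chain_weight q (Suc p) m)) \<le> K * y ^ (M\<^sup>2)"
  proof (induction p)
    case 0
    have "(\<Sum>m\<in>top_chains (Suc 0) M. norm (chain_weight q (Suc 0) m)) \<le> D * y ^ (M\<^sup>2)" for M
    proof -
      have "(\<Sum>m\<in>top_chains (Suc 0) M. norm (chain_weight q (Suc 0) m)) = y ^ (M\<^sup>2) * (1 / norm (qpoch (q\<^sup>2) (q\<^sup>2) (2 * M)))"
        by (simp add: top_chains_1 chain_weight_1 norm_divide norm_power y_def)
      also have "\<dots> \<le> y ^ (M\<^sup>2) * D" by (intro mult_left_mono D') (use y in auto)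
      finally show ?thesis by (simp add: mult.commute)
    qed
    then show ?case using D(1) by blast
  next
    case (Suc p)
    then obtain K where K: "K > 0" "\<And>M. (\<Sum>m\<in>top_chains (Suc p) M. norm (chain_weight q (Suc p) m)) \<le> K * y ^ (M\<^sup>2)"
      by blast
    have "(\<Sum>m\<in>top_chains (Suc (Suc p)) M. norm (chain_weight q (Suc (Suc p)) m)) \<le> (D * K * (1 / (1 - y))) * y ^ (M\<^sup>2)" for M
    proof -
      have "(\<Sum>m\<in>top_chains (Suc (Suc p)) M. norm (chain_weight q (Suc (Suc p)) m)) =
        (\<Sum>k\<le>M. \<Sum>m\<in>top_chains (Suc p) k. norm (chain_weight q (Suc (Suc p)) (m(Suc (Suc p) := M))))"
        by (subst sum_top_chains_Suc) auto
      also have "\<dots> = (\<Sum>k\<le>M. y ^ (M\<^sup>2) * (1 / norm (qpoch (q\<^sup>2) (q\<^sup>2) (M - k))) * (\<Sum>m\<in>top_chains (Suc p) k. norm (chain_weight q (Suc p) m)))"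
        unfolding sum_distrib_left
        by (intro sum.cong refl) (simp add: chain_weight_Suc top_chains_def norm_mult norm_divide norm_power y_def)
      also have "\<dots> \<le> (\<Sum>k\<le>M. y ^ (M\<^sup>2) * D * (K * y ^ k))"
      proof (intro sum_mono mult_mono D')
        fix k
        have "y ^ (k\<^sup>2) \<le> y ^ k" by (rule power_decreasing) (use y in \<open>auto simp: power2_eq_square\<close>)
        then show "(\<Sum>m\<in>top_chains (Suc p) k. norm (chain_weight q (Suc p) m)) \<le> K * y ^ k"
          using K(2)[of k] K(1) by (meson mult_left_mono order.trans less_imp_le)
      qed (use y D in \<open>auto intro!: sum_nonneg\<close>)
      also have "\<dots> = y ^ (M\<^sup>2) * D * K * (\<Sum>k\<le>M. y ^ k)"
        unfolding sum_distrib_left by (rule sum.cong) auto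
      also have "\<dots> \<le> y ^ (M\<^sup>2) * D * K * (1 / (1 - y))"
      proof (rule mult_left_mono)
        have "(\<Sum>k\<le>M. y ^ k) = (1 - y ^ Suc M) / (1 - y)" using y by (simp add: sum_gp0)
        also have "\<dots> \<le> 1 / (1 - y)" using y by (intro divide_right_mono) auto
        finally show "(\<Sum>k\<le>M. y ^ k) \<le> 1 / (1 - y)" .
      qed (use y D K in auto)
      finally show ?thesis by (simp add: mult_ac)
    qed
    moreover have "D * K * (1 / (1 - y)) > 0" using D(1) K(1) y by simp
    ultimately show ?case by blast
  qed
  then show ?thesis using that unfolding y_def by blast
qed

lemma triple_sum_eq_beta:
  assumes F: "(\<Sum>x\<in>triples L. f L x) = (\<Sum>\<^sub>\<infinity>x. \<alpha> x * qbinom (q\<^sup>2) (int (2 * L)) (int L - A x))"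
  shows "(\<Sum>x\<in>triples L. f L x) = qpoch (q\<^sup>2) (q\<^sup>2) (2 * L) * bailey_beta 0 L"
proof -
  have "\<alpha> x * qbinom (q\<^sup>2) (int (2 * L)) (int L - A x) = qpoch (q\<^sup>2) (q\<^sup>2) (2 * L) *
     (bailey_alpha 0 x * (recip_qfact (q\<^sup>2) (int L - A x) * recip_qfact (q\<^sup>2) (int L + A x)))" for x
  proof -
    have "int (2 * L) - (int L - A x) = int L + A x" "nat (int (2 * L)) = 2 * L" by linarith+
    then show ?thesis unfolding qbinom_eq bailey_alpha_def by simp
  qed
  then show ?thesis unfolding F bailey_beta_def by (simp add: infsum_cmult_right')
qed

theorem triple_sum_LIMSEQ:
  assumes F: "\<And>L. (\<Sum>x\<in>triples L. f L x) = (\<Sum>\<^sub>\<infinity>x. \<alpha> x * qbinom (q\<^sup>2) (int (2 * L)) (int L - A x))"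
  shows "(\<lambda>L. \<Sum>x\<in>triples L. f L x) \<longlonglongrightarrow> theta 0 / qpoch_inf (q\<^sup>2) (q\<^sup>2)"
proof -
  have "filterlim (\<lambda>L :: nat. 2 * L) at_top sequentially"
    by (rule filterlim_subseq) (simp add: strict_mono_def)
  then have "(\<lambda>L. qpoch (q\<^sup>2) (q\<^sup>2) (2 * L)) \<longlonglongrightarrow> qpoch_inf (q\<^sup>2) (q\<^sup>2)"
    by (rule filterlim_compose[OF qpoch_LIMSEQ])
  then have "(\<lambda>L. \<Sum>x\<in>triples L. f L x) \<longlonglongrightarrow> qpoch_inf (q\<^sup>2) (q\<^sup>2) * (theta 0 * (inverse (qpoch_inf (q\<^sup>2) (q\<^sup>2)))\<^sup>2)"
    unfolding triple_sum_eq_beta[of f, OF F] by (rule tendsto_mult[OF _ bailey_beta_LIMSEQ])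
  then show ?thesis using qpoch_inf_nonzero by (simp add: field_simps power2_eq_square)
qed

text \<open>
  A finite identity at the bottom determines the sum over all chains: the block of all chains with
  largest element \<open>M\<close> contributes \<open>q^(2M^2)\<close> times the value of \<open>bailey_beta\<close> at \<open>M\<close>.
\<close>
theorem chain_has_sum:
  assumes F: "\<And>L. (\<Sum>x\<in>triples L. f L x) = (\<Sum>\<^sub>\<infinity>x. \<alpha> x * qbinom (q\<^sup>2) (int (2 * L)) (int L - A x))"
    and bound: "\<And>L x. norm (f L x) \<le> B" and supp: "\<And>L x. x \<notin> triples L \<Longrightarrow> f L x = 0"
    and p: "p \<ge> 1"
  shows "((\<lambda>(x, m). chain_weight q p m * f (m 1) x) has_sum (theta p / qpoch_inf (q\<^sup>2) (q\<^sup>2))) (UNIV \<times> chains p)"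
proof -
  obtain p' where p': "p = Suc p'" using p by (cases p) auto
  obtain K where K: "K > 0" "\<And>M. (\<Sum>m\<in>top_chains p M. norm (chain_weight q p m)) \<le> K * norm (q\<^sup>2) ^ (M\<^sup>2)"
    unfolding p' by (rule sum_norm_chain_weight_le) auto
  have B: "B \<ge> 0" using bound[of 0 "(0,0,0)"] norm_ge_zero order_trans by blast
  have triples_mono: "x \<in> triples L" if "x \<in> triples (m 1)" "m \<in> top_chains p L" for x m L
    using that chain_le_top[OF that(2) p] by (auto simp: triples_def)
  show ?thesis
  proof (rule has_sum_finite_blocks[where E = "\<lambda>M. triples M \<times> top_chains p M"
        and h = "\<lambda>M. (B * K) * (real ((M + 1) ^ 3) * norm (q\<^sup>2) ^ (M\<^sup>2))"])
    show "finite (triples M \<times> top_chains p M)" for M using finite_top_chains[OF p] by simp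
    show "M = N" if "x \<in> triples M \<times> top_chains p M" "x \<in> triples N \<times> top_chains p N" for M N x
      using that by (auto simp: top_chains_def)
    show "triples M \<times> top_chains p M \<subseteq> UNIV \<times> chains p" for M by (auto simp: top_chains_def)
    fix y :: "(nat \<times> nat \<times> nat) \<times> (nat \<Rightarrow> nat)"
    assume y: "y \<in> UNIV \<times> chains p" "\<And>M. y \<notin> triples M \<times> top_chains p M"
    obtain x m where xm: "y = (x, m)" by (cases y)
    have "m \<in> top_chains p (m p)" using y xm by (auto simp: top_chains_def)
    then have "x \<notin> triples (m 1)" using y(2)[of "m p"] triples_mono[of x m "m p"] xm by auto
    then show "(case y of (x, m) \<Rightarrow> chain_weight q p m * f (m 1) x) = 0" using supp xm by simp
  next
    fix M
    have "(\<Sum>x\<in>triples M \<times> top_chains p M. norm (case x of (x, m) \<Rightarrow> chain_weight q p m * f (m 1) x))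
       \<le> (\<Sum>x\<in>triples M \<times> top_chains p M. B * norm (chain_weight q p (snd x)))"
    proof (intro sum_mono)
      fix x :: "(nat \<times> nat \<times> nat) \<times> (nat \<Rightarrow> nat)"
      have "norm (chain_weight q p (snd x)) * norm (f (snd x 1) (fst x)) \<le> norm (chain_weight q p (snd x)) * B"
        by (intro mult_left_mono bound) simp
      then show "norm (case x of (x, m) \<Rightarrow> chain_weight q p m * f (m 1) x) \<le> B * norm (chain_weight q p (snd x))"
        by (simp add: case_prod_unfold norm_mult mult.commute)
    qed
    also have "\<dots> = real (card (triples M)) * (B * (\<Sum>m\<in>top_chains p M. norm (chain_weight q p m)))"
    proof -
      have "(\<Sum>x\<in>triples M \<times> top_chains p M. B * norm (chain_weight q p (snd x))) =
        (\<Sum>x\<in>triples M. \<Sum>m\<in>top_chains p M. B * norm (chain_weight q p m))"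
        by (subst sum.cartesian_product) (simp add: case_prod_unfold)
      then show ?thesis by (simp add: sum_distrib_left)
    qed
    also have "\<dots> \<le> real (card (triples M)) * (B * (K * norm (q\<^sup>2) ^ (M\<^sup>2)))"
      by (intro mult_left_mono K B) auto
    also have "card (triples M) = (M + 1) ^ 3" by (simp add: triples_def power3_eq_cube)
    finally show "(\<Sum>x\<in>triples M \<times> top_chains p M. norm (case x of (x, m) \<Rightarrow> chain_weight q p m * f (m 1) x))
      \<le> (B * K) * (real ((M + 1) ^ 3) * norm (q\<^sup>2) ^ (M\<^sup>2))" by (simp only: mult_ac)
  next
    show "(\<lambda>M. (B * K) * (real ((M + 1) ^ 3) * norm (q\<^sup>2) ^ (M\<^sup>2))) summable_on UNIV"
      by (intro summable_on_cmult_right summable_cubic_geometric) (use norm_Q in auto)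
  next
    have "(\<Sum>x\<in>triples M \<times> top_chains p M. case x of (x, m) \<Rightarrow> chain_weight q p m * f (m 1) x) = (q\<^sup>2) ^ (M\<^sup>2) * bailey_beta p' M" for M
    proof -
      have "(\<Sum>x\<in>triples M \<times> top_chains p M. case x of (x, m) \<Rightarrow> chain_weight q p m * f (m 1) x) =
        (\<Sum>x\<in>triples M. \<Sum>m\<in>top_chains p M. chain_weight q p m * f (m 1) x)"
        by (rule sum.cartesian_product[symmetric])
      also have "\<dots> = (\<Sum>m\<in>top_chains p M. \<Sum>x\<in>triples M. chain_weight q p m * f (m 1) x)"
        by (rule sum.swap)
      also have "\<dots> = (\<Sum>m\<in>top_chains p M. chain_weight q p m * (\<Sum>x\<in>triples (m 1). f (m 1) x))"
        unfolding sum_distrib_left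
      proof (rule sum.cong[OF refl])
        fix m assume m: "m \<in> top_chains p M"
        show "(\<Sum>x\<in>triples M. chain_weight q p m * f (m 1) x) = (\<Sum>x\<in>triples (m 1). chain_weight q p m * f (m 1) x)"
          by (rule sum.mono_neutral_right) (use m triples_mono supp in auto)
      qed
      also have "\<dots> = (q\<^sup>2) ^ (M\<^sup>2) * bailey_beta p' M"
        unfolding p' by (rule sum_top_chains_weight) (rule triple_sum_eq_beta[of f, OF F])
      finally show ?thesis .
    qed
    then show "((\<lambda>M. \<Sum>x\<in>triples M \<times> top_chains p M. case x of (x, m) \<Rightarrow> chain_weight q p m * f (m 1) x)
      has_sum theta p / qpoch_inf (q\<^sup>2) (q\<^sup>2)) UNIV"
      using bailey_beta_sums[of p'] by (simp add: p')
  qed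
qed

text \<open>
  When there is no chain, the identity is obtained by letting \<open>L\<close> tend to infinity inside the sum
  over \<open>i\<close>, where \<open>[L;i]\<close> tends to \<open>1 / (q^2;q^2)_i\<close>.
\<close>
theorem row_has_sum:
  assumes F: "\<And>L. (\<Sum>(i, j, k)\<in>triples L. qbinom (q\<^sup>2) (int L) (int i) * g (i, j, k)) =
       (\<Sum>\<^sub>\<infinity>x. \<alpha> x * qbinom (q\<^sup>2) (int (2 * L)) (int L - A x))"
    and bound: "\<And>i j k. norm (g (i, j, k)) \<le> B * norm q ^ (i\<^sup>2)"
    and supp: "\<And>i j k. \<not> (j \<le> i \<and> k \<le> i) \<Longrightarrow> g (i, j, k) = 0"
  shows "((\<lambda>(i, j, k). g (i, j, k) / qpoch (q\<^sup>2) (q\<^sup>2) i) has_sum (theta 0 / qpoch_inf (q\<^sup>2) (q\<^sup>2))) UNIV"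
proof -
  obtain C where C: "C > 0" "\<And>n. norm (qpoch (q\<^sup>2) (q\<^sup>2) n) \<le> C" by (rule bounded_qpoch) auto
  obtain D where D: "D > 0" "\<And>n. norm (recip_qfact (q\<^sup>2) n) \<le> D" by (rule bounded_recip_qfact) auto
  have B: "B \<ge> 0" using order_trans[OF norm_ge_zero bound[of 0 0 0]] by simp
  define s where "s i = (\<Sum>x\<in>{..i} \<times> {..i}. g (i, x)) * recip_qfact (q\<^sup>2) (int i)" for i
  define h where "h i = (B * D) * (real ((i + 1) ^ 3) * norm q ^ (i\<^sup>2))" for i
  have h: "h summable_on UNIV" unfolding h_def
    by (intro summable_on_cmult_right summable_cubic_geometric) (use norm_q in auto)
  have dq: "g (i, x) / qpoch (q\<^sup>2) (q\<^sup>2) i = g (i, x) * recip_qfact (q\<^sup>2) (int i)" for i x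
    by (simp add: recip_qfact_nonneg)
  have absrow: "(\<Sum>x\<in>{..i} \<times> {..i}. norm (g (i, x) / qpoch (q\<^sup>2) (q\<^sup>2) i)) \<le> h i" for i
  proof -
    have "(\<Sum>x\<in>{..i} \<times> {..i}. norm (g (i, x) / qpoch (q\<^sup>2) (q\<^sup>2) i)) \<le>
      (\<Sum>x\<in>{..i} \<times> {..i}. B * norm q ^ (i\<^sup>2) * D)"
      unfolding dq norm_mult by (intro sum_mono mult_mono D(2)) (use bound B in auto)
    also have "\<dots> = real ((i + 1) ^ 2) * (B * D * norm q ^ (i\<^sup>2))" by (simp add: power2_eq_square)
    also have "\<dots> \<le> real ((i + 1) ^ 3) * (B * D * norm q ^ (i\<^sup>2))"
      by (intro mult_right_mono of_nat_mono power_increasing) (use B D in auto)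
    finally show ?thesis by (simp only: h_def mult_ac)
  qed
  have s_bound: "norm (s i) \<le> h i" for i
  proof -
    have "norm (s i) = norm (\<Sum>x\<in>{..i} \<times> {..i}. g (i, x) / qpoch (q\<^sup>2) (q\<^sup>2) i)"
      unfolding dq s_def sum_distrib_right ..
    also have "\<dots> \<le> (\<Sum>x\<in>{..i} \<times> {..i}. norm (g (i, x) / qpoch (q\<^sup>2) (q\<^sup>2) i))" by (rule norm_sum)
    finally show ?thesis using absrow[of i] by linarith
  qed
  have rows: "(\<Sum>(i, j, k)\<in>triples L. qbinom (q\<^sup>2) (int L) (int i) * g (i, j, k)) =
     (\<Sum>\<^sub>\<infinity>i. s i * (qpoch (q\<^sup>2) (q\<^sup>2) L * recip_qfact (q\<^sup>2) (int L - int i)))" for L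
  proof -
    have "(\<Sum>(i, j, k)\<in>triples L. qbinom (q\<^sup>2) (int L) (int i) * g (i, j, k)) =
      (\<Sum>i\<le>L. \<Sum>x\<in>{..L} \<times> {..L}. qbinom (q\<^sup>2) (int L) (int i) * g (i, x))"
      unfolding triples_def by (subst sum.cartesian_product) (simp add: case_prod_unfold)
    also have "\<dots> = (\<Sum>i\<le>L. s i * (qpoch (q\<^sup>2) (q\<^sup>2) L * recip_qfact (q\<^sup>2) (int L - int i)))"
    proof (rule sum.cong[OF refl])
      fix i assume i: "i \<in> {..L}"
      have "(\<Sum>x\<in>{..L} \<times> {..L}. qbinom (q\<^sup>2) (int L) (int i) * g (i, x)) =
        (\<Sum>x\<in>{..i} \<times> {..i}. qbinom (q\<^sup>2) (int L) (int i) * g (i, x))"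
        by (rule sum.mono_neutral_right) (use i supp in auto)
      then show "(\<Sum>x\<in>{..L} \<times> {..L}. qbinom (q\<^sup>2) (int L) (int i) * g (i, x)) =
        s i * (qpoch (q\<^sup>2) (q\<^sup>2) L * recip_qfact (q\<^sup>2) (int L - int i))"
        unfolding sum_distrib_left[symmetric] s_def by (simp add: qbinom_eq mult_ac)
    qed
    also have "\<dots> = (\<Sum>\<^sub>\<infinity>i. s i * (qpoch (q\<^sup>2) (q\<^sup>2) L * recip_qfact (q\<^sup>2) (int L - int i)))"
      by (rule infsum_finite_support[symmetric]) auto
    finally show ?thesis .
  qed
  have "(\<lambda>L. \<Sum>\<^sub>\<infinity>i. s i * (qpoch (q\<^sup>2) (q\<^sup>2) L * recip_qfact (q\<^sup>2) (int L - int i))) \<longlonglongrightarrow>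
     (\<Sum>\<^sub>\<infinity>i. s i * (qpoch_inf (q\<^sup>2) (q\<^sup>2) * inverse (qpoch_inf (q\<^sup>2) (q\<^sup>2))))"
  proof (rule tannery_infsum[where h = "\<lambda>i. h i * (C * D)"])
    show "(\<lambda>L. s i * (qpoch (q\<^sup>2) (q\<^sup>2) L * recip_qfact (q\<^sup>2) (int L - int i))) \<longlonglongrightarrow>
      s i * (qpoch_inf (q\<^sup>2) (q\<^sup>2) * inverse (qpoch_inf (q\<^sup>2) (q\<^sup>2)))" for i
      using recip_qfact_LIMSEQ[of "- int i"] by (intro tendsto_intros qpoch_LIMSEQ) simp
    show "norm (s i * (qpoch (q\<^sup>2) (q\<^sup>2) L * recip_qfact (q\<^sup>2) (int L - int i))) \<le> h i * (C * D)" for L i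
      unfolding norm_mult
      by (intro mult_mono s_bound C(2) D(2)) (use C D order_trans[OF norm_ge_zero s_bound] in auto)
  qed (rule summable_on_cmult_left[OF h])
  moreover have "(\<lambda>L. \<Sum>\<^sub>\<infinity>i. s i * (qpoch (q\<^sup>2) (q\<^sup>2) L * recip_qfact (q\<^sup>2) (int L - int i))) \<longlonglongrightarrow>
      theta 0 / qpoch_inf (q\<^sup>2) (q\<^sup>2)"
    using triple_sum_LIMSEQ[of "\<lambda>L (i, j, k). qbinom (q\<^sup>2) (int L) (int i) * g (i, j, k)", OF F] unfolding rows .
  ultimately have val: "(\<Sum>\<^sub>\<infinity>i. s i) = theta 0 / qpoch_inf (q\<^sup>2) (q\<^sup>2)"
    using LIMSEQ_unique qpoch_inf_nonzero by fastforce
  have "s summable_on UNIV"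
    by (rule abs_summable_summable[OF Infinite_Sum.abs_summable_on_comparison_test'[OF h]]) (rule s_bound)
  then have ss: "(s has_sum (theta 0 / qpoch_inf (q\<^sup>2) (q\<^sup>2))) UNIV"
    unfolding val[symmetric] by (rule has_sum_infsum)
  show ?thesis
  proof (rule has_sum_finite_blocks[where E = "\<lambda>i. {i} \<times> ({..i} \<times> {..i})" and h = h])
    have *: "(\<Sum>x\<in>{i} \<times> ({..i} \<times> {..i}). f x) = (\<Sum>x\<in>{..i} \<times> {..i}. f (i, x))" for f :: "_ \<Rightarrow> 'c :: comm_monoid_add" and i
      by (rule sum.reindex_bij_witness[of _ "\<lambda>x. (i, x)" snd]) auto
    show "(\<Sum>x\<in>{i} \<times> ({..i} \<times> {..i}). norm (case x of (i, j, k) \<Rightarrow> g (i, j, k) / qpoch (q\<^sup>2) (q\<^sup>2) i)) \<le> h i" for i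
      using absrow[of i] unfolding * by (simp add: case_prod_unfold)
    have "(\<Sum>x\<in>{i} \<times> ({..i} \<times> {..i}). case x of (i, j, k) \<Rightarrow> g (i, j, k) / qpoch (q\<^sup>2) (q\<^sup>2) i) = s i" for i
      unfolding * s_def sum_distrib_right using dq by (simp add: case_prod_unfold)
    then show "((\<lambda>i. \<Sum>x\<in>{i} \<times> ({..i} \<times> {..i}). case x of (i, j, k) \<Rightarrow> g (i, j, k) / qpoch (q\<^sup>2) (q\<^sup>2) i) has_sum
        theta 0 / qpoch_inf (q\<^sup>2) (q\<^sup>2)) UNIV" using ss by simp
    fix x :: "nat \<times> nat \<times> nat"
    assume x: "\<And>M. x \<notin> {M} \<times> ({..M} \<times> {..M})"
    obtain i j k where ijk: "x = (i, j, k)" by (cases x)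
    show "(case x of (i, j, k) \<Rightarrow> g (i, j, k) / qpoch (q\<^sup>2) (q\<^sup>2) i) = 0"
      using x[of i] supp[of j i k] by (auto simp: ijk)
  qed (use h in auto)
qed

end

section \<open>The Jacobi triple product\<close>

text \<open>
  The general term of Ramanujan's theta function \<open>f(-u, -v)\<close>. In contrast to the form with a
  quotient of \<open>u\<close> and \<open>v\<close>, it makes sense also if \<open>u\<close> or \<open>v\<close> is 0.
\<close>
definition ramanujan_term :: "complex \<Rightarrow> complex \<Rightarrow> int \<Rightarrow> complex" where
  "ramanujan_term u v n = (-1) powi n * (u ^ nat (n * (n + 1) div 2) * v ^ nat (n * (n - 1) div 2))"

lemma ramanujan_term_swap: "ramanujan_term u v (- n) = ramanujan_term v u n"
proof -
  have "- n * (- n + 1) = n * (n - 1)" "- n * (- n - 1) = n * (n + 1)" by (simp_all add: algebra_simps)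
  then show ?thesis by (simp add: ramanujan_term_def power_int_minus_one_minus mult_ac)
qed

lemma ramanujan_term_Suc:
  assumes "n \<ge> 0"
  shows "ramanujan_term u v (n + 1) = - u * (u * v) ^ nat n * ramanujan_term u v n"
proof -
  have "(n + 1) * (n + 1 + 1) = n * (n + 1) + (n + 1) * 2" by (simp add: algebra_simps)
  then have 1: "(n + 1) * (n + 1 + 1) div 2 = n * (n + 1) div 2 + (n + 1)" by simp
  have "(n + 1) * (n + 1 - 1) = n * (n - 1) + n * 2" by (simp add: algebra_simps)
  then have 2: "(n + 1) * (n + 1 - 1) div 2 = n * (n - 1) div 2 + n" by simp
  have nn: "n * (n - 1) \<ge> 0" using assms by (cases "n = 0") auto
  have 3: "nat (n * (n + 1) div 2 + (n + 1)) = nat (n * (n + 1) div 2) + Suc (nat n)"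
    using assms by (simp add: nat_add_distrib)
  have 4: "nat (n * (n - 1) div 2 + n) = nat (n * (n - 1) div 2) + nat n"
    using assms nn by (simp add: nat_add_distrib)
  have 5: "(-1 :: complex) powi (n + 1) = - ((-1) powi n)" by (simp add: power_int_add)
  show ?thesis
    unfolding ramanujan_term_def 1 2 3 4 5 by (simp add: power_add power_mult_distrib mult_ac)
qed

context nonroot
begin

text \<open>
  Two Pascal rules in one, for the step from \<open>2N\<close> to \<open>2N + 2\<close> in a central q-binomial coefficient:
  with \<open>A = Q^a\<close> and \<open>B = Q^b\<close>, it is an identity between polynomials in \<open>A\<close>, \<open>B\<close> and \<open>1/Q\<close>.
\<close>
lemma recip_qfact_three_term:
  assumes "a \<ge> 1" "b \<ge> 0"
  shows "(1 - Q ^ nat (a + b)) * (1 - Q ^ nat (a + b - 1)) * (recip_qfact Q a * recip_qfact Q b) =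
     (1 + Q ^ nat (a + b - 1)) * (recip_qfact Q (a - 1) * recip_qfact Q (b - 1))
     + Q ^ nat b * (recip_qfact Q (a - 2) * recip_qfact Q b) + Q ^ nat a * (recip_qfact Q a * recip_qfact Q (b - 2))"
proof -
  define A where "A = Q ^ nat (a - 1)"
  have a: "nat a = Suc (nat (a - 1))" using assms by simp
  have A: "Q ^ nat a = Q * A" unfolding a A_def by simp
  have r1: "recip_qfact Q (a - 1) = (1 - Q * A) * recip_qfact Q a"
    using recip_qfact_step_nat[of a] by (simp only: A)
  have r2: "recip_qfact Q (a - 2) = (1 - A) * ((1 - Q * A) * recip_qfact Q a)"
    using recip_qfact_step_nat[of "a - 1"] by (simp add: A_def r1[unfolded A_def])
  show ?thesis
  proof (cases "b = 0")
    case True then show ?thesis by (simp add: r2 A A_def[symmetric])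
  next
    case False
    define B where "B = Q ^ nat (b - 1)"
    have b: "nat b = Suc (nat (b - 1))" using assms False by simp
    have B: "Q ^ nat b = Q * B" unfolding b B_def by simp
    have s1: "recip_qfact Q (b - 1) = (1 - Q * B) * recip_qfact Q b"
      using recip_qfact_step_nat[of b] by (simp only: B)
    have s2: "recip_qfact Q (b - 2) = (1 - B) * ((1 - Q * B) * recip_qfact Q b)"
      using recip_qfact_step_nat[of "b - 1"] by (simp add: B_def s1[unfolded B_def])
    have "nat (a + b) = nat a + nat b" "nat (a + b - 1) = nat (a - 1) + nat b" using assms by auto
    then have ab: "Q ^ nat (a + b) = Q * A * (Q * B)" "Q ^ nat (a + b - 1) = A * (Q * B)"
      by (simp_all only: power_add A B A_def)
    show ?thesis unfolding ab A B r1 r2 s1 s2 by algebra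
  qed
qed

definition central_qbinom :: "nat \<Rightarrow> int \<Rightarrow> complex" where
  "central_qbinom N n = qpoch Q Q (2 * N) * (recip_qfact Q (int N + n) * recip_qfact Q (int N - n))"

lemma central_qbinom_sym: "central_qbinom N (- n) = central_qbinom N n"
  by (simp add: central_qbinom_def mult_ac)

lemma central_qbinom_eq_0: "\<bar>n\<bar> > int N \<Longrightarrow> central_qbinom N n = 0"
  by (auto simp: central_qbinom_def recip_qfact_def)

lemma central_qbinom_Suc:
  "central_qbinom (Suc N) n = (1 + Q ^ (2 * N + 1)) * central_qbinom N n
     + Q ^ nat (int N + 1 - n) * central_qbinom N (n - 1) + Q ^ nat (int N + 1 + n) * central_qbinom N (n + 1)"
proof -
  have nonneg: "central_qbinom (Suc N) n = (1 + Q ^ (2 * N + 1)) * central_qbinom N n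
     + Q ^ nat (int N + 1 - n) * central_qbinom N (n - 1) + Q ^ nat (int N + 1 + n) * central_qbinom N (n + 1)"
    if "n \<ge> 0" for n
  proof (cases "n \<le> int N + 1")
    case False then show ?thesis using that by (simp add: central_qbinom_eq_0)
  next
    case True
    define a where "a = int N + 1 + n"
    define b where "b = int N + 1 - n"
    have ab: "a \<ge> 1" "b \<ge> 0" using True that by (auto simp: a_def b_def)
    have e: "int (Suc N) + n = a" "int (Suc N) - n = b" "int N + n = a - 1" "int N - n = b - 1"
      "int N + (n - 1) = a - 2" "int N - (n - 1) = b" "int N + (n + 1) = a" "int N - (n + 1) = b - 2"
      by (auto simp: a_def b_def)
    have n1: "nat (a + b) = Suc (Suc (2 * N))" "nat (a + b - 1) = Suc (2 * N)" by (auto simp: a_def b_def)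
    have "2 * Suc N = Suc (Suc (2 * N))" by simp
    then have P: "qpoch Q Q (2 * Suc N) = (1 - Q ^ nat (a + b)) * (1 - Q ^ nat (a + b - 1)) * qpoch Q Q (2 * N)"
      unfolding n1 by (simp only: qpoch_Suc mult.assoc)
    have x: "Q ^ (2 * N + 1) = Q ^ nat (a + b - 1)" unfolding n1 by simp
    show ?thesis
      unfolding central_qbinom_def P e a_def[symmetric] b_def[symmetric] x
      using arg_cong[OF recip_qfact_three_term[OF ab], of "\<lambda>t. qpoch Q Q (2 * N) * t"]
      by (simp only: distrib_left mult_ac)
  qed
  show ?thesis
  proof (cases "n \<ge> 0")
    case True then show ?thesis by (rule nonneg)
  next
    case False
    have s: "central_qbinom N (- n - 1) = central_qbinom N (n + 1)" "central_qbinom N (- n + 1) = central_qbinom N (n - 1)"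
      using central_qbinom_sym[of N "n + 1"] central_qbinom_sym[of N "n - 1"] by (simp_all only: minus_add_distrib minus_diff_eq) simp_all
    have e: "int N + 1 - - n = int N + 1 + n" "int N + 1 + - n = int N + 1 - n" by simp_all
    have "- n \<ge> 0" using False by simp
    from nonneg[OF this, unfolded central_qbinom_sym s e] show ?thesis by simp
  qed
qed

text \<open>
  The powers of \<open>Q\<close> in \<open>central_qbinom_Suc\<close> are those that separate neighbouring terms of the theta
  series. Therefore the sum over \<open>n\<close> acquires the factor
  \<open>1 + Q^(2N+1) - (u + v) Q^N = (1 - u Q^N) (1 - v Q^N)\<close> when \<open>N\<close> grows by 1.
\<close>
lemma ramanujan_term_shift:
  assumes "Q = u * v"
  shows "ramanujan_term u v n * (Q ^ nat (int N + 1 - n) * central_qbinom N (n - 1)) =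
     - u * Q ^ N * (ramanujan_term u v (n - 1) * central_qbinom N (n - 1))"
proof (cases "\<bar>n - 1\<bar> > int N")
  case True then show ?thesis by (simp add: central_qbinom_eq_0)
next
  case False
  show ?thesis
  proof (cases "n \<ge> 1")
    case True
    have "nat (n - 1) + nat (int N + 1 - n) = N" using False True by linarith
    then have "Q ^ nat (n - 1) * Q ^ nat (int N + 1 - n) = Q ^ N" by (simp flip: power_add)
    then show ?thesis
      using ramanujan_term_Suc[of "n - 1" u v] True unfolding assms[symmetric] by simp
  next
    case neg: False
    have "nat (int N + 1 - n) = Suc (nat (- n) + N)" using neg by linarith
    then have "Q ^ nat (int N + 1 - n) = u * v * Q ^ nat (- n) * Q ^ N" using assms by (simp add: power_add)
    moreover have "ramanujan_term u v (n - 1) = - v * Q ^ nat (- n) * ramanujan_term u v n"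
      using ramanujan_term_Suc[of "- n" v u] neg ramanujan_term_swap[of u v "- n + 1"] ramanujan_term_swap[of v u n] assms
      by (simp add: mult.commute)
    ultimately show ?thesis by simp
  qed
qed

lemma ramanujan_term_shift':
  assumes "Q = u * v"
  shows "ramanujan_term u v n * (Q ^ nat (int N + 1 + n) * central_qbinom N (n + 1)) =
     - v * Q ^ N * (ramanujan_term u v (n + 1) * central_qbinom N (n + 1))"
proof -
  have e: "- n - 1 = - (n + 1)" by simp
  have "central_qbinom N (- n - 1) = central_qbinom N (n + 1)"
    unfolding e by (rule central_qbinom_sym)
  moreover have "ramanujan_term v u (- n - 1) = ramanujan_term u v (n + 1)"
    unfolding e by (rule ramanujan_term_swap)
  ultimately show ?thesis
    using ramanujan_term_shift[of v u "- n" N] assms ramanujan_term_swap[of v u n] by (simp add: mult.commute)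
qed

lemma finite_jacobi_triple_product:
  assumes Q: "Q = u * v"
  shows "(\<Sum>\<^sub>\<infinity>n. ramanujan_term u v n * central_qbinom N n) = qpoch u Q N * qpoch v Q N"
proof (induction N)
  case 0
  have "(\<Sum>\<^sub>\<infinity>n. ramanujan_term u v n * central_qbinom 0 n) = (\<Sum>n\<in>{0}. ramanujan_term u v n * central_qbinom 0 n)"
    by (rule infsum_finite_support) (auto intro!: central_qbinom_eq_0)
  then show ?case by (simp add: ramanujan_term_def central_qbinom_def qpoch_def)
next
  case (Suc N)
  define S where "S n = ramanujan_term u v n * central_qbinom N n" for n
  have S0: "S n = 0" if "n \<notin> {- int N..int N}" for n
    using that by (auto simp: S_def intro!: central_qbinom_eq_0)
  have s: "(\<lambda>n. c * S n) summable_on UNIV" "(\<lambda>n. c * S (n - 1)) summable_on UNIV" "(\<lambda>n. c * S (n + 1)) summable_on UNIV" for c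
    by (rule summable_finite_support[of "{- int N - 1..int N + 1}"]; use S0 in auto)+
  have sh: "(\<Sum>\<^sub>\<infinity>n. S (n - 1)) = (\<Sum>\<^sub>\<infinity>n. S n)" "(\<Sum>\<^sub>\<infinity>n. S (n + 1)) = (\<Sum>\<^sub>\<infinity>n. S n)"
    by (rule infsum_reindex_bij_witness[of _ "\<lambda>n. n + 1" "\<lambda>n. n - 1"]; simp)
       (rule infsum_reindex_bij_witness[of _ "\<lambda>n. n - 1" "\<lambda>n. n + 1"]; simp)
  have "ramanujan_term u v n * central_qbinom (Suc N) n = (1 + Q ^ (2 * N + 1)) * S n + (- u * Q ^ N) * S (n - 1) + (- v * Q ^ N) * S (n + 1)" for n
    using ramanujan_term_shift[OF Q, of n N] ramanujan_term_shift'[OF Q, of n N]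
    unfolding central_qbinom_Suc S_def distrib_left by (simp add: mult_ac)
  then have "(\<Sum>\<^sub>\<infinity>n. ramanujan_term u v n * central_qbinom (Suc N) n) =
     (\<Sum>\<^sub>\<infinity>n. (1 + Q ^ (2 * N + 1)) * S n + (- u * Q ^ N) * S (n - 1) + (- v * Q ^ N) * S (n + 1))" by simp
  also have "\<dots> = (1 + Q ^ (2 * N + 1)) * (\<Sum>\<^sub>\<infinity>n. S n) + (- u * Q ^ N) * (\<Sum>\<^sub>\<infinity>n. S n) + (- v * Q ^ N) * (\<Sum>\<^sub>\<infinity>n. S n)"
    by (subst infsum_add, intro summable_on_add s, rule s, subst infsum_add, rule s, rule s)
       (simp only: infsum_cmult_right' sh)
  also have "\<dots> = (1 - u * Q ^ N) * (1 - v * Q ^ N) * (qpoch u Q N * qpoch v Q N)"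
  proof -
    have "Q ^ (2 * N + 1) = u * v * Q ^ N * Q ^ N" using Q by (simp add: power_add mult_2)
    then show ?thesis unfolding S_def Suc.IH by (simp add: algebra_simps)
  qed
  also have "\<dots> = qpoch u Q (Suc N) * qpoch v Q (Suc N)" by (simp add: qpoch_def mult_ac)
  finally show ?case .
qed

end

lemma norm_ramanujan_term_le:
  assumes "norm u \<le> y" "norm v \<le> y" "y \<le> 1"
  shows "norm (ramanujan_term u v n) \<le> y ^ nat \<bar>n\<bar>"
proof -
  have y: "y \<ge> 0" using assms(1) norm_ge_zero order_trans by blast
  have nn: "n * (n + 1) \<ge> 0" "n * (n - 1) \<ge> 0"
    by (cases "n \<ge> 0"; cases "n = 0"; simp add: zero_le_mult_iff)+
  have "even (n * (n + 1))" "even (n * (n - 1))" by simp_all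
  then have half: "2 * (n * (n + 1) div 2) = n * (n + 1)" "2 * (n * (n - 1) div 2) = n * (n - 1)" by simp_all
  have "2 * (n * (n + 1) div 2 + n * (n - 1) div 2) = 2 * (n * n)"
    unfolding distrib_left half by (simp add: algebra_simps)
  then have e: "n * (n + 1) div 2 + n * (n - 1) div 2 = n * n" by (subst (asm) mult_cancel_left) simp
  have "\<bar>n\<bar> \<le> n * n" using int_abs_le_square[of n] by (simp add: power2_eq_square)
  then have m: "nat \<bar>n\<bar> \<le> nat (n * (n + 1) div 2) + nat (n * (n - 1) div 2)"
    using e nn by linarith
  have "norm (ramanujan_term u v n) = norm u ^ nat (n * (n + 1) div 2) * norm v ^ nat (n * (n - 1) div 2)"
    by (simp add: ramanujan_term_def norm_mult norm_power norm_power_int)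
  also have "\<dots> \<le> y ^ nat (n * (n + 1) div 2) * y ^ nat (n * (n - 1) div 2)"
    by (intro mult_mono power_mono assms) (use y in auto)
  also have "\<dots> \<le> y ^ nat \<bar>n\<bar>"
    unfolding power_add[symmetric] by (rule power_decreasing[OF m y assms(3)])
  finally show ?thesis .
qed

theorem jacobi_triple_product:
  assumes "norm u < 1" "norm v < 1"
  shows "(\<Sum>\<^sub>\<infinity>n. ramanujan_term u v n) = qpoch_inf (u * v) (u * v) * (qpoch_inf u (u * v) * qpoch_inf v (u * v))"
proof -
  define Q where "Q = u * v"
  define y where "y = max (norm u) (norm v)"
  have y: "norm u \<le> y" "norm v \<le> y" "y < 1" "y \<ge> 0" using assms by (auto simp: y_def le_max_iff_disj)
  have "norm u * norm v \<le> norm u * 1" using assms by (intro mult_left_mono) auto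
  then have "norm Q < 1" using assms(1) by (simp add: Q_def norm_mult)
  then interpret unit_disc Q by unfold_locales
  obtain C where C: "C > 0" "\<And>n. norm (qpoch Q Q n) \<le> C" by (rule bounded_qpoch) auto
  obtain D where D: "D > 0" "\<And>n. norm (recip_qfact Q n) \<le> D" by (rule bounded_recip_qfact) auto
  define c where "c = qpoch_inf Q Q * (inverse (qpoch_inf Q Q) * inverse (qpoch_inf Q Q))"
  have even_lim: "(\<lambda>N. qpoch Q Q (2 * N)) \<longlonglongrightarrow> qpoch_inf Q Q"
    by (rule filterlim_compose[OF qpoch_LIMSEQ]) (rule filterlim_subseq, simp add: strict_mono_def)
  have "(\<lambda>N. \<Sum>\<^sub>\<infinity>n. ramanujan_term u v n * central_qbinom N n) \<longlonglongrightarrow> (\<Sum>\<^sub>\<infinity>n. ramanujan_term u v n * c)"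
  proof (rule tannery_infsum[where h = "\<lambda>n. y ^ nat \<bar>n\<bar> * (C * (D * D))"])
    show "(\<lambda>N. ramanujan_term u v n * central_qbinom N n) \<longlonglongrightarrow> ramanujan_term u v n * c" for n
      unfolding central_qbinom_def c_def
      using recip_qfact_LIMSEQ[of n] recip_qfact_LIMSEQ[of "- n"] by (intro tendsto_intros even_lim) simp_all
    show "norm (ramanujan_term u v n * central_qbinom N n) \<le> y ^ nat \<bar>n\<bar> * (C * (D * D))" for N n
      unfolding central_qbinom_def norm_mult
      by (intro mult_mono C(2) D(2) norm_ramanujan_term_le) (use y C D in auto)
    show "(\<lambda>n :: int. y ^ nat \<bar>n\<bar> * (C * (D * D))) summable_on UNIV"
      by (intro summable_on_cmult_left summable_geometric_int) (use y in auto)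
  qed
  moreover have "(\<lambda>N. \<Sum>\<^sub>\<infinity>n. ramanujan_term u v n * central_qbinom N n) \<longlonglongrightarrow> qpoch_inf u Q * qpoch_inf v Q"
    unfolding finite_jacobi_triple_product[OF Q_def] by (intro tendsto_mult qpoch_LIMSEQ)
  ultimately have "(\<Sum>\<^sub>\<infinity>n. ramanujan_term u v n) * c = qpoch_inf u Q * qpoch_inf v Q"
    unfolding infsum_cmult_left' by (rule LIMSEQ_unique)
  then show ?thesis
    using qpoch_inf_nonzero unfolding c_def Q_def[symmetric] by (simp add: field_simps)
qed

text \<open>
  This is the triple product with \<open>u = q^a\<close> and \<open>v = q^b\<close>; every theta series of the four identities
  is brought to this form, with \<open>a + b\<close> equal to \<open>40 + 64p\<close> or \<open>24 + 64p\<close>.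
\<close>
lemma theta_sum_eq_product:
  fixes q :: complex and X :: "int \<Rightarrow> int"
  assumes q: "norm q < 1" and ab: "a > 0" "b > 0"
    and X: "\<And>n. 2 * X n = 2 * int c + int a * (n * (n + 1)) + int b * (n * (n - 1))"
  shows "(\<Sum>\<^sub>\<infinity>n. (-1) powi n * q ^ nat (X n)) =
    q ^ c * (qpoch_inf (q ^ (a + b)) (q ^ (a + b)) * qpochs_inf [q ^ b, q ^ a] (q ^ (a + b)))"
proof -
  have "(-1) powi n * q ^ nat (X n) = q ^ c * ramanujan_term (q ^ a) (q ^ b) n" for n
  proof -
    have nn: "n * (n + 1) \<ge> 0" "n * (n - 1) \<ge> 0"
      by (cases "n \<ge> 0"; cases "n = 0"; simp add: zero_le_mult_iff)+
    have "even (n * (n + 1))" "even (n * (n - 1))" by simp_all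
    then obtain s t where st: "n * (n + 1) = 2 * s" "n * (n - 1) = 2 * t" by (meson evenE)
    have "X n = int c + int a * s + int b * t" using X[of n] unfolding st by simp
    then have "X n = int (c + a * nat s + b * nat t)" using nn st by simp
    then have "nat (X n) = c + a * nat s + b * nat t" by (simp only: nat_int)
    then show ?thesis
      by (simp add: ramanujan_term_def st power_add power_mult mult_ac)
  qed
  then have "(\<Sum>\<^sub>\<infinity>n. (-1) powi n * q ^ nat (X n)) = q ^ c * (\<Sum>\<^sub>\<infinity>n. ramanujan_term (q ^ a) (q ^ b) n)"
    by (simp add: infsum_cmult_right')
  also have "(\<Sum>\<^sub>\<infinity>n. ramanujan_term (q ^ a) (q ^ b) n) =
    qpoch_inf (q ^ a * q ^ b) (q ^ a * q ^ b) * (qpoch_inf (q ^ a) (q ^ a * q ^ b) * qpoch_inf (q ^ b) (q ^ a * q ^ b))"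
    by (rule jacobi_triple_product) (use q ab in \<open>simp_all add: norm_power power_less_one_iff\<close>)
  finally show ?thesis by (simp add: qpochs_inf_def power_add mult_ac)
qed

section \<open>The theta series as products\<close>

definition theta_coeff :: "bool \<Rightarrow> nat \<Rightarrow> complex \<Rightarrow> int \<times> bool \<Rightarrow> complex" where
  "theta_coeff dual e q x = theta_sign x * q ^ nat (theta_exp dual e x)"

lemma bailey_theta_coeff:
  assumes "e \<le> 1" "norm q < 1"
  shows "bailey q (theta_coeff dual e q)"
proof
  show "(\<lambda>x. norm (theta_coeff dual e q x)) summable_on UNIV"
  proof (rule summable_on_times_bool(1))
    fix b
    show "(\<lambda>n. norm (theta_coeff dual e q (n, b))) summable_on UNIV"
    proof (rule Infinite_Sum.abs_summable_on_comparison_test')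
      show "(\<lambda>n :: int. norm q ^ nat \<bar>n\<bar>) summable_on UNIV"
        by (rule summable_geometric_int) (use assms in auto)
      show "norm (theta_coeff dual e q (n, b)) \<le> norm q ^ nat \<bar>n\<bar>" for n
        unfolding theta_coeff_def theta_sign_def norm_mult norm_power norm_power_int
        using assms(2) theta_exp_ge[OF assms(1), of n dual b]
        by (auto intro!: power_decreasing nat_mono)
    qed
  qed
qed (rule assms(2))

lemma theta_coeff_expansion:
  assumes "e \<le> 1" "norm q < 1"
  shows "(\<Sum>x\<in>triples L. q ^ nat (summand_exp dual e L x) * qbinom3 q e L x) =
     (\<Sum>\<^sub>\<infinity>x. theta_coeff dual e q x * qbinom (q\<^sup>2) (int (2 * L)) (int L - theta_pos e x))"
  unfolding finite_identity_unit_disc[OF assms] theta_coeff_def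
  by (rule infsum_finite_support[symmetric]) (use qbinom_outside_window[OF assms(1)] in auto)

lemma theta_eq:
  assumes "e \<le> 1" "norm q < 1"
  shows "bailey.theta q (theta_coeff dual e q) (theta_pos e) p =
    (\<Sum>\<^sub>\<infinity>n. (-1) powi n * q ^ nat (theta_exp dual e (n, False) + 2 * int p * (4 * n + int e)\<^sup>2)) +
    (\<Sum>\<^sub>\<infinity>n. (-1) powi n * q ^ nat (theta_exp dual e (n, True) + 2 * int p * (4 * n + int e + 1)\<^sup>2))"
proof -
  interpret bailey q "theta_coeff dual e q" "theta_pos e" by (rule bailey_theta_coeff[OF assms])
  have t: "bailey_alpha p (n, b) = (-1) powi n * q ^ nat (theta_exp dual e (n, b) + 2 * int p * (4 * n + int e + of_bool b)\<^sup>2)" for n b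
  proof -
    define a where "a = 4 * n + int e + of_bool b"
    have "nat (theta_exp dual e (n, b) + 2 * int p * a\<^sup>2) = nat (theta_exp dual e (n, b)) + 2 * (p * nat (a\<^sup>2))"
      using theta_exp_nonneg[OF assms(1), of dual n b] by (simp add: nat_add_distrib nat_mult_distrib)
    then show ?thesis
      unfolding bailey_alpha_def unfolding theta_coeff_def theta_sign_def theta_pos_def prod.case a_def[symmetric]
      by (simp add: power_add power_mult)
  qed
  have "theta p = (\<Sum>\<^sub>\<infinity>n. bailey_alpha p (n, False)) + (\<Sum>\<^sub>\<infinity>n. bailey_alpha p (n, True))"
    unfolding theta_def
  proof (rule summable_on_times_bool(2))
    fix b
    have "bailey_alpha p summable_on UNIV" using bailey_summable[of "\<lambda>_. 1" 1] by simp
    then have "bailey_alpha p summable_on range (\<lambda>n. (n, b))" by (rule summable_on_subset_banach) simp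
    then show "(\<lambda>n. bailey_alpha p (n, b)) summable_on UNIV"
      by (subst (asm) summable_on_reindex) (auto simp: inj_on_def o_def)
  qed
  then show ?thesis unfolding t by simp
qed

lemma theta_direct_0:
  assumes "norm q < 1"
  shows "bailey.theta q (theta_coeff False 0 q) (theta_pos 0) p =
    qpoch_inf (q ^ (40 + 64 * p)) (q ^ (40 + 64 * p)) *
      (qpochs_inf [q ^ (19 + 32 * p), q ^ (21 + 32 * p)] (q ^ (40 + 64 * p))
       + q ^ (1 + 2 * p) * qpochs_inf [q ^ (11 + 16 * p), q ^ (29 + 48 * p)] (q ^ (40 + 64 * p)))"
proof -
  have 1: "(\<Sum>\<^sub>\<infinity>n. (-1) powi n * q ^ nat (theta_exp False 0 (n, False) + 2 * int p * (4 * n + int 0)\<^sup>2)) =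
     q ^ 0 * (qpoch_inf (q ^ (21 + 32 * p + (19 + 32 * p))) (q ^ (21 + 32 * p + (19 + 32 * p))) *
       qpochs_inf [q ^ (19 + 32 * p), q ^ (21 + 32 * p)] (q ^ (21 + 32 * p + (19 + 32 * p))))"
    by (rule theta_sum_eq_product[OF assms]) (simp_all add: theta_exp_def power2_eq_square algebra_simps)
  have 2: "(\<Sum>\<^sub>\<infinity>n. (-1) powi n * q ^ nat (theta_exp False 0 (n, True) + 2 * int p * (4 * n + int 0 + 1)\<^sup>2)) =
     q ^ (1 + 2 * p) * (qpoch_inf (q ^ (29 + 48 * p + (11 + 16 * p))) (q ^ (29 + 48 * p + (11 + 16 * p))) *
       qpochs_inf [q ^ (11 + 16 * p), q ^ (29 + 48 * p)] (q ^ (29 + 48 * p + (11 + 16 * p))))"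
    by (rule theta_sum_eq_product[OF assms]) (simp_all add: theta_exp_def power2_eq_square algebra_simps)
  have e: "21 + 32 * p + (19 + 32 * p) = 40 + 64 * p" "29 + 48 * p + (11 + 16 * p) = 40 + 64 * p" by simp_all
  show ?thesis unfolding theta_eq[OF zero_le_one assms] 1 2 e by (simp add: algebra_simps)
qed

lemma theta_direct_1:
  assumes "norm q < 1"
  shows "bailey.theta q (theta_coeff False 1 q) (theta_pos 1) p =
    q ^ (1 + 2 * p) * qpoch_inf (q ^ (40 + 64 * p)) (q ^ (40 + 64 * p)) *
      (qpochs_inf [q ^ (9 + 16 * p), q ^ (31 + 48 * p)] (q ^ (40 + 64 * p))
       + q ^ (3 * (1 + 2 * p)) * qpochs_inf [q, q ^ (39 + 64 * p)] (q ^ (40 + 64 * p)))"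
proof -
  have 1: "(\<Sum>\<^sub>\<infinity>n. (-1) powi n * q ^ nat (theta_exp False 1 (n, False) + 2 * int p * (4 * n + int 1)\<^sup>2)) =
     q ^ (1 + 2 * p) * (qpoch_inf (q ^ (31 + 48 * p + (9 + 16 * p))) (q ^ (31 + 48 * p + (9 + 16 * p))) *
       qpochs_inf [q ^ (9 + 16 * p), q ^ (31 + 48 * p)] (q ^ (31 + 48 * p + (9 + 16 * p))))"
    by (rule theta_sum_eq_product[OF assms]) (simp_all add: theta_exp_def power2_eq_square algebra_simps)
  have 2: "(\<Sum>\<^sub>\<infinity>n. (-1) powi n * q ^ nat (theta_exp False 1 (n, True) + 2 * int p * (4 * n + int 1 + 1)\<^sup>2)) =
     q ^ (1 + 2 * p + 3 * (1 + 2 * p)) * (qpoch_inf (q ^ (39 + 64 * p + 1)) (q ^ (39 + 64 * p + 1)) *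
       qpochs_inf [q ^ 1, q ^ (39 + 64 * p)] (q ^ (39 + 64 * p + 1)))"
    by (rule theta_sum_eq_product[OF assms]) (simp_all add: theta_exp_def power2_eq_square algebra_simps)
  have e: "31 + 48 * p + (9 + 16 * p) = 40 + 64 * p" "39 + 64 * p + 1 = 40 + 64 * p" by simp_all
  show ?thesis unfolding theta_eq[OF order_refl assms] 1 2 e power_add[of q "1 + 2 * p"] power_one_right
    by (simp only: algebra_simps)
qed

lemma theta_dual_0:
  assumes "norm q < 1"
  shows "bailey.theta q (theta_coeff True 0 q) (theta_pos 0) p =
    qpoch_inf (q ^ (24 + 64 * p)) (q ^ (24 + 64 * p)) *
      (qpochs_inf [q ^ (11 + 32 * p), q ^ (13 + 32 * p)] (q ^ (24 + 64 * p))
       + q ^ (1 + 2 * p) * qpochs_inf [q ^ (5 + 16 * p), q ^ (19 + 48 * p)] (q ^ (24 + 64 * p)))"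
proof -
  have 1: "(\<Sum>\<^sub>\<infinity>n. (-1) powi n * q ^ nat (theta_exp True 0 (n, False) + 2 * int p * (4 * n + int 0)\<^sup>2)) =
     q ^ 0 * (qpoch_inf (q ^ (11 + 32 * p + (13 + 32 * p))) (q ^ (11 + 32 * p + (13 + 32 * p))) *
       qpochs_inf [q ^ (13 + 32 * p), q ^ (11 + 32 * p)] (q ^ (11 + 32 * p + (13 + 32 * p))))"
    by (rule theta_sum_eq_product[OF assms]) (simp_all add: theta_exp_def power2_eq_square algebra_simps)
  have 2: "(\<Sum>\<^sub>\<infinity>n. (-1) powi n * q ^ nat (theta_exp True 0 (n, True) + 2 * int p * (4 * n + int 0 + 1)\<^sup>2)) =
     q ^ (1 + 2 * p) * (qpoch_inf (q ^ (19 + 48 * p + (5 + 16 * p))) (q ^ (19 + 48 * p + (5 + 16 * p))) *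
       qpochs_inf [q ^ (5 + 16 * p), q ^ (19 + 48 * p)] (q ^ (19 + 48 * p + (5 + 16 * p))))"
    by (rule theta_sum_eq_product[OF assms]) (simp_all add: theta_exp_def power2_eq_square algebra_simps)
  have e: "11 + 32 * p + (13 + 32 * p) = 24 + 64 * p" "19 + 48 * p + (5 + 16 * p) = 24 + 64 * p" by simp_all
  have s: "qpochs_inf [x, y] z = qpochs_inf [y, x] z" for x y z by (simp add: qpochs_inf_def mult.commute)
  show ?thesis unfolding theta_eq[OF zero_le_one assms] 1 2 e s[of "q ^ (13 + 32 * p)"] by (simp add: algebra_simps)
qed

text \<open>
  In the second series, the linear coefficient of the exponent is too large for natural \<open>a\<close> and \<open>b\<close>.
  The substitution of \<open>-1 - n\<close> for \<open>n\<close> repairs this, and its sign is the minus sign of the last identity.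
\<close>
lemma theta_dual_1:
  assumes "norm q < 1"
  shows "bailey.theta q (theta_coeff True 1 q) (theta_pos 1) p =
    q ^ (1 + 2 * p) * qpoch_inf (q ^ (24 + 64 * p)) (q ^ (24 + 64 * p)) *
      (qpochs_inf [q ^ (7 + 16 * p), q ^ (17 + 48 * p)] (q ^ (24 + 64 * p))
       - q ^ (3 * (1 + 2 * p) - 1) * qpochs_inf [q, q ^ (23 + 64 * p)] (q ^ (24 + 64 * p)))"
proof -
  have 1: "(\<Sum>\<^sub>\<infinity>n. (-1) powi n * q ^ nat (theta_exp True 1 (n, False) + 2 * int p * (4 * n + int 1)\<^sup>2)) =
     q ^ (1 + 2 * p) * (qpoch_inf (q ^ (17 + 48 * p + (7 + 16 * p))) (q ^ (17 + 48 * p + (7 + 16 * p))) *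
       qpochs_inf [q ^ (7 + 16 * p), q ^ (17 + 48 * p)] (q ^ (17 + 48 * p + (7 + 16 * p))))"
    by (rule theta_sum_eq_product[OF assms]) (simp_all add: theta_exp_def power2_eq_square algebra_simps)
  define X where "X n = theta_exp True 1 (n, True) + 2 * int p * (4 * n + int 1 + 1)\<^sup>2" for n
  have "(\<Sum>\<^sub>\<infinity>n. (-1 :: complex) powi n * q ^ nat (X n)) = (\<Sum>\<^sub>\<infinity>n. (-1) powi (- 1 - n) * q ^ nat (X (- 1 - n)))"
    by (rule infsum_reindex_bij_witness[of _ "\<lambda>n. - 1 - n" "\<lambda>n. - 1 - n"]) auto
  also have "\<dots> = (\<Sum>\<^sub>\<infinity>n. - ((-1) powi n * q ^ nat (X (- 1 - n))))"
  proof (rule infsum_cong)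
    fix n :: int
    have "- 1 - n = - (n + 1)" by simp
    then have "(-1 :: complex) powi (- 1 - n) = (-1) powi (- (n + 1))" by (simp only:)
    also have "\<dots> = - ((-1) powi n)" unfolding power_int_minus_one_minus by (simp add: power_int_add)
    finally show "(-1 :: complex) powi (- 1 - n) * q ^ nat (X (- 1 - n)) = - ((-1) powi n * q ^ nat (X (- 1 - n)))"
      by simp
  qed
  also have "\<dots> = - (\<Sum>\<^sub>\<infinity>n. (-1) powi n * q ^ nat (X (- 1 - n)))"
    by (rule infsum_uminus)
  also have "(\<Sum>\<^sub>\<infinity>n. (-1) powi n * q ^ nat (X (- 1 - n))) =
     q ^ (1 + 2 * p + (3 * (1 + 2 * p) - 1)) * (qpoch_inf (q ^ (23 + 64 * p + 1)) (q ^ (23 + 64 * p + 1)) *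
       qpochs_inf [q ^ 1, q ^ (23 + 64 * p)] (q ^ (23 + 64 * p + 1)))"
    by (rule theta_sum_eq_product[OF assms]) (simp_all add: X_def theta_exp_def power2_eq_square algebra_simps)
  finally have 2: "(\<Sum>\<^sub>\<infinity>n. (-1 :: complex) powi n * q ^ nat (X n)) = - (q ^ (1 + 2 * p + (3 * (1 + 2 * p) - 1)) *
      (qpoch_inf (q ^ (23 + 64 * p + 1)) (q ^ (23 + 64 * p + 1)) *
       qpochs_inf [q ^ 1, q ^ (23 + 64 * p)] (q ^ (23 + 64 * p + 1))))" .
  have e: "17 + 48 * p + (7 + 16 * p) = 24 + 64 * p" "23 + 64 * p + 1 = 24 + 64 * p" by simp_all
  show ?thesis unfolding theta_eq[OF order_refl assms] 1 X_def[symmetric] 2 e power_add[of q "1 + 2 * p"] power_one_right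
    by (simp only: algebra_simps) simp
qed

lemma summand_bounded:
  assumes "norm q < 1"
  obtains B where "\<And>L x. norm (q ^ nat (summand_exp dual e L x) * qbinom3 q e L x) \<le> B"
proof -
  interpret unit_disc "q\<^sup>2" by unfold_locales (use assms in \<open>simp add: norm_power power_less_one_iff\<close>)
  obtain C where C: "C > 0" "\<And>n m. norm (qbinom (q\<^sup>2) n m) \<le> C" by (rule bounded_qbinom) auto
  have "norm (q ^ nat (summand_exp dual e L x) * qbinom3 q e L x) \<le> 1 * (C * (C * C))" for L x
    unfolding qbinom3_def case_prod_unfold norm_mult norm_power
    by (intro mult_mono C(2) power_le_one) (use assms C in auto)
  then show ?thesis by (rule that)
qed

theorem chain_identity:
  assumes "e \<le> 1" "norm q < 1" "p \<ge> 1"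
  shows "((\<lambda>(x, m). chain_weight q p m * (q ^ nat (summand_exp dual e (m 1) x) * qbinom3 q e (m 1) x))
     has_sum (bailey.theta q (theta_coeff dual e q) (theta_pos e) p / qpoch_inf (q\<^sup>2) (q\<^sup>2))) (UNIV \<times> chains p)"
proof -
  interpret bailey q "theta_coeff dual e q" "theta_pos e" by (rule bailey_theta_coeff[OF assms(1,2)])
  obtain B where B: "\<And>L x. norm (q ^ nat (summand_exp dual e L x) * qbinom3 q e L x) \<le> B"
    by (rule summand_bounded[OF assms(2), where dual = dual and e = e]) auto
  show ?thesis
    by (rule chain_has_sum[where f = "\<lambda>L x. q ^ nat (summand_exp dual e L x) * qbinom3 q e L x",
          OF theta_coeff_expansion[OF assms(1,2)] B _ assms(3)]) (simp add: qbinom3_outside)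
qed

lemma direct_chain_term:
  "q ^ (2 * (\<Sum>r=1..p. (m r)\<^sup>2) + i\<^sup>2 + j\<^sup>2 + k\<^sup>2 + 2 * e * j) / chain_denom q p m
     * qbinom (q\<^sup>2) (int (m 1)) (int i) * qbinom (q\<^sup>2) (int i - int k - int e) (int j) * qbinom (q\<^sup>2) (int j) (int k)
   = chain_weight q p m * (q ^ nat (summand_exp False e (m 1) (i, j, k)) * qbinom3 q e (m 1) (i, j, k))"
proof -
  have "summand_exp False e (m 1) (i, j, k) = int (i\<^sup>2 + j\<^sup>2 + k\<^sup>2 + 2 * e * j)"
    by (simp add: summand_exp_def)
  then have "nat (summand_exp False e (m 1) (i, j, k)) = i\<^sup>2 + j\<^sup>2 + k\<^sup>2 + 2 * e * j" by (simp only: nat_int)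
  then show ?thesis
    by (simp add: chain_weight_def qbinom3_def power_add flip: power_mult)
qed

text \<open>
  The integer exponent may be negative where the q-binomial coefficients vanish. Everywhere else it
  is a natural number, so that it can be split also at \<open>q = 0\<close>.
\<close>
lemma dual_chain_term:
  assumes "p \<ge> 1"
  shows "q powi (2 * (\<Sum>r=2..p. (int (m r))\<^sup>2) + 4 * (int (m 1))\<^sup>2 - 2 * int i * int (m 1)
                    + (int i)\<^sup>2 - 2 * int i * int j + (int j)\<^sup>2 + (int k)\<^sup>2) / chain_denom q p m
     * qbinom (q\<^sup>2) (int (m 1)) (int i) * qbinom (q\<^sup>2) (int i - int k - int e) (int j) * qbinom (q\<^sup>2) (int j) (int k)
   = chain_weight q p m * (q ^ nat (summand_exp True e (m 1) (i, j, k)) * qbinom3 q e (m 1) (i, j, k))"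
proof (cases "i \<le> m 1")
  case False
  then have "qbinom3 q e (m 1) (i, j, k) = 0" "qbinom (q\<^sup>2) (int (m 1)) (int i) = 0"
    using qbinom3_support[of q e "m 1" i j k] by (auto simp: qbinom_def)
  then show ?thesis by simp
next
  case True
  have nn: "summand_exp True e (m 1) (i, j, k) \<ge> 0" by (rule summand_exp_nonneg[OF True])
  have s: "(\<Sum>r=1..p. (m r)\<^sup>2) = (m 1)\<^sup>2 + (\<Sum>r=2..p. (m r)\<^sup>2)"
    using assms by (subst sum.atLeast_Suc_atMost) (simp_all add: numeral_2_eq_2)
  have s': "(\<Sum>r=2..p. (int (m r))\<^sup>2) = int (\<Sum>r=2..p. (m r)\<^sup>2)" by simp
  have "2 * (\<Sum>r=2..p. (int (m r))\<^sup>2) + 4 * (int (m 1))\<^sup>2 - 2 * int i * int (m 1)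
      + (int i)\<^sup>2 - 2 * int i * int j + (int j)\<^sup>2 + (int k)\<^sup>2 =
     int (2 * (\<Sum>r=1..p. (m r)\<^sup>2)) + summand_exp True e (m 1) (i, j, k)"
    unfolding s s' by (simp add: summand_exp_def)
  also have "\<dots> = int (2 * (\<Sum>r=1..p. (m r)\<^sup>2) + nat (summand_exp True e (m 1) (i, j, k)))" using nn by simp
  finally have e: "q powi (2 * (\<Sum>r=2..p. (int (m r))\<^sup>2) + 4 * (int (m 1))\<^sup>2 - 2 * int i * int (m 1)
      + (int i)\<^sup>2 - 2 * int i * int j + (int j)\<^sup>2 + (int k)\<^sup>2) =
     (q\<^sup>2) ^ (\<Sum>r=1..p. (m r)\<^sup>2) * q ^ nat (summand_exp True e (m 1) (i, j, k))"
    by (simp only: power_int_of_nat power_add power_mult)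
  show ?thesis unfolding e by (simp add: chain_weight_def qbinom3_def)
qed

theorem direct_start_has_sum:
  assumes "e \<le> 1" "norm q < 1"
  shows "((\<lambda>(i::nat, j::nat, k::nat). q ^ (i\<^sup>2 + j\<^sup>2 + k\<^sup>2 + 2 * e * j) / qpoch (q\<^sup>2) (q\<^sup>2) i
            * qbinom (q\<^sup>2) (int i - int k - int e) (int j) * qbinom (q\<^sup>2) (int j) (int k))
         has_sum (bailey.theta q (theta_coeff False e q) (theta_pos e) 0 / qpoch_inf (q\<^sup>2) (q\<^sup>2))) UNIV"
proof -
  interpret bailey q "theta_coeff False e q" "theta_pos e" by (rule bailey_theta_coeff[OF assms])
  define g where "g = (\<lambda>(i::nat, j::nat, k::nat). q ^ (i\<^sup>2 + j\<^sup>2 + k\<^sup>2 + 2 * e * j) *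
      (qbinom (q\<^sup>2) (int i - int k - int e) (int j) * qbinom (q\<^sup>2) (int j) (int k)))"
  obtain C where C: "C > 0" "\<And>n m. norm (qbinom (q\<^sup>2) n m) \<le> C" by (rule bounded_qbinom) auto
  have gx: "qbinom (q\<^sup>2) (int L) (int i) * g (i, j, k) = q ^ nat (summand_exp False e L (i, j, k)) * qbinom3 q e L (i, j, k)" for L i j k
  proof -
    have "summand_exp False e L (i, j, k) = int (i\<^sup>2 + j\<^sup>2 + k\<^sup>2 + 2 * e * j)"
      by (simp add: summand_exp_def)
    then have "nat (summand_exp False e L (i, j, k)) = i\<^sup>2 + j\<^sup>2 + k\<^sup>2 + 2 * e * j" by (simp only: nat_int)
    then show ?thesis by (simp add: g_def qbinom3_def)
  qed
  have "((\<lambda>(i, j, k). g (i, j, k) / qpoch (q\<^sup>2) (q\<^sup>2) i) has_sum (theta 0 / qpoch_inf (q\<^sup>2) (q\<^sup>2))) UNIV"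
  proof (rule row_has_sum[where B = "C * C"])
    show "(\<Sum>(i, j, k)\<in>triples L. qbinom (q\<^sup>2) (int L) (int i) * g (i, j, k)) =
       (\<Sum>\<^sub>\<infinity>x. theta_coeff False e q x * qbinom (q\<^sup>2) (int (2 * L)) (int L - theta_pos e x))" for L
      unfolding gx theta_coeff_expansion[OF assms, symmetric] by (simp add: case_prod_unfold)
    fix i j k :: nat
    have "norm (q ^ (i\<^sup>2 + j\<^sup>2 + k\<^sup>2 + 2 * e * j)) \<le> norm q ^ (i\<^sup>2)"
      unfolding norm_power by (rule power_decreasing) (use assms(2) in auto)
    then have "norm (g (i, j, k)) \<le> norm q ^ (i\<^sup>2) * (C * C)"
      unfolding g_def prod.case norm_mult by (intro mult_mono C(2)) (use C in auto)
    then show "norm (g (i, j, k)) \<le> C * C * norm q ^ (i\<^sup>2)" by (simp add: mult_ac)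
    show "g (i, j, k) = 0" if "\<not> (j \<le> i \<and> k \<le> i)"
      using that by (auto simp: g_def qbinom_def)
  qed
  then show ?thesis by (simp add: g_def case_prod_unfold mult.assoc)
qed

theorem dual_start_LIMSEQ:
  assumes "e \<le> 1" "norm q < 1"
  shows "(\<lambda>L::nat. \<Sum>\<^sub>\<infinity>(i::nat, j::nat, k::nat)\<in>UNIV.
            q powi (2 * (int L)\<^sup>2 + (int i)\<^sup>2 - 2 * int i * int j + (int j)\<^sup>2 + (int k)\<^sup>2 - 2 * int i * int L)
            * qbinom (q\<^sup>2) (int L) (int i)
            * qbinom (q\<^sup>2) (int i - int k - int e) (int j) * qbinom (q\<^sup>2) (int j) (int k))
     \<longlonglongrightarrow> bailey.theta q (theta_coeff True e q) (theta_pos e) 0 / qpoch_inf (q\<^sup>2) (q\<^sup>2)"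
proof -
  interpret bailey q "theta_coeff True e q" "theta_pos e" by (rule bailey_theta_coeff[OF assms])
  have tm: "q powi (2 * (int L)\<^sup>2 + (int i)\<^sup>2 - 2 * int i * int j + (int j)\<^sup>2 + (int k)\<^sup>2 - 2 * int i * int L)
            * qbinom (q\<^sup>2) (int L) (int i)
            * qbinom (q\<^sup>2) (int i - int k - int e) (int j) * qbinom (q\<^sup>2) (int j) (int k)
      = q ^ nat (summand_exp True e L (i, j, k)) * qbinom3 q e L (i, j, k)" for L i j k
  proof (cases "i \<le> L")
    case True
    have "2 * (int L)\<^sup>2 + (int i)\<^sup>2 - 2 * int i * int j + (int j)\<^sup>2 + (int k)\<^sup>2 - 2 * int i * int L = summand_exp True e L (i, j, k)"
      by (simp add: summand_exp_def)
    then show ?thesis using summand_exp_nonneg[OF True, of True e j k]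
      by (simp add: qbinom3_def power_int_nonneg_exp)
  next
    case False then show ?thesis by (simp add: qbinom3_def qbinom_def)
  qed
  have "(\<Sum>\<^sub>\<infinity>(i::nat, j::nat, k::nat)\<in>UNIV. q ^ nat (summand_exp True e L (i, j, k)) * qbinom3 q e L (i, j, k)) =
     (\<Sum>x\<in>triples L. q ^ nat (summand_exp True e L x) * qbinom3 q e L x)" for L
  proof -
    have "(\<Sum>\<^sub>\<infinity>(i::nat, j::nat, k::nat)\<in>UNIV. q ^ nat (summand_exp True e L (i, j, k)) * qbinom3 q e L (i, j, k)) =
      (\<Sum>\<^sub>\<infinity>x. q ^ nat (summand_exp True e L x) * qbinom3 q e L x)" by (simp add: case_prod_unfold)
    also have "\<dots> = (\<Sum>x\<in>triples L. q ^ nat (summand_exp True e L x) * qbinom3 q e L x)"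
      by (rule infsum_finite_support) (auto simp: qbinom3_outside)
    finally show ?thesis .
  qed
  then show ?thesis unfolding tm
    using triple_sum_LIMSEQ[OF theta_coeff_expansion[OF assms]] by simp
qed

theorem theorem1p4:
  fixes q :: complex and p :: nat
  assumes "norm q < 1"
  shows
   "lhs1_is q p
      (qpoch_inf (q ^ (40 + 64 * p)) (q ^ (40 + 64 * p)) / qpoch_inf (q ^ 2) (q ^ 2)
       * (qpochs_inf [q ^ (19 + 32 * p), q ^ (21 + 32 * p)] (q ^ (40 + 64 * p))
          + q ^ (1 + 2 * p)
            * qpochs_inf [q ^ (11 + 16 * p), q ^ (29 + 48 * p)] (q ^ (40 + 64 * p))))
  \<and> lhs2_is q p
      (q ^ (1 + 2 * p)
       * (qpoch_inf (q ^ (40 + 64 * p)) (q ^ (40 + 64 * p)) / qpoch_inf (q ^ 2) (q ^ 2))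
       * (qpochs_inf [q ^ (9 + 16 * p), q ^ (31 + 48 * p)] (q ^ (40 + 64 * p))
          + q ^ (3 * (1 + 2 * p))
            * qpochs_inf [q, q ^ (39 + 64 * p)] (q ^ (40 + 64 * p))))
  \<and> lhs3_is q p
      (qpoch_inf (q ^ (24 + 64 * p)) (q ^ (24 + 64 * p)) / qpoch_inf (q ^ 2) (q ^ 2)
       * (qpochs_inf [q ^ (11 + 32 * p), q ^ (13 + 32 * p)] (q ^ (24 + 64 * p))
          + q ^ (1 + 2 * p)
            * qpochs_inf [q ^ (5 + 16 * p), q ^ (19 + 48 * p)] (q ^ (24 + 64 * p))))
  \<and> lhs4_is q p
      (q ^ (1 + 2 * p)
       * (qpoch_inf (q ^ (24 + 64 * p)) (q ^ (24 + 64 * p)) / qpoch_inf (q ^ 2) (q ^ 2))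
       * (qpochs_inf [q ^ (7 + 16 * p), q ^ (17 + 48 * p)] (q ^ (24 + 64 * p))
          - q ^ (3 * (1 + 2 * p) - 1)
            * qpochs_inf [q, q ^ (23 + 64 * p)] (q ^ (24 + 64 * p))))"
proof (intro conjI)
  note q = assms
  have direct: "((\<lambda>((i::nat, j::nat, k::nat), m). q ^ (2 * (\<Sum>r=1..p. (m r)\<^sup>2) + i\<^sup>2 + j\<^sup>2 + k\<^sup>2 + 2 * e * j) / chain_denom q p m
     * qbinom (q\<^sup>2) (int (m 1)) (int i) * qbinom (q\<^sup>2) (int i - int k - int e) (int j) * qbinom (q\<^sup>2) (int j) (int k))
     has_sum (bailey.theta q (theta_coeff False e q) (theta_pos e) p / qpoch_inf (q\<^sup>2) (q\<^sup>2))) (UNIV \<times> chains p)"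
    if "e \<le> 1" "p \<ge> 1" for e
    using chain_identity[OF that(1) q that(2), of False] unfolding direct_chain_term by (simp add: case_prod_unfold)
  have dual: "((\<lambda>((i::nat, j::nat, k::nat), m). q powi (2 * (\<Sum>r=2..p. (int (m r))\<^sup>2) + 4 * (int (m 1))\<^sup>2 - 2 * int i * int (m 1)
                    + (int i)\<^sup>2 - 2 * int i * int j + (int j)\<^sup>2 + (int k)\<^sup>2) / chain_denom q p m
     * qbinom (q\<^sup>2) (int (m 1)) (int i) * qbinom (q\<^sup>2) (int i - int k - int e) (int j) * qbinom (q\<^sup>2) (int j) (int k))
     has_sum (bailey.theta q (theta_coeff True e q) (theta_pos e) p / qpoch_inf (q\<^sup>2) (q\<^sup>2))) (UNIV \<times> chains p)"
    if "e \<le> 1" "p \<ge> 1" for e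
    using chain_identity[OF that(1) q that(2), of True] unfolding dual_chain_term[OF that(2)] by (simp add: case_prod_unfold)
  show "lhs1_is q p
      (qpoch_inf (q ^ (40 + 64 * p)) (q ^ (40 + 64 * p)) / qpoch_inf (q ^ 2) (q ^ 2)
       * (qpochs_inf [q ^ (19 + 32 * p), q ^ (21 + 32 * p)] (q ^ (40 + 64 * p))
          + q ^ (1 + 2 * p)
            * qpochs_inf [q ^ (11 + 16 * p), q ^ (29 + 48 * p)] (q ^ (40 + 64 * p))))"
    using direct_start_has_sum[OF zero_le_one q] direct[of 0] theta_direct_0[OF q, of p]
    by (auto simp: lhs1_is_def)
  show "lhs2_is q p
      (q ^ (1 + 2 * p)
       * (qpoch_inf (q ^ (40 + 64 * p)) (q ^ (40 + 64 * p)) / qpoch_inf (q ^ 2) (q ^ 2))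
       * (qpochs_inf [q ^ (9 + 16 * p), q ^ (31 + 48 * p)] (q ^ (40 + 64 * p))
          + q ^ (3 * (1 + 2 * p))
            * qpochs_inf [q, q ^ (39 + 64 * p)] (q ^ (40 + 64 * p))))"
    using direct_start_has_sum[OF order_refl q] direct[of 1] theta_direct_1[OF q, of p]
    by (auto simp: lhs2_is_def)
  show "lhs3_is q p
      (qpoch_inf (q ^ (24 + 64 * p)) (q ^ (24 + 64 * p)) / qpoch_inf (q ^ 2) (q ^ 2)
       * (qpochs_inf [q ^ (11 + 32 * p), q ^ (13 + 32 * p)] (q ^ (24 + 64 * p))
          + q ^ (1 + 2 * p)
            * qpochs_inf [q ^ (5 + 16 * p), q ^ (19 + 48 * p)] (q ^ (24 + 64 * p))))"
    using dual_start_LIMSEQ[OF zero_le_one q] dual[of 0] theta_dual_0[OF q, of p]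
    by (auto simp: lhs3_is_def)
  show "lhs4_is q p
      (q ^ (1 + 2 * p)
       * (qpoch_inf (q ^ (24 + 64 * p)) (q ^ (24 + 64 * p)) / qpoch_inf (q ^ 2) (q ^ 2))
       * (qpochs_inf [q ^ (7 + 16 * p), q ^ (17 + 48 * p)] (q ^ (24 + 64 * p))
          - q ^ (3 * (1 + 2 * p) - 1)
            * qpochs_inf [q, q ^ (23 + 64 * p)] (q ^ (24 + 64 * p))))"
    using dual_start_LIMSEQ[OF order_refl q] dual[of 1] theta_dual_1[OF q, of p]
    by (auto simp: lhs4_is_def)
qed

end
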